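(* Let $A$ be either a nuclear $C^*$-algebra or an injective von Neumann algebra, let $n\ge1$, and let $I_{E_n}=vw$ be a factorization of the identity of $E_n$ through $A$, i.e. $w\colon E_n\to A$ and $v\colon A\to E_n$ are linear maps with $vw=I_{E_n}$. Then $$\|v\|_{cb}\|w\|_{cb}\ge\tfrac12(1+\sqrt n).$$
   Context: $E_n\subset M_n\oplus M_n$ (with norm $\max\{\|x\|,\|y\|\}$, block-diagonal in $M_{2n}$) is the operator space spanned by $\delta_i=e_{i1}\oplus e_{1i}$, $1\le i\le n$, where $(e_{ij})$ are the matrix units of $M_n$. $\|\cdot\|_{cb}$ is the completely bounded norm. *)

theory Defs
  imports
    "HOL-Analysis.Bounded_Linear_Function"
    "HOL-Library.Extended_Nonnegative_Real"
    "Jordan_Normal_Form.Matrix"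
begin

section \<open>Complex Hilbert spaces and bounded operators\<close>

text \<open>The inner product is antilinear in its first argument. Completeness is part of \<^class>\<open>banach\<close>;
  positive definiteness follows from the last axiom.\<close>

class complex_hilbert_space = banach +
  fixes scaleC :: "complex \<Rightarrow> 'a \<Rightarrow> 'a"
    and cinner :: "'a \<Rightarrow> 'a \<Rightarrow> complex"
  assumes scaleC_add_right: "scaleC a (x + y) = scaleC a x + scaleC a y"
    and scaleC_add_left: "scaleC (a + b) x = scaleC a x + scaleC b x"
    and scaleC_scaleC: "scaleC a (scaleC b x) = scaleC (a * b) x"
    and scaleC_of_real: "scaleC (complex_of_real r) x = scaleR r x"
    and cinner_commute: "cinner x y = cnj (cinner y x)"
    and cinner_add_right: "cinner x (y + z) = cinner x y + cinner x z"
    and cinner_scaleC_right: "cinner x (scaleC a y) = a * cinner x y"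
    and cinner_self: "cinner x x = complex_of_real ((norm x)\<^sup>2)"

instantiation complex :: complex_hilbert_space
begin

definition scaleC_complex :: "complex \<Rightarrow> complex \<Rightarrow> complex" where
  "scaleC_complex a x = a * x"

definition cinner_complex :: "complex \<Rightarrow> complex \<Rightarrow> complex" where
  "cinner_complex x y = cnj x * y"

instance
  by standard
    (auto simp: scaleC_complex_def cinner_complex_def algebra_simps scaleR_conv_of_real
      complex_norm_square simp del: of_real_power)

end

lemma norm_scaleC:
  fixes x :: "'h::complex_hilbert_space"
  shows "norm (scaleC a x) = cmod a * norm x"
proof -
  have "cinner (scaleC a x) x = cnj a * cinner x x"
    by (metis cinner_commute cinner_scaleC_right complex_cnj_mult)
  then have "cinner (scaleC a x) (scaleC a x) = a * (cnj a * cinner x x)"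
    by (simp add: cinner_scaleC_right)
  then have "complex_of_real ((norm (scaleC a x))\<^sup>2) = complex_of_real ((cmod a * norm x)\<^sup>2)"
    by (simp only: cinner_self of_real_mult power_mult_distrib complex_norm_square mult.assoc)
  then have "(norm (scaleC a x))\<^sup>2 = (cmod a * norm x)\<^sup>2"
    by (simp only: of_real_eq_iff)
  then show ?thesis
    by (rule power2_eq_imp_eq) auto
qed

lemma bounded_linear_scaleC: "bounded_linear (scaleC a :: 'h::complex_hilbert_space \<Rightarrow> 'h)"
proof (rule bounded_linear_intro[where K = "cmod a"])
  show "scaleC a (r *\<^sub>R x) = r *\<^sub>R scaleC a x" for r and x :: 'h
    by (metis scaleC_of_real scaleC_scaleC mult.commute)
qed (auto simp: scaleC_add_right norm_scaleC mult.commute)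

text \<open>The type \<^typ>\<open>'h \<Rightarrow>\<^sub>L 'h\<close> consists of the real-linear bounded operators; \<open>B(H)\<close> is
  the subset of the complex-linear ones. The norm and the topology are the operator norm and
  the norm topology.\<close>

definition bounded_ops :: "('h::complex_hilbert_space \<Rightarrow>\<^sub>L 'h) set" where
  "bounded_ops = {T. \<forall>c x. blinfun_apply T (scaleC c x) = scaleC c (blinfun_apply T x)}"

definition op_scaleC ::
    "complex \<Rightarrow> ('h::complex_hilbert_space \<Rightarrow>\<^sub>L 'h) \<Rightarrow> ('h \<Rightarrow>\<^sub>L 'h)" where
  "op_scaleC c T = Blinfun (scaleC c) o\<^sub>L T"

lemma op_scaleC_apply: "blinfun_apply (op_scaleC c T) x = scaleC c (blinfun_apply T x)"
  by (simp add: op_scaleC_def bounded_linear_Blinfun_apply bounded_linear_scaleC)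

definition is_adjoint ::
    "('h::complex_hilbert_space \<Rightarrow>\<^sub>L 'h) \<Rightarrow> ('h \<Rightarrow>\<^sub>L 'h) \<Rightarrow> bool" where
  "is_adjoint S T \<longleftrightarrow>
     (\<forall>x y. cinner (blinfun_apply S x) y = cinner x (blinfun_apply T y))"

text \<open>C*-algebras, not necessarily unital, are taken in concrete form, as norm-closed self-adjoint
  subalgebras of \<open>B(H)\<close>. By Gelfand-Naimark this is no restriction, and the norms of the
  C*-algebras \<open>M\<^sub>k(A)\<close> do not depend on the faithful representation.\<close>

definition cstar_algebra :: "('h::complex_hilbert_space \<Rightarrow>\<^sub>L 'h) set \<Rightarrow> bool" where
  "cstar_algebra A \<longleftrightarrow>
     A \<subseteq> bounded_ops \<and> 0 \<in> A \<and>
     (\<forall>S\<in>A. \<forall>T\<in>A. S + T \<in> A) \<and>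
     (\<forall>c. \<forall>T\<in>A. op_scaleC c T \<in> A) \<and>
     (\<forall>S\<in>A. \<forall>T\<in>A. S o\<^sub>L T \<in> A) \<and>
     (\<forall>T\<in>A. \<exists>S\<in>A. is_adjoint S T) \<and>
     closed A"

definition commutant ::
    "('h::complex_hilbert_space \<Rightarrow>\<^sub>L 'h) set \<Rightarrow> ('h \<Rightarrow>\<^sub>L 'h) set" where
  "commutant A = {T \<in> bounded_ops. \<forall>S\<in>A. S o\<^sub>L T = T o\<^sub>L S}"

definition von_neumann_algebra :: "('h::complex_hilbert_space \<Rightarrow>\<^sub>L 'h) set \<Rightarrow> bool" where
  "von_neumann_algebra A \<longleftrightarrow> cstar_algebra A \<and> commutant (commutant A) = A"


section \<open>Operator spaces\<close>

text \<open>A common format for concrete operator spaces acting on a Hilbert space type and on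
  some \<open>\<complex>\<^sup>N\<close>. An element of \<open>M\<^sub>k(V)\<close> is a function \<^term>\<open>X :: nat \<Rightarrow> nat \<Rightarrow> 'a\<close>, of which
  only the entries \<^term>\<open>X i j\<close> with \<open>i, j < k\<close> matter. The field \<open>mnorm\<close> gives the norm of
  \<open>M\<^sub>k(V)\<close>, and \<open>mpos\<close> says that an element of \<open>M\<^sub>k(V)\<close> is a positive operator.\<close>

record 'a operator_space = "'a partial_object" +
  osp_add :: "'a \<Rightarrow> 'a \<Rightarrow> 'a"
  osp_scale :: "complex \<Rightarrow> 'a \<Rightarrow> 'a"
  mnorm :: "nat \<Rightarrow> (nat \<Rightarrow> nat \<Rightarrow> 'a) \<Rightarrow> real"
  mpos :: "nat \<Rightarrow> (nat \<Rightarrow> nat \<Rightarrow> 'a) \<Rightarrow> bool"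

definition linear_map ::
    "'a operator_space \<Rightarrow> 'b operator_space \<Rightarrow> ('a \<Rightarrow> 'b) \<Rightarrow> bool" where
  "linear_map V W u \<longleftrightarrow>
     (\<forall>x\<in>carrier V. u x \<in> carrier W) \<and>
     (\<forall>x\<in>carrier V. \<forall>y\<in>carrier V. u (osp_add V x y) = osp_add W (u x) (u y)) \<and>
     (\<forall>c. \<forall>x\<in>carrier V. u (osp_scale V c x) = osp_scale W c (u x))"

definition matrices_over :: "nat \<Rightarrow> 'a operator_space \<Rightarrow> (nat \<Rightarrow> nat \<Rightarrow> 'a) set" where
  "matrices_over k V = {X. \<forall>i<k. \<forall>j<k. X i j \<in> carrier V}"

text \<open>The value is \<open>\<infinity>\<close> if \<^term>\<open>u\<close> is not completely bounded.\<close>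

definition cb_norm ::
    "'a operator_space \<Rightarrow> 'b operator_space \<Rightarrow> ('a \<Rightarrow> 'b) \<Rightarrow> ennreal" where
  "cb_norm V W u =
     (SUP k. SUP X\<in>{X \<in> matrices_over k V. mnorm V k X \<le> 1}.
        ennreal (mnorm W k (\<lambda>i j. u (X i j))))"

definition contractive ::
    "'a operator_space \<Rightarrow> 'b operator_space \<Rightarrow> ('a \<Rightarrow> 'b) \<Rightarrow> bool" where
  "contractive V W u \<longleftrightarrow>
     (\<forall>x\<in>carrier V. mnorm W 1 (\<lambda>_ _. u x) \<le> mnorm V 1 (\<lambda>_ _. x))"

definition completely_positive ::
    "'a operator_space \<Rightarrow> 'b operator_space \<Rightarrow> ('a \<Rightarrow> 'b) \<Rightarrow> bool" where
  "completely_positive V W u \<longleftrightarrow>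
     (\<forall>k. \<forall>X\<in>matrices_over k V. mpos V k X \<longrightarrow> mpos W k (\<lambda>i j. u (X i j)))"


subsection \<open>Spaces of operators on a Hilbert space\<close>

text \<open>Norm and positivity in \<open>M\<^sub>k(B(H)) = B(H\<^sup>k)\<close>; a vector of \<open>H\<^sup>k\<close> is a function on
  \<^typ>\<open>nat\<close> restricted to arguments below \<^term>\<open>k\<close>.\<close>

definition op_mnorm ::
    "nat \<Rightarrow> (nat \<Rightarrow> nat \<Rightarrow> ('h::complex_hilbert_space \<Rightarrow>\<^sub>L 'h)) \<Rightarrow> real" where
  "op_mnorm k X =
     (SUP \<xi>\<in>{\<xi> :: nat \<Rightarrow> 'h. (\<Sum>j<k. (norm (\<xi> j))\<^sup>2) \<le> 1}.
        sqrt (\<Sum>i<k. (norm (\<Sum>j<k. blinfun_apply (X i j) (\<xi> j)))\<^sup>2))"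

definition op_mpos ::
    "nat \<Rightarrow> (nat \<Rightarrow> nat \<Rightarrow> ('h::complex_hilbert_space \<Rightarrow>\<^sub>L 'h)) \<Rightarrow> bool" where
  "op_mpos k X \<longleftrightarrow>
     (\<forall>\<xi> :: nat \<Rightarrow> 'h. 0 \<le> (\<Sum>i<k. \<Sum>j<k. cinner (\<xi> i) (blinfun_apply (X i j) (\<xi> j))))"

definition op_space ::
    "('h::complex_hilbert_space \<Rightarrow>\<^sub>L 'h) set \<Rightarrow> ('h \<Rightarrow>\<^sub>L 'h) operator_space" where
  "op_space A =
     \<lparr>carrier = A, osp_add = (+), osp_scale = op_scaleC, mnorm = op_mnorm, mpos = op_mpos\<rparr>"


subsection \<open>Spaces of matrices\<close>

definition euclidean_norm :: "complex Matrix.vec \<Rightarrow> real" where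
  "euclidean_norm x = sqrt (Re (x \<bullet>c x))"

definition mat_opnorm :: "complex mat \<Rightarrow> real" where
  "mat_opnorm M =
     (SUP x\<in>{x \<in> carrier_vec (dim_col M). euclidean_norm x \<le> 1}. euclidean_norm (M *\<^sub>v x))"

definition mat_positive :: "complex mat \<Rightarrow> bool" where
  "mat_positive M \<longleftrightarrow> (\<forall>x\<in>carrier_vec (dim_col M). 0 \<le> (M *\<^sub>v x) \<bullet>c x)"

text \<open>The identification of \<open>M\<^sub>k(M\<^sub>N)\<close> with \<open>M\<^sub>k\<^sub>N\<close>: the \<open>(i, j)\<close> block of size \<^term>\<open>N\<close> is
  \<^term>\<open>X i j\<close>.\<close>

definition amplify :: "nat \<Rightarrow> nat \<Rightarrow> (nat \<Rightarrow> nat \<Rightarrow> complex mat) \<Rightarrow> complex mat" where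
  "amplify N k X =
     mat (k * N) (k * N) (\<lambda>(r, s). X (r div N) (s div N) $$ (r mod N, s mod N))"

definition mat_space :: "nat \<Rightarrow> complex mat set \<Rightarrow> complex mat operator_space" where
  "mat_space N V =
     \<lparr>carrier = V, osp_add = (+), osp_scale = (\<cdot>\<^sub>m),
      mnorm = (\<lambda>k X. mat_opnorm (amplify N k X)),
      mpos = (\<lambda>k X. mat_positive (amplify N k X))\<rparr>"

abbreviation M_space :: "nat \<Rightarrow> complex mat operator_space" where
  "M_space N \<equiv> mat_space N (carrier_mat N N)"


subsection \<open>The spaces \<open>E\<^sub>n\<close>\<close>

text \<open>Indices start at \<open>0\<close>, so \<open>\<delta>\<^sub>i = e\<^sub>i\<^sub>0 \<oplus> e\<^sub>0\<^sub>i\<close> for \<open>0 \<le> i < n\<close>. The norm of \<open>M\<^sub>2\<^sub>n\<close> restricts to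
  the maximum of the norms of the two diagonal blocks.\<close>

definition matrix_unit :: "nat \<Rightarrow> nat \<Rightarrow> nat \<Rightarrow> complex mat" where
  "matrix_unit n i j = mat n n (\<lambda>(r, s). if r = i \<and> s = j then 1 else 0)"

definition direct_sum :: "nat \<Rightarrow> complex mat \<Rightarrow> complex mat \<Rightarrow> complex mat" where
  "direct_sum n a b = four_block_mat a (0\<^sub>m n n) (0\<^sub>m n n) b"

definition delta :: "nat \<Rightarrow> nat \<Rightarrow> complex mat" where
  "delta n i = direct_sum n (matrix_unit n i 0) (matrix_unit n 0 i)"

definition E_space :: "nat \<Rightarrow> complex mat operator_space" where
  "E_space n = mat_space (2 * n)
     {mat (2 * n) (2 * n) (\<lambda>rs. \<Sum>i<n. c i * delta n i $$ rs) | c. True}"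


section \<open>Nuclearity and injectivity\<close>

text \<open>Nuclearity is the completely positive approximation property: the identity of \<^term>\<open>A\<close>
  is a point-norm limit of completely positive contractions through matrix algebras.\<close>

definition nuclear_cstar_algebra :: "('h::complex_hilbert_space \<Rightarrow>\<^sub>L 'h) set \<Rightarrow> bool" where
  "nuclear_cstar_algebra A \<longleftrightarrow>
     cstar_algebra A \<and>
     (\<forall>F \<epsilon>. finite F \<and> F \<subseteq> A \<and> \<epsilon> > 0 \<longrightarrow>
        (\<exists>N \<phi> \<psi>.
           linear_map (op_space A) (M_space N) \<phi> \<and>
           completely_positive (op_space A) (M_space N) \<phi> \<and>
           contractive (op_space A) (M_space N) \<phi> \<and>
           linear_map (M_space N) (op_space A) \<psi> \<and>
           completely_positive (M_space N) (op_space A) \<psi> \<and>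
           contractive (M_space N) (op_space A) \<psi> \<and>
           (\<forall>a\<in>F. norm (\<psi> (\<phi> a) - a) < \<epsilon>)))"

text \<open>Injectivity means that there is a completely contractive projection of \<open>B(H)\<close> onto
  \<^term>\<open>A\<close>.\<close>

definition injective_von_neumann_algebra ::
    "('h::complex_hilbert_space \<Rightarrow>\<^sub>L 'h) set \<Rightarrow> bool" where
  "injective_von_neumann_algebra A \<longleftrightarrow>
     von_neumann_algebra A \<and>
     (\<exists>P. linear_map (op_space bounded_ops) (op_space A) P \<and>
          (\<forall>a\<in>A. P a = a) \<and>
          cb_norm (op_space bounded_ops) (op_space A) P \<le> 1)"

end

theory Submission
  imports Defs "HOL-Library.Function_Algebras"
begin

text \<open>Let \<open>w\<^sub>i = w(\<delta>\<^sub>i)\<close>, \<open>K = \<parallel>w\<parallel>\<^sub>c\<^sub>b\<close> and \<open>s = 1 + 1/\<surd>n\<close>. The heart of the matter is a decomposition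
  \<open>s w\<^sub>i = c\<^sub>i + d\<^sub>i\<close> in \<open>A\<close> such that the column \<open>(c\<^sub>i)\<close> and the row \<open>(d\<^sub>i)\<close> have norm at most \<open>K\<close>. Applying
  \<open>v\<close> to this column and testing on unit vectors bounds the sum of the \<open>i\<close>-th coordinates of \<open>v(c\<^sub>i)\<close> by
  \<open>\<surd>n \<parallel>v\<parallel>\<^sub>c\<^sub>b K\<close>, and similarly for the row. Since \<open>v(w\<^sub>i) = \<delta>\<^sub>i\<close>, adding the two bounds gives
  \<open>s n \<le> 2 \<surd>n \<parallel>v\<parallel>\<^sub>c\<^sub>b K\<close>, which is the claim.

  By Hahn-Banach, such a decomposition exists in \<open>B(H)\<close> if
  \<open>s Re \<Sum>\<langle>\<beta>\<^sub>0\<^sub>k, w\<^sub>i \<alpha>\<^sub>i\<^sub>k\<rangle> \<le> K/2 \<Sum>(\<parallel>\<alpha>\<parallel>\<^sup>2 + \<parallel>\<beta>\<parallel>\<^sup>2)\<close> whenever the tensors \<open>\<Sum>\<^sub>k \<alpha>\<^sub>0\<^sub>k \<otimes> \<beta>\<^sub>i\<^sub>k\<close> and \<open>\<Sum>\<^sub>k \<alpha>\<^sub>i\<^sub>k \<otimes> \<beta>\<^sub>0\<^sub>k\<close>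
  agree for all \<open>i\<close>. Both sides of this hypothesis have coefficient matrices with respect to the
  families \<open>\<alpha>\<close> and \<open>\<beta>\<close>; compressed to the orthogonal complements of the kernels of the families, they
  become one and the same \<open>x\<^sub>i\<close>, and so \<open>x\<^sub>i\<close> is also the compression of every convex combination. The
  right combinations show that the column and the row norm of \<open>(x\<^sub>i)\<close> are at most \<open>1/s\<close>, so that
  complete boundedness of \<open>w\<close> applies to \<open>\<Sum> s x\<^sub>i \<otimes> \<delta>\<^sub>i\<close>.

  If \<open>A\<close> is injective, the decomposition in \<open>B(H)\<close> is projected to \<open>A\<close>. If \<open>A\<close> is nuclear, it is carried
  out in a matrix algebra through which the identity of \<open>A\<close> approximately factors; the factors are
  completely contractive by positivity of \<open>2 \<times> 2\<close> block matrices, compressed with an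
  approximate unit since \<open>A\<close> need not be unital.\<close>

section \<open>Hahn-Banach for generated cones\<close>

text \<open>Origin of s: on index blocks 0, ..., n the two sides of the hypothesis for i are the
  matrix units E(0,i+1) and E(i+1,0). As a column over i, the first family has norm 1 and the second
  has norm sqrt n, because all its members read the same block 0; as a row it is the other way
  round. A mixture t E(0,i+1) + (1-t) E(i+1,0) has column norm max(t, sqrt n (1-t)), which is
  smallest when both terms agree, that is for t = 1/s. The mixture with exchanged weights has the
  same row norm, and compression identifies the two mixtures. Norm bounds are carried in the form Re
  B(\<xi>, \<eta>) \<le> K/2 (|\<xi>|^2 + |\<eta>|^2). Such bounds add up over finite families, as
  the costs in the Hahn-Banach argument must, and rescaling one vector recovers the product form.
  They also let one argument serve both for operators on a Hilbert space and for matrices: the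
  decomposition is found among sesquilinear forms and only afterwards represented by
  operators.\<close>

instantiation "fun" :: (type, real_vector) real_vector
begin

definition "scaleR_fun r f = (\<lambda>x. r *\<^sub>R f x)"

instance
  by standard (simp_all add: fun_eq_iff scaleR_fun_def scaleR_add_right scaleR_add_left)

end

lemma scaleR_fun_apply [simp]: "(r *\<^sub>R f) x = r *\<^sub>R f x"
  by (simp add: scaleR_fun_def)

text \<open>A pair (x, b) is the constraint L x \<le> b on a linear functional L still to be found.
  The closure properties are those that the constraints satisfied by such an L have, and the last
  clause says that nothing contradicts L 0 = 0.\<close>

definition consistent_cone :: "('v::real_vector \<times> real) set \<Rightarrow> bool" where
  "consistent_cone R \<longleftrightarrow>
     (0, 0) \<in> R \<and>
     (\<forall>x b y c. (x, b) \<in> R \<longrightarrow> (y, c) \<in> R \<longrightarrow> (x + y, b + c) \<in> R) \<and>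
     (\<forall>r x b. r > 0 \<longrightarrow> (x, b) \<in> R \<longrightarrow> (r *\<^sub>R x, r * b) \<in> R) \<and>
     (\<forall>b. (0, b) \<in> R \<longrightarrow> b \<ge> 0)"

lemma consistent_coneD:
  assumes "consistent_cone R"
  shows "(0, 0) \<in> R"
    and "(x, b) \<in> R \<Longrightarrow> (y, c) \<in> R \<Longrightarrow> (x + y, b + c) \<in> R"
    and "r > 0 \<Longrightarrow> (x, b) \<in> R \<Longrightarrow> (r *\<^sub>R x, r * b) \<in> R"
    and "(0, b) \<in> R \<Longrightarrow> b \<ge> 0"
  using assms unfolding consistent_cone_def by auto

text \<open>Zorn's lemma with the set of constrained vectors held fixed: a larger cone only has
  sharper bounds, and each vector keeps a constrained negative, which later bounds the infimum of
  its bounds from below.\<close>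

lemma maximal_consistent_cone:
  assumes R: "consistent_cone R" and D: "\<And>x b. (x, b) \<in> R \<Longrightarrow> \<exists>c. (- x, c) \<in> R"
  obtains M where "R \<subseteq> M" "consistent_cone M" "fst ` M = fst ` R"
    and "\<forall>N. M \<subseteq> N \<longrightarrow> consistent_cone N \<longrightarrow> fst ` N = fst ` R \<longrightarrow> N = M"
proof -
  define \<A> where "\<A> = {N. R \<subseteq> N \<and> consistent_cone N \<and> fst ` N = fst ` R}"
  have "\<exists>M\<in>\<A>. \<forall>X\<in>\<A>. M \<subseteq> X \<longrightarrow> X = M"
  proof (rule subset_Zorn_nonempty)
    show "\<A> \<noteq> {}" using R unfolding \<A>_def by auto
  next
    fix \<C> assume ne: "\<C> \<noteq> {}" and "subset.chain \<A> \<C>"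
    then have sub: "\<C> \<subseteq> \<A>" and lin: "\<And>X Y. X \<in> \<C> \<Longrightarrow> Y \<in> \<C> \<Longrightarrow> X \<subseteq> Y \<or> Y \<subseteq> X"
      by (auto simp: subset_chain_def)
    have "consistent_cone (\<Union>\<C>)"
      unfolding consistent_cone_def
    proof (intro conjI allI impI)
      show "(0, 0) \<in> \<Union>\<C>"
      proof -
        from ne obtain X where "X \<in> \<C>" by blast
        then show ?thesis using sub consistent_coneD(1)[of X] unfolding \<A>_def by blast
      qed
      show "(x + y, b + c) \<in> \<Union>\<C>" if "(x, b) \<in> \<Union>\<C>" "(y, c) \<in> \<Union>\<C>" for x b y c
      proof -
        from that obtain X Y where X: "X \<in> \<C>" "(x, b) \<in> X" and Y: "Y \<in> \<C>" "(y, c) \<in> Y" by blast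
        from lin[OF X(1) Y(1)] obtain Z where "Z \<in> \<C>" "(x, b) \<in> Z" "(y, c) \<in> Z" using X Y by blast
        then show ?thesis using sub consistent_coneD(2)[of Z x b y c] unfolding \<A>_def by blast
      qed
      show "(r *\<^sub>R x, r * b) \<in> \<Union>\<C>" if "r > 0" "(x, b) \<in> \<Union>\<C>" for r x b
      proof -
        from that obtain X where "X \<in> \<C>" "(x, b) \<in> X" by blast
        then show ?thesis using that(1) sub consistent_coneD(3)[of X r x b] unfolding \<A>_def by blast
      qed
      show "b \<ge> 0" if "(0, b) \<in> \<Union>\<C>" for b
      proof -
        from that obtain X where "X \<in> \<C>" "(0, b) \<in> X" by blast
        then show ?thesis using sub consistent_coneD(4)[of X b] unfolding \<A>_def by blast
      qed
    qed
    moreover have "R \<subseteq> \<Union>\<C>" "fst ` \<Union>\<C> = fst ` R"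
    proof -
      have *: "R \<subseteq> X" "fst ` X = fst ` R" if "X \<in> \<C>" for X
      proof -
        from that sub have "X \<in> \<A>" by blast
        then show "R \<subseteq> X" "fst ` X = fst ` R" unfolding \<A>_def by simp_all
      qed
      from ne obtain X where "X \<in> \<C>" by blast
      then show "R \<subseteq> \<Union>\<C>" using * by blast
      have "fst ` \<Union>\<C> = (\<Union>X\<in>\<C>. fst ` X)" by (rule image_Union)
      also have "\<dots> = fst ` R" using *(2) ne by simp
      finally show "fst ` \<Union>\<C> = fst ` R" .
    qed
    ultimately show "\<Union>\<C> \<in> \<A>" unfolding \<A>_def by simp
  qed
  then obtain M where M: "M \<in> \<A>" "\<forall>X\<in>\<A>. M \<subseteq> X \<longrightarrow> X = M" by blast
  show thesis
  proof (rule that[of M])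
    show "\<forall>N. M \<subseteq> N \<longrightarrow> consistent_cone N \<longrightarrow> fst ` N = fst ` R \<longrightarrow> N = M"
    proof (intro allI impI)
      fix N assume N: "M \<subseteq> N" "consistent_cone N" "fst ` N = fst ` R"
      have "R \<subseteq> N" using M(1) N(1) unfolding \<A>_def by auto
      then have "N \<in> \<A>" using N unfolding \<A>_def by simp
      then show "N = M" using M(2) N(1) by simp
    qed
  qed (use M(1) in \<open>simp_all add: \<A>_def\<close>)
qed

text \<open>Hahn-Banach for the sublinear functional \<open>p x = Inf {b. (x, b) \<in> R}\<close>: for a maximal
  consistent cone \<open>R\<close>, the
  pair \<open>(- y, - p y)\<close> can be added, so \<open>p\<close> is linear.\<close>

lemma cone_hahn_banach:
  assumes R: "consistent_cone R" and D: "\<And>x b. (x, b) \<in> R \<Longrightarrow> \<exists>c. (- x, c) \<in> R"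
  shows "\<exists>L :: 'v::real_vector \<Rightarrow> real.
      (\<forall>x\<in>fst ` R. \<forall>y\<in>fst ` R. L (x + y) = L x + L y) \<and>
      (\<forall>x\<in>fst ` R. \<forall>r. L (r *\<^sub>R x) = r * L x) \<and>
      (\<forall>(x, b)\<in>R. L x \<le> b)"
proof -
  obtain M where RM: "R \<subseteq> M" and M: "consistent_cone M" and fM: "fst ` M = fst ` R"
    and max: "\<forall>N. M \<subseteq> N \<longrightarrow> consistent_cone N \<longrightarrow> fst ` N = fst ` R \<longrightarrow> N = M"
    by (rule maximal_consistent_cone[OF R D])
  note M_zero = consistent_coneD(1)[OF M] and M_add = consistent_coneD(2)[OF M]
    and M_scale = consistent_coneD(3)[OF M] and M_pos = consistent_coneD(4)[OF M]
  have neg: "\<exists>c. (- x, c) \<in> M" if "x \<in> fst ` R" for x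
    using that D RM by force
  define p where "p x = Inf {b. (x, b) \<in> M}" for x
  have bdd: "bdd_below {b. (x, b) \<in> M}" if x: "x \<in> fst ` R" for x
  proof -
    from neg[OF x] obtain c where c: "(- x, c) \<in> M" by blast
    have "- c \<le> b" if "(x, b) \<in> M" for b
      using M_pos[of "b + c"] M_add[OF that c] by simp
    then show ?thesis by (auto simp: bdd_below_def)
  qed
  have ne: "{b. (x, b) \<in> M} \<noteq> {}" if "x \<in> fst ` R" for x
    using that fM by force
  have p_le: "p x \<le> b" if "(x, b) \<in> M" for x b
  proof -
    have "x \<in> fst ` R" using that fM by force
    then show ?thesis unfolding p_def using that bdd by (intro cInf_lower) auto
  qed
  have p_ge: "c \<le> p x" if "x \<in> fst ` R" "\<And>b. (x, b) \<in> M \<Longrightarrow> c \<le> b" for x c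
    unfolding p_def using that ne by (intro cInf_greatest) auto
  have dom_add: "x + y \<in> fst ` R" if "x \<in> fst ` R" "y \<in> fst ` R" for x y
    using that consistent_coneD(2)[OF R] by force
  have dom_neg: "- x \<in> fst ` R" if "x \<in> fst ` R" for x
    using that D by force
  have dom_zero: "0 \<in> fst ` R" using consistent_coneD(1)[OF R] by force
  have p_zero: "p 0 = 0"
    using p_le[OF M_zero] p_ge[OF dom_zero, of 0] M_pos by force
  have p_subadd: "p (x + y) \<le> p x + p y" if x: "x \<in> fst ` R" and y: "y \<in> fst ` R" for x y
  proof -
    have "p (x + y) - c \<le> p x" if c: "(y, c) \<in> M" for c
      using p_le[OF M_add[OF _ c]] by (intro p_ge[OF x]) (force simp: algebra_simps)
    then have "p (x + y) - p x \<le> p y"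
      by (intro p_ge[OF y]) (force simp: algebra_simps)
    then show ?thesis by simp
  qed
  have p_scale_le: "p (r *\<^sub>R x) \<le> r * p x" if r: "r > 0" and x: "x \<in> fst ` R" for r x
  proof -
    have "p (r *\<^sub>R x) / r \<le> p x"
      using p_le[OF M_scale[OF r]] r by (intro p_ge[OF x]) (simp add: field_simps)
    then show ?thesis using r by (simp add: field_simps)
  qed
  have dom_scale: "r *\<^sub>R x \<in> fst ` R" if "x \<in> fst ` R" for r x
  proof -
    have pos: "t *\<^sub>R z \<in> fst ` R" if "t > 0" "z \<in> fst ` R" for t z
      using that consistent_coneD(3)[OF R] by force
    consider "r > 0" | "r = 0" | "r < 0" by linarith
    then show ?thesis
      using pos[of r x] pos[of "- r" "- x"] dom_zero dom_neg[OF that] that by cases auto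
  qed
  have p_neg_le: "p (- y) \<le> - p y" if y: "y \<in> fst ` R" for y
  proof -
    define N where "N = {(x - t *\<^sub>R y, b - t * p y) | x b t. (x, b) \<in> M \<and> t \<ge> 0}"
    have NI: "(x - t *\<^sub>R y, b - t * p y) \<in> N" if "(x, b) \<in> M" "t \<ge> 0" for x b t
      using that unfolding N_def by blast
    have MN: "M \<subseteq> N"
      using NI[of _ _ 0] by auto
    have "consistent_cone N"
      unfolding consistent_cone_def
    proof (intro conjI allI impI)
      show "(0, 0) \<in> N" using MN M_zero by blast
      show "(x + x', b + b') \<in> N" if "(x, b) \<in> N" "(x', b') \<in> N" for x b x' b'
      proof -
        from that obtain z c t z' c' t' where *: "x = z - t *\<^sub>R y" "b = c - t * p y" "(z, c) \<in> M" "t \<ge> 0"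
          "x' = z' - t' *\<^sub>R y" "b' = c' - t' * p y" "(z', c') \<in> M" "t' \<ge> 0"
          unfolding N_def by blast
        then have "((z + z') - (t + t') *\<^sub>R y, (c + c') - (t + t') * p y) \<in> N"
          by (intro NI M_add) auto
        then have "((z - t *\<^sub>R y) + (z' - t' *\<^sub>R y), (c - t * p y) + (c' - t' * p y)) \<in> N"
          by (simp add: algebra_simps)
        then show ?thesis using * by simp
      qed
      show "(r *\<^sub>R x, r * b) \<in> N" if "r > 0" "(x, b) \<in> N" for r x b
      proof -
        from that(2) obtain z c t where *: "x = z - t *\<^sub>R y" "b = c - t * p y" "(z, c) \<in> M" "t \<ge> 0"
          unfolding N_def by blast
        then have "(r *\<^sub>R z - (r * t) *\<^sub>R y, r * c - (r * t) * p y) \<in> N"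
          using that(1) by (intro NI M_scale) auto
        then have "(r *\<^sub>R (z - t *\<^sub>R y), r * (c - t * p y)) \<in> N" by (simp add: algebra_simps)
        then show ?thesis using * by simp
      qed
      show "b \<ge> 0" if "(0, b) \<in> N" for b
      proof -
        \<comment> \<open>The new constraint would be inconsistent only if c < t p y for some (t y,
          c) in M; dividing by t > 0 contradicts the definition of p y.\<close>
        from that obtain c t where *: "(t *\<^sub>R y, c) \<in> M" "b = c - t * p y" "t \<ge> 0"
          unfolding N_def by auto
        show ?thesis
        proof (cases "t = 0")
          case True
          then show ?thesis using * M_pos by simp
        next
          case False
          then have "t > 0" using * by simp
          then have "p y \<le> (1 / t) * c"
            using M_scale[of "1 / t", OF _ *(1)] by (intro p_le) auto
          then show ?thesis using * \<open>t > 0\<close> by (simp add: field_simps)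
        qed
      qed
    qed
    moreover have "fst ` N = fst ` R"
    proof
      show "fst ` R \<subseteq> fst ` N" using MN fM by blast
      show "fst ` N \<subseteq> fst ` R"
      proof
        fix z assume "z \<in> fst ` N"
        then obtain x b t where "z = x - t *\<^sub>R y" "(x, b) \<in> M" "t \<ge> 0" unfolding N_def by auto
        moreover from this have "x \<in> fst ` R" using fM by force
        ultimately show "z \<in> fst ` R"
          using dom_add[of x "(- t) *\<^sub>R y"] dom_scale[OF y, of "- t"] by simp
      qed
    qed
    ultimately have "N = M" using max MN by blast
    then have "(- y, - p y) \<in> M" using NI[OF M_zero, of 1] by simp
    then show ?thesis by (rule p_le)
  qed
  have p_neg: "p (- y) = - p y" if y: "y \<in> fst ` R" for y
    using p_neg_le[OF y] p_subadd[OF y dom_neg[OF y]] p_zero by simp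
  have p_add: "p (x + y) = p x + p y" if x: "x \<in> fst ` R" and y: "y \<in> fst ` R" for x y
    using p_subadd[OF x y] p_subadd[OF dom_add[OF x y] dom_neg[OF y]] p_neg[OF y] by simp
  have p_scale_pos: "p (r *\<^sub>R x) = r * p x" if r: "r > 0" and x: "x \<in> fst ` R" for r x
    using p_scale_le[OF r x] p_scale_le[OF r dom_neg[OF x]] p_neg[OF x] p_neg[OF dom_scale[OF x, of r]]
    by simp
  have p_scale: "p (r *\<^sub>R x) = r * p x" if x: "x \<in> fst ` R" for r x
  proof -
    consider "r > 0" | "r = 0" | "r < 0" by linarith
    then show ?thesis
      using p_scale_pos[OF _ x, of r] p_scale_pos[OF _ dom_neg[OF x], of "- r"] p_zero p_neg[OF x]
      by cases auto
  qed
  show ?thesis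
    using p_add p_scale subsetD[OF RM, THEN p_le] by (intro exI[of _ p]) (simp add: split_beta)
qed

text \<open>The sublinear functional is the infimum of the total cost over all representations of a
  vector as a finite sum of generators F z. Lists of generators give the cone, since appending is
  addition, and \<open>consistent\<close> says that no representation of 0 has negative
  cost.\<close>

lemma generated_hahn_banach:
  fixes F :: "'z \<Rightarrow> 'v::real_vector" and cost :: "'z \<Rightarrow> real"
  assumes scale: "\<And>r z. r > 0 \<Longrightarrow> \<exists>z'. F z' = r *\<^sub>R F z \<and> cost z' = r * cost z"
    and neg: "\<And>z. \<exists>z'. F z' = - F z"
    and consistent: "\<And>(m::nat) z. (\<Sum>k<m. F (z k)) = 0 \<Longrightarrow> (\<Sum>k<m. cost (z k)) \<ge> 0"
  shows "\<exists>L :: 'v \<Rightarrow> real. (\<forall>x y. L (F x + F y) = L (F x) + L (F y)) \<and>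
      (\<forall>I x. finite (I :: 'i set) \<longrightarrow> L (\<Sum>i\<in>I. F (x i)) = (\<Sum>i\<in>I. L (F (x i)))) \<and>
      (\<forall>r x. L (r *\<^sub>R F x) = r * L (F x)) \<and> (\<forall>x. L (F x) \<le> cost x)"
proof -
  define R where "R = (\<lambda>zs. (sum_list (map F zs), sum_list (map cost zs))) ` UNIV"
  have RI: "(sum_list (map F zs), sum_list (map cost zs)) \<in> R" for zs
    unfolding R_def by blast
  have R: "consistent_cone R"
    unfolding consistent_cone_def
  proof (intro conjI allI impI)
    show "(0, 0) \<in> R" using RI[of "[]"] by simp
    show "(x + y, b + c) \<in> R" if "(x, b) \<in> R" "(y, c) \<in> R" for x b y c
    proof -
      from that obtain zs zs' where "x = sum_list (map F zs)" "b = sum_list (map cost zs)"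
        "y = sum_list (map F zs')" "c = sum_list (map cost zs')" unfolding R_def by blast
      then show ?thesis using RI[of "zs @ zs'"] by simp
    qed
    show "(r *\<^sub>R x, r * b) \<in> R" if "r > 0" "(x, b) \<in> R" for r x b
    proof -
      obtain g where g: "\<And>z. F (g z) = r *\<^sub>R F z \<and> cost (g z) = r * cost z"
        using scale[OF \<open>r > 0\<close>] by metis
      from that obtain zs where "x = sum_list (map F zs)" "b = sum_list (map cost zs)"
        unfolding R_def by blast
      moreover have "sum_list (map F (map g zs)) = r *\<^sub>R sum_list (map F zs) \<and>
          sum_list (map cost (map g zs)) = r * sum_list (map cost zs)"
        by (induction zs) (simp_all add: g algebra_simps)
      ultimately show ?thesis using RI[of "map g zs"] by simp
    qed
    show "b \<ge> 0" if "(0, b) \<in> R" for b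
    proof -
      from that obtain zs where "sum_list (map F zs) = 0" and b: "b = sum_list (map cost zs)"
        unfolding R_def by force
      then have "(\<Sum>k<length zs. F (zs ! k)) = 0"
        by (simp add: sum_list_sum_nth atLeast0LessThan)
      from consistent[OF this] show ?thesis
        using b by (simp add: sum_list_sum_nth atLeast0LessThan)
    qed
  qed
  have R_neg: "\<exists>c. (- x, c) \<in> R" if "(x, b) \<in> R" for x b
  proof -
    obtain g where g: "\<And>z. F (g z) = - F z" using neg by metis
    from that obtain zs where "x = sum_list (map F zs)" unfolding R_def by blast
    moreover have "sum_list (map F (map g zs)) = - sum_list (map F zs)"
      by (induction zs) (simp_all add: g)
    ultimately show ?thesis using RI[of "map g zs"] by auto
  qed
  obtain L :: "'v \<Rightarrow> real"
    where L: "\<forall>x\<in>fst ` R. \<forall>y\<in>fst ` R. L (x + y) = L x + L y"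
      "\<forall>x\<in>fst ` R. \<forall>r. L (r *\<^sub>R x) = r * L x" "\<forall>(x, b)\<in>R. L x \<le> b"
    by (rule cone_hahn_banach[OF R, THEN exE]) (blast intro: R_neg, elim conjE)
  note L_add = L(1)[rule_format] and L_scale = L(2)[rule_format]
  have L_le: "L x \<le> b" if "(x, b) \<in> R" for x b
    using L(3) that by (auto dest: bspec)
  have gen: "(F x, cost x) \<in> R" for x using RI[of "[x]"] by simp
  have dom: "F x \<in> fst ` R" for x using gen by force
  have dom_sum: "(\<Sum>i\<in>I. F (x i)) \<in> fst ` R \<and> L (\<Sum>i\<in>I. F (x i)) = (\<Sum>i\<in>I. L (F (x i)))"
    if "finite I" for I :: "'i set" and x
    using that
  proof (induction I rule: finite_induct)
    case empty
    have "(0, 0) \<in> R" using RI[of "[]"] by simp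
    then have "(0::'v) \<in> fst ` R" by force
    then show ?case using L_scale[of 0 0] by simp
  next
    case (insert i I)
    have "F (x i) + (\<Sum>i\<in>I. F (x i)) \<in> fst ` R"
    proof -
      from insert.IH obtain zs where "(\<Sum>i\<in>I. F (x i)) = sum_list (map F zs)"
        unfolding R_def by force
      then show ?thesis using RI[of "x i # zs"] by force
    qed
    then show ?case using insert L_add[OF dom, of "\<Sum>i\<in>I. F (x i)" "x i"] by simp
  qed
  show ?thesis
  proof (intro exI[of _ L] conjI allI impI)
    show "L (F x + F y) = L (F x) + L (F y)" for x y by (rule L_add[OF dom dom])
    show "L (\<Sum>i\<in>I. F (x i)) = (\<Sum>i\<in>I. L (F (x i)))" if "finite I" for I :: "'i set" and x
      using dom_sum[OF that] by blast
    show "L (r *\<^sub>R F x) = r * L (F x)" for r x by (rule L_scale[OF dom])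
    show "L (F x) \<le> cost x" for x by (rule L_le[OF gen])
  qed
qed

section \<open>Projections with prescribed kernel\<close>

definition cdot :: "'i set \<Rightarrow> ('i \<Rightarrow> complex) \<Rightarrow> ('i \<Rightarrow> complex) \<Rightarrow> complex" where
  "cdot I x y = (\<Sum>p\<in>I. cnj (x p) * y p)"

lemma cdot_commute: "cdot I x y = cnj (cdot I y x)"
  by (simp add: cdot_def mult.commute)

lemma cdot_self: "cdot I x x = complex_of_real (\<Sum>p\<in>I. (cmod (x p))\<^sup>2)"
proof -
  have "cnj (x p) * x p = complex_of_real ((cmod (x p))\<^sup>2)" for p
    by (metis complex_norm_square mult.commute)
  then show ?thesis by (simp add: cdot_def)
qed

lemma cdot_diff_right: "cdot I x (\<lambda>p. y p - z p) = cdot I x y - cdot I x z"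
  by (simp add: cdot_def right_diff_distrib sum_subtractf)

lemma cdot_lincomb_right:
  "cdot I x (\<lambda>p. \<Sum>k\<in>K. c k * u k p) = (\<Sum>k\<in>K. c k * cdot I x (u k))"
  by (simp add: cdot_def sum_distrib_left mult.assoc mult.left_commute) (rule sum.swap)

lemma cdot_unit: "finite I \<Longrightarrow> q \<in> I \<Longrightarrow> cdot I x (\<lambda>p. if p = q then 1 else 0) = cnj (x q)"
  by (simp add: cdot_def if_distrib cong: if_cong)

definition orthonormal :: "'i set \<Rightarrow> nat \<Rightarrow> (nat \<Rightarrow> 'i \<Rightarrow> complex) \<Rightarrow> bool" where
  "orthonormal I r u \<longleftrightarrow> (\<forall>k<r. \<forall>l<r. cdot I (u k) (u l) = (if k = l then 1 else 0))"

text \<open>\<open>y z\<close> is the Gram-Schmidt residual of z. The norm identity is Pythagoras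
  and contains Bessel's inequality.\<close>

lemma orthonormal_residual:
  assumes u: "orthonormal I r u"
  defines "y z \<equiv> \<lambda>p. z p - (\<Sum>k<r. cdot I (u k) z * u k p)"
  shows "l < r \<Longrightarrow> cdot I (u l) (y z) = 0"
    and "(\<Sum>p\<in>I. (cmod (y z p))\<^sup>2) = (\<Sum>p\<in>I. (cmod (z p))\<^sup>2) - (\<Sum>k<r. (cmod (cdot I (u k) z))\<^sup>2)"
proof -
  have orth: "cdot I (u l) (y z) = 0" if l: "l < r" for l
  proof -
    have "(\<Sum>k<r. cdot I (u k) z * cdot I (u l) (u k)) = (\<Sum>k<r. if k = l then cdot I (u l) z else 0)"
      using u l unfolding orthonormal_def by (intro sum.cong) auto
    then show ?thesis
      using l by (simp add: y_def cdot_diff_right cdot_lincomb_right)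
  qed
  then show "l < r \<Longrightarrow> cdot I (u l) (y z) = 0" .
  have "cdot I (y z) (y z) = cdot I (y z) z - (\<Sum>k<r. cdot I (u k) z * cdot I (y z) (u k))"
    unfolding y_def by (subst cdot_diff_right) (simp add: cdot_lincomb_right)
  also have "(\<Sum>k<r. cdot I (u k) z * cdot I (y z) (u k)) = 0"
    using orth by (intro sum.neutral) (simp add: cdot_commute[of I "y z"])
  also have "cdot I (y z) z = cnj (cdot I z (y z))" by (rule cdot_commute)
  also have "cdot I z (y z) = cdot I z z - (\<Sum>k<r. cdot I (u k) z * cdot I z (u k))"
    by (simp add: y_def cdot_diff_right cdot_lincomb_right)
  also have "(\<Sum>k<r. cdot I (u k) z * cdot I z (u k)) =
      complex_of_real (\<Sum>k<r. (cmod (cdot I (u k) z))\<^sup>2)"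
    by (simp add: cdot_commute[of I z "u _"] complex_norm_square del: of_real_power)
  finally have "complex_of_real (\<Sum>p\<in>I. (cmod (y z p))\<^sup>2) =
      complex_of_real ((\<Sum>p\<in>I. (cmod (z p))\<^sup>2) - (\<Sum>k<r. (cmod (cdot I (u k) z))\<^sup>2))"
    by (simp add: cdot_self del: of_real_power of_real_sum)
  then show "(\<Sum>p\<in>I. (cmod (y z p))\<^sup>2) = (\<Sum>p\<in>I. (cmod (z p))\<^sup>2) - (\<Sum>k<r. (cmod (cdot I (u k) z))\<^sup>2)"
    by (simp only: of_real_eq_iff)
qed

text \<open>Double counting of \<Sum> |u k q|^2: Bessel's inequality for the unit vector at q bounds
  the sum over k by 1, while the sum over q is exactly 1 for each k.\<close>

lemma orthonormal_le_card:
  assumes I: "finite I" and u: "orthonormal I r u"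
  shows "r \<le> card I"
proof -
  have "(\<Sum>k<r. (cmod (u k q))\<^sup>2) \<le> 1" if q: "q \<in> I" for q
  proof -
    define e where "e p = (if p = q then 1 else 0 :: complex)" for p
    have "0 \<le> (\<Sum>p\<in>I. (cmod (e p - (\<Sum>k<r. cdot I (u k) e * u k p)))\<^sup>2)"
      by (intro sum_nonneg) auto
    also have "\<dots> = (\<Sum>p\<in>I. (cmod (e p))\<^sup>2) - (\<Sum>k<r. (cmod (cdot I (u k) e))\<^sup>2)"
      by (rule orthonormal_residual(2)[OF u])
    also have "(\<Sum>p\<in>I. (cmod (e p))\<^sup>2) = (\<Sum>p\<in>I. if p = q then 1 else 0)"
      by (intro sum.cong) (auto simp: e_def)
    also have "\<dots> = 1"
      using I q by simp
    also have "(\<Sum>k<r. (cmod (cdot I (u k) e))\<^sup>2) = (\<Sum>k<r. (cmod (u k q))\<^sup>2)"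
      using I q unfolding e_def by (simp add: cdot_unit)
    finally show ?thesis by simp
  qed
  then have "(\<Sum>q\<in>I. \<Sum>k<r. (cmod (u k q))\<^sup>2) \<le> real (card I)"
    using sum_bounded_above[of I "\<lambda>q. \<Sum>k<r. (cmod (u k q))\<^sup>2" 1] by simp
  moreover have "(\<Sum>q\<in>I. \<Sum>k<r. (cmod (u k q))\<^sup>2) = (\<Sum>k<r. \<Sum>q\<in>I. (cmod (u k q))\<^sup>2)"
    by (rule sum.swap)
  moreover have "(\<Sum>q\<in>I. (cmod (u k q))\<^sup>2) = 1" if "k < r" for k
    using u that cdot_self[of I "u k"] unfolding orthonormal_def
    by (metis of_real_eq_1_iff)
  ultimately show ?thesis by simp
qed

definition annihilates :: "'i set \<Rightarrow> ('z \<Rightarrow> 'i \<Rightarrow> complex) \<Rightarrow> ('i \<Rightarrow> complex) \<Rightarrow> bool" where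
  "annihilates I g z \<longleftrightarrow> (\<forall>\<zeta>. (\<Sum>p\<in>I. z p * g \<zeta> p) = 0)"

text \<open>This describes the orthogonal projection onto the complement of the space of all z with
  \<open>annihilates I g z\<close>. The pairing in \<open>annihilates\<close> is bilinear, so it is
  the conjugate of h that is orthogonal to this space; hence the transpose of \<pi> in the third
  clause.\<close>

definition kernel_projection ::
    "'i set \<Rightarrow> ('z \<Rightarrow> 'i \<Rightarrow> complex) \<Rightarrow> ('i \<Rightarrow> 'i \<Rightarrow> complex) \<Rightarrow> bool" where
  "kernel_projection I g \<pi> \<longleftrightarrow>
     (\<forall>p q. \<pi> q p = cnj (\<pi> p q)) \<and>
     (\<forall>z. (\<Sum>p\<in>I. (cmod (\<Sum>q\<in>I. \<pi> p q * z q))\<^sup>2) \<le> (\<Sum>p\<in>I. (cmod (z p))\<^sup>2)) \<and>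
     (\<forall>h. \<forall>q\<in>I. (\<forall>z. annihilates I g z \<longrightarrow> (\<Sum>p\<in>I. z p * h p) = 0) \<longrightarrow>
        (\<Sum>p\<in>I. \<pi> p q * h p) = h q) \<and>
     (\<forall>z. \<forall>p\<in>I. annihilates I g z \<longrightarrow> (\<Sum>q\<in>I. \<pi> p q * z q) = 0)"

lemma kernel_projectionD:
  assumes "kernel_projection I g \<pi>"
  shows "\<pi> q p = cnj (\<pi> p q)"
    and "(\<Sum>p\<in>I. (cmod (\<Sum>q\<in>I. \<pi> p q * z q))\<^sup>2) \<le> (\<Sum>p\<in>I. (cmod (z p))\<^sup>2)"
    and "q \<in> I \<Longrightarrow> (\<And>z. annihilates I g z \<Longrightarrow> (\<Sum>p\<in>I. z p * h p) = 0) \<Longrightarrow> (\<Sum>p\<in>I. \<pi> p q * h p) = h q"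
    and "annihilates I g z \<Longrightarrow> p \<in> I \<Longrightarrow> (\<Sum>q\<in>I. \<pi> p q * z q) = 0"
  using assms unfolding kernel_projection_def by blast+

text \<open>The projection is \<open>1 - \<Sum>k. u k (u k)*\<close> for a maximal orthonormal family \<open>u\<close> in its kernel.\<close>

lemma kernel_projection_exists:
  fixes g :: "'z \<Rightarrow> 'i \<Rightarrow> complex"
  assumes I: "finite I"
  shows "\<exists>\<pi>. kernel_projection I g \<pi>"
proof -
  define U where "U = {z. annihilates I g z}"
  define P where "P r \<longleftrightarrow> (\<exists>u. orthonormal I r u \<and> (\<forall>k<r. u k \<in> U))" for r
  have "P 0" unfolding P_def orthonormal_def by simp
  moreover have "\<forall>r. P r \<longrightarrow> r \<le> card I"
    unfolding P_def using orthonormal_le_card[OF I] by blast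
  ultimately obtain r where "P r" and max: "\<And>s. P s \<Longrightarrow> s \<le> r"
    using GreatestI_nat[of P 0 "card I"] Greatest_le_nat[of P _ "card I"] by metis
  then obtain u where u: "orthonormal I r u" and uU: "\<And>k. k < r \<Longrightarrow> u k \<in> U"
    unfolding P_def by blast
  define \<pi> where "\<pi> p q = (if p = q then 1 else 0) - (\<Sum>k<r. u k p * cnj (u k q))" for p q
  have \<pi>_apply: "(\<Sum>q\<in>I. \<pi> p q * z q) = z p - (\<Sum>k<r. cdot I (u k) z * u k p)" if "p \<in> I" for p z
  proof -
    have "(\<Sum>q\<in>I. \<pi> p q * z q) = (\<Sum>q\<in>I. (if q = p then z q else 0) - (\<Sum>k<r. u k p * cnj (u k q) * z q))"
      by (intro sum.cong) (auto simp: \<pi>_def left_diff_distrib sum_distrib_right)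
    also have "\<dots> = z p - (\<Sum>q\<in>I. \<Sum>k<r. u k p * cnj (u k q) * z q)"
      using I that by (simp add: sum_subtractf)
    also have "(\<Sum>q\<in>I. \<Sum>k<r. u k p * cnj (u k q) * z q) = (\<Sum>k<r. cdot I (u k) z * u k p)"
      by (subst sum.swap) (simp add: cdot_def sum_distrib_left sum_distrib_right mult_ac)
    finally show ?thesis .
  qed
  show ?thesis
    unfolding kernel_projection_def
  proof (intro exI[of _ \<pi>] conjI allI ballI impI)
    show "\<pi> q p = cnj (\<pi> p q)" for p q
      by (auto simp: \<pi>_def mult.commute)
    show "(\<Sum>p\<in>I. (cmod (\<Sum>q\<in>I. \<pi> p q * z q))\<^sup>2) \<le> (\<Sum>p\<in>I. (cmod (z p))\<^sup>2)" for z
    proof -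
      have "(\<Sum>p\<in>I. (cmod (\<Sum>q\<in>I. \<pi> p q * z q))\<^sup>2) =
          (\<Sum>p\<in>I. (cmod (z p - (\<Sum>k<r. cdot I (u k) z * u k p)))\<^sup>2)"
        by (intro sum.cong) (simp_all add: \<pi>_apply)
      also have "\<dots> = (\<Sum>p\<in>I. (cmod (z p))\<^sup>2) - (\<Sum>k<r. (cmod (cdot I (u k) z))\<^sup>2)"
        by (rule orthonormal_residual(2)[OF u])
      finally show ?thesis by (simp add: sum_nonneg)
    qed
    show "(\<Sum>p\<in>I. \<pi> p q * h p) = h q" 
      if q: "q \<in> I" and h: "\<forall>z. annihilates I g z \<longrightarrow> (\<Sum>p\<in>I. z p * h p) = 0" for h q
    proof -
      have "(\<Sum>p\<in>I. \<pi> p q * h p) =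
          (\<Sum>p\<in>I. (if p = q then h p else 0) - (\<Sum>k<r. cnj (u k q) * (u k p * h p)))"
        by (intro sum.cong) (auto simp: \<pi>_def algebra_simps sum_distrib_left)
      also have "\<dots> = h q - (\<Sum>p\<in>I. \<Sum>k<r. cnj (u k q) * (u k p * h p))"
        using I q by (simp add: sum_subtractf)
      also have "(\<Sum>p\<in>I. \<Sum>k<r. cnj (u k q) * (u k p * h p)) =
          (\<Sum>k<r. cnj (u k q) * (\<Sum>p\<in>I. u k p * h p))"
        by (subst sum.swap) (simp add: sum_distrib_left)
      also have "\<dots> = 0"
        using uU h unfolding U_def by (intro sum.neutral) simp
      finally show ?thesis by simp
    qed
    show "(\<Sum>q\<in>I. \<pi> p q * z q) = 0" if z: "annihilates I g z" and p: "p \<in> I" for z p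
    proof -
      define y where "y = (\<lambda>p. z p - (\<Sum>k<r. cdot I (u k) z * u k p))"
      have yU: "y \<in> U"
      proof -
        have "(\<Sum>p\<in>I. y p * g \<zeta> p) = 0" for \<zeta>
        proof -
          have "(\<Sum>p\<in>I. y p * g \<zeta> p) =
              (\<Sum>p\<in>I. z p * g \<zeta> p - (\<Sum>k<r. cdot I (u k) z * (u k p * g \<zeta> p)))"
            by (simp add: y_def algebra_simps sum_distrib_left)
          also have "\<dots> = (\<Sum>p\<in>I. z p * g \<zeta> p) - (\<Sum>p\<in>I. \<Sum>k<r. cdot I (u k) z * (u k p * g \<zeta> p))"
            by (rule sum_subtractf)
          also have "(\<Sum>p\<in>I. \<Sum>k<r. cdot I (u k) z * (u k p * g \<zeta> p)) =
              (\<Sum>k<r. cdot I (u k) z * (\<Sum>p\<in>I. u k p * g \<zeta> p))"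
            by (subst sum.swap) (simp add: sum_distrib_left)
          also have "\<dots> = 0"
            using uU unfolding U_def annihilates_def by (intro sum.neutral) simp
          finally show ?thesis using z unfolding annihilates_def by simp
        qed
        then show ?thesis unfolding U_def annihilates_def by simp
      qed
      define s where "s = (\<Sum>p\<in>I. (cmod (y p))\<^sup>2)"
      have "s = 0"
      \<comment> \<open>A nonzero residual of z lies in the kernel and is orthogonal to u;
        normalized, it would extend the maximal family.\<close>
      proof (rule ccontr)
        assume "s \<noteq> 0"
        moreover have "s \<ge> 0" unfolding s_def by (intro sum_nonneg) auto
        ultimately have s: "s > 0" by simp
        define t where "t = complex_of_real (1 / sqrt s)"
        have tt: "cnj t * t * complex_of_real s = 1"
          using s by (simp add: t_def flip: of_real_mult)
        define u' where "u' k = (if k = r then (\<lambda>p. t * y p) else u k)" for k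
        have yy: "cdot I (\<lambda>p. t * y p) (\<lambda>p. t * y p) = 1"
        proof -
          have "cdot I (\<lambda>p. t * y p) (\<lambda>p. t * y p) = cnj t * t * cdot I y y"
            by (simp add: cdot_def sum_distrib_left mult_ac)
          then show ?thesis using tt by (simp add: cdot_self s_def)
        qed
        have uy: "cdot I (u k) (\<lambda>p. t * y p) = 0" if "k < r" for k
        proof -
          have "cdot I (u k) (\<lambda>p. t * y p) = t * cdot I (u k) y"
            by (simp add: cdot_def sum_distrib_left mult_ac)
          also have "cdot I (u k) y = 0"
            unfolding y_def by (rule orthonormal_residual(1)[OF u that])
          finally show ?thesis by simp
        qed
        then have yu: "cdot I (\<lambda>p. t * y p) (u k) = 0" if "k < r" for k
          using that by (subst cdot_commute) simp
        have "orthonormal I (Suc r) u'"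
          using u unfolding orthonormal_def u'_def by (auto simp: less_Suc_eq yy uy yu)
        moreover have "(\<lambda>p. t * y p) \<in> U"
          using yU unfolding U_def annihilates_def by (simp add: mult.assoc flip: sum_distrib_left)
        ultimately have "P (Suc r)"
          unfolding P_def using uU by (intro exI[of _ u']) (auto simp: u'_def less_Suc_eq)
        then show False using max[of "Suc r"] by simp
      qed
      then have "y p = 0"
        using I p unfolding s_def by (subst (asm) sum_nonneg_eq_0_iff) auto
      then show ?thesis using \<pi>_apply[OF p] unfolding y_def by simp
    qed
  qed
qed

section \<open>Balanced coefficient arrays\<close>

text \<open>On C^(n+1) \<otimes> C^m this is the matrix \<tau> E(0,i+1) + (1 - \<tau>) E(i+1,0),
  tensored with the identity of C^m. The first component of an index is the block, the second
  numbers the summands of a tensor.\<close>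

definition couple :: "complex \<Rightarrow> nat \<Rightarrow> (nat \<times> nat \<Rightarrow> complex) \<Rightarrow> nat \<times> nat \<Rightarrow> complex" where
  "couple \<tau> i z p =
     (if fst p = 0 then \<tau> * z (Suc i, snd p)
      else if fst p = Suc i then (1 - \<tau>) * z (0, snd p) else 0)"

lemma sum_blocks:
  "(\<Sum>p\<in>{..n} \<times> {..<m}. f p) = (\<Sum>k<m. f (0, k)) + (\<Sum>i<n. \<Sum>k<m. f (Suc i, k))"
proof -
  have "(\<Sum>p\<in>{..n} \<times> {..<m}. f p) = (\<Sum>j\<le>n. \<Sum>k<m. f (j, k))"
    by (simp add: sum.cartesian_product)
  then show ?thesis by (simp add: sum.atMost_shift)
qed

lemma sum_couple:
  assumes i: "i < n" and h0: "\<And>p. h p 0 = 0"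
  shows "(\<Sum>p\<in>{..n} \<times> {..<m}. h p (couple \<tau> i z p)) =
    (\<Sum>k<m. h (0, k) (\<tau> * z (Suc i, k))) + (\<Sum>k<m. h (Suc i, k) ((1 - \<tau>) * z (0, k)))"
proof -
  have "(\<Sum>j<n. \<Sum>k<m. h (Suc j, k) (couple \<tau> i z (Suc j, k))) =
      (\<Sum>j<n. if j = i then \<Sum>k<m. h (Suc i, k) ((1 - \<tau>) * z (0, k)) else 0)"
    by (intro sum.cong) (auto simp: couple_def h0)
  then show ?thesis
    using i by (simp add: sum_blocks couple_def)
qed

text \<open>Transposition exchanges E(0,i+1) and E(i+1,0), and with them the weights \<tau> and 1 -
  \<tau>.\<close>

lemma couple_adjoint:
  assumes "i < n"
  shows "(\<Sum>p\<in>{..n} \<times> {..<m}. a p * couple \<tau> i b p) = (\<Sum>q\<in>{..n} \<times> {..<m}. b q * couple (1 - \<tau>) i a q)"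
  using assms sum_couple[of i n "\<lambda>p c. a p * c" \<tau> b m] sum_couple[of i n "\<lambda>p c. b p * c" "1 - \<tau>" a m]
  by (simp add: mult_ac)

lemma couple_sum:
  "couple \<tau> i (\<lambda>q. \<Sum>r\<in>R. c r * f r q) p = (\<Sum>r\<in>R. c r * couple \<tau> i (f r) p)"
  by (simp add: couple_def sum_distrib_left mult.left_commute)

text \<open>The units E(0,i+1) read different blocks of z for different i, whereas every E(i+1,0)
  reads block 0 again; hence the factor n on one side only.\<close>

lemma couple_norm:
  assumes "0 \<le> t" "t \<le> 1"
  shows "(\<Sum>i<n. \<Sum>p\<in>{..n} \<times> {..<m}. (cmod (couple (of_real t) i z p))\<^sup>2) =
    t\<^sup>2 * (\<Sum>i<n. \<Sum>k<m. (cmod (z (Suc i, k)))\<^sup>2) + real n * (1 - t)\<^sup>2 * (\<Sum>k<m. (cmod (z (0, k)))\<^sup>2)"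
proof -
  have "(\<Sum>p\<in>{..n} \<times> {..<m}. (cmod (couple (of_real t) i z p))\<^sup>2) =
      t\<^sup>2 * (\<Sum>k<m. (cmod (z (Suc i, k)))\<^sup>2) + (1 - t)\<^sup>2 * (\<Sum>k<m. (cmod (z (0, k)))\<^sup>2)" if "i < n" for i
  proof -
    have "cmod (1 - of_real t) = \<bar>1 - t\<bar>"
      by (metis norm_of_real of_real_1 of_real_diff)
    then show ?thesis
      using sum_couple[OF that, of "\<lambda>_ c. (cmod c)\<^sup>2" "of_real t" z m]
      by (simp add: norm_mult power_mult_distrib sum_distrib_left)
  qed
  then have "(\<Sum>i<n. \<Sum>p\<in>{..n} \<times> {..<m}. (cmod (couple (of_real t) i z p))\<^sup>2) =
      (\<Sum>i<n. t\<^sup>2 * (\<Sum>k<m. (cmod (z (Suc i, k)))\<^sup>2) + (1 - t)\<^sup>2 * (\<Sum>k<m. (cmod (z (0, k)))\<^sup>2))"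
    by (intro sum.cong) auto
  then show ?thesis by (simp add: sum.distrib sum_distrib_left mult.assoc)
qed

text \<open>The transpose of a Hermitian matrix is its entrywise conjugate, and conjugating z does
  not change the norms.\<close>

lemma transposed_contraction:
  fixes \<pi> :: "'i \<Rightarrow> 'i \<Rightarrow> complex"
  assumes "\<And>p q. \<pi> q p = cnj (\<pi> p q)"
    and "\<And>z. (\<Sum>p\<in>I. (cmod (\<Sum>q\<in>I. \<pi> p q * z q))\<^sup>2) \<le> (\<Sum>p\<in>I. (cmod (z p))\<^sup>2)"
  shows "(\<Sum>p\<in>I. (cmod (\<Sum>q\<in>I. z q * \<pi> q p))\<^sup>2) \<le> (\<Sum>p\<in>I. (cmod (z p))\<^sup>2)"
proof -
  have "cmod (\<Sum>q\<in>I. z q * \<pi> q p) = cmod (\<Sum>q\<in>I. \<pi> p q * cnj (z q))" for p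
  proof -
    have "(\<Sum>q\<in>I. z q * \<pi> q p) = cnj (\<Sum>q\<in>I. \<pi> p q * cnj (z q))"
      using assms(1)[of p] by (simp add: mult.commute)
    then show ?thesis by (metis complex_mod_cnj)
  qed
  then show ?thesis using assms(2)[of "\<lambda>q. cnj (z q)"] by simp
qed

text \<open>Write \<open>couple \<tau> i = \<tau> J + (1 - \<tau>) J'\<close>, where \<open>J\<close> and \<open>J'\<close> implement the two sides of the hypothesis. The
  hypothesis makes the compressions \<open>\<pi> (couple \<tau> i) \<rho>\<close> independent of \<open>\<tau>\<close>. The column bound is read off
  from \<open>\<tau> = t\<close>, the row bound from \<open>\<tau> = 1 - t\<close>.\<close>

lemma balanced_coefficients:
  fixes ga :: "'z \<Rightarrow> nat \<times> nat \<Rightarrow> complex" and gb :: "'z \<Rightarrow> nat \<times> nat \<Rightarrow> complex" and n m :: nat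
  defines "I \<equiv> {..n} \<times> {..<m}"
  assumes balance: "\<forall>i<n. \<forall>\<zeta> \<zeta>'.
      (\<Sum>k<m. ga \<zeta> (0, k) * gb \<zeta>' (Suc i, k)) = (\<Sum>k<m. ga \<zeta> (Suc i, k) * gb \<zeta>' (0, k))"
    and t: "0 \<le> t" "t \<le> 1" "real n * (1 - t)\<^sup>2 = t\<^sup>2"
  shows "\<exists>x :: nat \<Rightarrow> nat \<times> nat \<Rightarrow> nat \<times> nat \<Rightarrow> complex.
    (\<forall>z. (\<Sum>i<n. \<Sum>p\<in>I. (cmod (\<Sum>q\<in>I. x i p q * z q))\<^sup>2) \<le> t\<^sup>2 * (\<Sum>q\<in>I. (cmod (z q))\<^sup>2)) \<and>
    (\<forall>z. (\<Sum>i<n. \<Sum>q\<in>I. (cmod (\<Sum>p\<in>I. x i p q * z p))\<^sup>2) \<le> t\<^sup>2 * (\<Sum>p\<in>I. (cmod (z p))\<^sup>2)) \<and>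
    (\<forall>i<n. \<forall>B. (\<forall>z. annihilates I ga z \<longrightarrow> (\<forall>q\<in>I. (\<Sum>p\<in>I. z p * B p q) = 0)) \<longrightarrow>
      (\<forall>z. annihilates I gb z \<longrightarrow> (\<forall>p\<in>I. (\<Sum>q\<in>I. z q * B p q) = 0)) \<longrightarrow>
      (\<Sum>p\<in>I. \<Sum>q\<in>I. x i p q * B p q) = (\<Sum>k<m. B (Suc i, k) (0, k)))"
proof -
  have fin: "finite I" unfolding I_def by simp
  obtain \<pi> where \<pi>: "kernel_projection I ga \<pi>"
    using kernel_projection_exists[OF fin] by blast
  obtain \<rho> where \<rho>: "kernel_projection I gb \<rho>"
    using kernel_projection_exists[OF fin] by blast
  note \<pi>_herm = kernel_projectionD(1)[OF \<pi>] and \<pi>_contr = kernel_projectionD(2)[OF \<pi>]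
    and \<pi>_fix = kernel_projectionD(3)[OF \<pi>] and \<pi>_ker = kernel_projectionD(4)[OF \<pi>]
  note \<rho>_herm = kernel_projectionD(1)[OF \<rho>] and \<rho>_contr = kernel_projectionD(2)[OF \<rho>]
    and \<rho>_fix = kernel_projectionD(3)[OF \<rho>] and \<rho>_ker = kernel_projectionD(4)[OF \<rho>]
  \<comment> \<open>As a matrix, this is \<pi> times \<open>couple \<tau> i\<close> times the
    transpose of \<rho>.\<close>
  define X where "X \<tau> i p q = (\<Sum>p'\<in>I. \<pi> p p' * couple \<tau> i (\<rho> q) p')" for \<tau> i p q
  have X_indep: "X \<tau> i p q = X 0 i p q" if i: "i < n" and p: "p \<in> I" and q: "q \<in> I" for \<tau> i p q
  proof -
    have affine: "couple \<tau> i z r = couple 0 i z r + \<tau> * (couple 1 i z r - couple 0 i z r)" for z r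
      by (simp add: couple_def algebra_simps)
    \<comment> \<open>By \<open>balance\<close> the difference of the two couplings sends
      \<open>ga \<zeta>\<close> into the kernel of \<open>gb\<close>, where \<rho> vanishes. Moved
      across the pairing, this says that the difference sends the rows of \<rho> into the kernel of
      \<open>ga\<close>, where \<pi> vanishes.\<close>
    have "(\<Sum>r\<in>I. \<pi> p r * (couple 1 i (\<rho> q) r - couple 0 i (\<rho> q) r)) = 0"
    proof (rule \<pi>_ker[OF _ p], unfold annihilates_def, rule allI)
      fix \<zeta>
      have "(\<Sum>q'\<in>I. \<rho> q q' * (couple 0 i (ga \<zeta>) q' - couple 1 i (ga \<zeta>) q')) = 0"
      proof (rule \<rho>_ker[OF _ q], unfold annihilates_def, rule allI)
        fix \<zeta>'
        show "(\<Sum>q'\<in>I. (couple 0 i (ga \<zeta>) q' - couple 1 i (ga \<zeta>) q') * gb \<zeta>' q') = 0"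
          using balance[rule_format, OF i, of \<zeta> \<zeta>'] sum_couple[OF i, of "\<lambda>q c. gb \<zeta>' q * c" 0 "ga \<zeta>" m]
            sum_couple[OF i, of "\<lambda>q c. gb \<zeta>' q * c" 1 "ga \<zeta>" m]
          by (simp add: I_def algebra_simps sum_subtractf)
      qed
      then show "(\<Sum>r\<in>I. (couple 1 i (\<rho> q) r - couple 0 i (\<rho> q) r) * ga \<zeta> r) = 0"
        using couple_adjoint[OF i, where m = m and a = "ga \<zeta>" and \<tau> = 1 and b = "\<rho> q"]
          couple_adjoint[OF i, where m = m and a = "ga \<zeta>" and \<tau> = 0 and b = "\<rho> q"]
        by (simp add: I_def algebra_simps sum_subtractf)
    qed
    moreover have "X \<tau> i p q = X 0 i p q + \<tau> * (\<Sum>r\<in>I. \<pi> p r * (couple 1 i (\<rho> q) r - couple 0 i (\<rho> q) r))"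
      unfolding X_def sum_distrib_left sum.distrib[symmetric]
      by (intro sum.cong refl, subst affine) (simp add: algebra_simps)
    ultimately show ?thesis by simp
  qed
  have X_col: "(\<Sum>q\<in>I. X \<tau> i p q * z q) = (\<Sum>r\<in>I. \<pi> p r * couple \<tau> i (\<lambda>q'. \<Sum>q\<in>I. z q * \<rho> q q') r)"
    for \<tau> i p z
    unfolding X_def couple_sum sum_distrib_left sum_distrib_right
    by (subst sum.swap) (simp add: mult_ac)
  have X_row: "(\<Sum>p\<in>I. X \<tau> i p q * z p) = (\<Sum>r\<in>I. \<rho> q r * couple (1 - \<tau>) i (\<lambda>p'. \<Sum>p\<in>I. z p * \<pi> p p') r)"
    if i: "i < n" for \<tau> i q z
  proof -
    have "(\<Sum>p\<in>I. X \<tau> i p q * z p) = (\<Sum>r\<in>I. (\<Sum>p\<in>I. z p * \<pi> p r) * couple \<tau> i (\<rho> q) r)"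
      unfolding X_def sum_distrib_right by (subst sum.swap) (simp add: mult_ac)
    also have "\<dots> = (\<Sum>r\<in>I. \<rho> q r * couple (1 - \<tau>) i (\<lambda>p'. \<Sum>p\<in>I. z p * \<pi> p p') r)"
      unfolding I_def by (rule couple_adjoint[OF i])
    finally show ?thesis .
  qed
  have bound: "(\<Sum>i<n. \<Sum>p\<in>I. (cmod (\<Sum>r\<in>I. \<kappa> p r * couple (of_real t) i (\<lambda>q'. \<Sum>q\<in>I. z q * \<sigma> q q') r))\<^sup>2)
      \<le> t\<^sup>2 * (\<Sum>q\<in>I. (cmod (z q))\<^sup>2)"
    if \<kappa>: "\<And>z. (\<Sum>p\<in>I. (cmod (\<Sum>q\<in>I. \<kappa> p q * z q))\<^sup>2) \<le> (\<Sum>p\<in>I. (cmod (z p))\<^sup>2)"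
      and \<sigma>: "(\<Sum>p\<in>I. (cmod (\<Sum>q\<in>I. z q * \<sigma> q p))\<^sup>2) \<le> (\<Sum>p\<in>I. (cmod (z p))\<^sup>2)"
    for \<kappa> \<sigma> :: "nat \<times> nat \<Rightarrow> nat \<times> nat \<Rightarrow> complex" and z
  proof -
    define z' where "z' q' = (\<Sum>q\<in>I. z q * \<sigma> q q')" for q'
    have "(\<Sum>i<n. \<Sum>p\<in>I. (cmod (\<Sum>r\<in>I. \<kappa> p r * couple (of_real t) i z' r))\<^sup>2)
        \<le> (\<Sum>i<n. \<Sum>p\<in>I. (cmod (couple (of_real t) i z' p))\<^sup>2)"
      by (intro sum_mono \<kappa>)
    \<comment> \<open>The condition \<open>t(3)\<close> makes both weights of
      \<open>couple_norm\<close> equal to t^2, so that the blocks recombine to the full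
      norm.\<close>
    also have "\<dots> = t\<^sup>2 * (\<Sum>p\<in>I. (cmod (z' p))\<^sup>2)"
      by (simp only: I_def couple_norm[OF t(1,2)] t(3)) (simp add: sum_blocks algebra_simps)
    also have "\<dots> \<le> t\<^sup>2 * (\<Sum>p\<in>I. (cmod (z p))\<^sup>2)"
      unfolding z'_def by (intro mult_left_mono \<sigma>) simp
    finally show ?thesis unfolding z'_def .
  qed
  show ?thesis
  proof (intro exI[of _ "X 0"] conjI allI impI)
    fix z :: "nat \<times> nat \<Rightarrow> complex"
    have "(\<Sum>i<n. \<Sum>p\<in>I. (cmod (\<Sum>q\<in>I. X 0 i p q * z q))\<^sup>2) =
        (\<Sum>i<n. \<Sum>p\<in>I. (cmod (\<Sum>q\<in>I. X (of_real t) i p q * z q))\<^sup>2)"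
      by (intro sum.cong refl arg_cong[where f = "\<lambda>c. (cmod c)\<^sup>2"]) (simp add: X_indep[of _ _ _ "of_real t"])
    also have "\<dots> \<le> t\<^sup>2 * (\<Sum>q\<in>I. (cmod (z q))\<^sup>2)"
      unfolding X_col by (intro bound \<pi>_contr transposed_contraction \<rho>_herm \<rho>_contr)
    finally show "(\<Sum>i<n. \<Sum>p\<in>I. (cmod (\<Sum>q\<in>I. X 0 i p q * z q))\<^sup>2) \<le> t\<^sup>2 * (\<Sum>q\<in>I. (cmod (z q))\<^sup>2)" .
  next
    fix z :: "nat \<times> nat \<Rightarrow> complex"
    have "(\<Sum>i<n. \<Sum>q\<in>I. (cmod (\<Sum>p\<in>I. X 0 i p q * z p))\<^sup>2) =
        (\<Sum>i<n. \<Sum>q\<in>I. (cmod (\<Sum>p\<in>I. X (1 - of_real t) i p q * z p))\<^sup>2)"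
      by (intro sum.cong refl arg_cong[where f = "\<lambda>c. (cmod c)\<^sup>2"])
          (simp add: X_indep[of _ _ _ "1 - of_real t"])
    also have "\<dots> = (\<Sum>i<n. \<Sum>q\<in>I. (cmod (\<Sum>r\<in>I. \<rho> q r * couple (of_real t) i (\<lambda>p'. \<Sum>p\<in>I. z p * \<pi> p p') r))\<^sup>2)"
      by (intro sum.cong refl) (simp add: X_row)
    also have "\<dots> \<le> t\<^sup>2 * (\<Sum>p\<in>I. (cmod (z p))\<^sup>2)"
      by (intro bound \<rho>_contr transposed_contraction \<pi>_herm \<pi>_contr)
    finally show "(\<Sum>i<n. \<Sum>q\<in>I. (cmod (\<Sum>p\<in>I. X 0 i p q * z p))\<^sup>2) \<le> t\<^sup>2 * (\<Sum>p\<in>I. (cmod (z p))\<^sup>2)" .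
  next
    fix i and B :: "nat \<times> nat \<Rightarrow> nat \<times> nat \<Rightarrow> complex"
    assume i: "i < n"
      and Ba: "\<forall>z. annihilates I ga z \<longrightarrow> (\<forall>q\<in>I. (\<Sum>p\<in>I. z p * B p q) = 0)"
      and Bb: "\<forall>z. annihilates I gb z \<longrightarrow> (\<forall>p\<in>I. (\<Sum>q\<in>I. z q * B p q) = 0)"
    have B\<pi>: "(\<Sum>p\<in>I. \<pi> p r * B p q) = B r q" if "q \<in> I" "r \<in> I" for q r
      using Ba that(1) by (intro \<pi>_fix[OF that(2)]) simp
    have B\<rho>: "(\<Sum>q\<in>I. \<rho> q r * B p q) = B p r" if "p \<in> I" "r \<in> I" for p r
      using Bb that(1) by (intro \<rho>_fix[OF that(2)]) simp
    \<comment> \<open>By hypothesis B vanishes on both kernels, so the projections can be moved from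
      X to B, where they act as the identity. What is left is the pairing of B with
      \<open>couple 0 i\<close>, which reads only the block (i+1, 0) of B.\<close>
    have "(\<Sum>p\<in>I. \<Sum>q\<in>I. X 0 i p q * B p q) = (\<Sum>q\<in>I. \<Sum>p\<in>I. X 0 i p q * B p q)"
      by (rule sum.swap)
    also have "\<dots> = (\<Sum>q\<in>I. \<Sum>r\<in>I. (\<Sum>p\<in>I. \<pi> p r * B p q) * couple 0 i (\<rho> q) r)"
      unfolding X_def sum_distrib_right by (rule sum.cong[OF refl], subst sum.swap) (simp add: mult_ac)
    also have "\<dots> = (\<Sum>q\<in>I. \<Sum>r\<in>I. B r q * couple 0 i (\<rho> q) r)"
      by (intro sum.cong refl) (simp add: B\<pi>)
    also have "\<dots> = (\<Sum>q\<in>I. \<Sum>r\<in>I. \<rho> q r * couple 1 i (\<lambda>p. B p q) r)"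
      using couple_adjoint[OF i, where m = m and \<tau> = 0] unfolding I_def by simp
    also have "\<dots> = (\<Sum>r\<in>I. couple 1 i (\<lambda>p. \<Sum>q\<in>I. \<rho> q r * B p q) r)"
      by (subst sum.swap) (simp add: couple_sum)
    also have "\<dots> = (\<Sum>r\<in>I. couple 1 i (\<lambda>p. B p r) r)"
      using i B\<rho> by (intro sum.cong refl) (auto simp: couple_def I_def)
    also have "\<dots> = (\<Sum>k<m. B (Suc i, k) (0, k))"
      unfolding I_def sum_blocks by (simp add: couple_def cong: if_cong)
    finally show "(\<Sum>p\<in>I. \<Sum>q\<in>I. X 0 i p q * B p q) = (\<Sum>k<m. B (Suc i, k) (0, k))" .
  qed
qed

section \<open>The column-row decomposition\<close>

definition sesquilinear :: "(complex \<Rightarrow> 'g::ab_group_add \<Rightarrow> 'g) \<Rightarrow> ('g \<Rightarrow> 'g \<Rightarrow> complex) \<Rightarrow> bool" where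
  "sesquilinear sc B \<longleftrightarrow>
     (\<forall>x y z. B (x + y) z = B x z + B y z) \<and> (\<forall>x y z. B x (y + z) = B x y + B x z) \<and>
     (\<forall>a x y. B (sc a x) y = cnj a * B x y) \<and> (\<forall>a x y. B x (sc a y) = a * B x y)"

lemma sesquilinearD:
  assumes "sesquilinear sc B"
  shows "B (x + y) z = B x z + B y z" "B x (y + z) = B x y + B x z"
    and "B (sc a x) y = cnj a * B x y" "B x (sc a y) = a * B x y"
  using assms unfolding sesquilinear_def by blast+

lemma sesquilinear_zero:
  assumes "sesquilinear sc B"
  shows "B 0 y = 0" "B x 0 = 0"
  using sesquilinearD(1)[OF assms, of 0 0 y] sesquilinearD(2)[OF assms, of x 0 0] by simp_all

lemma sesquilinear_sum:
  assumes "sesquilinear sc B"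
  shows "B (\<Sum>p\<in>I. sc (c p) (f p)) y = (\<Sum>p\<in>I. cnj (c p) * B (f p) y)"
    and "B x (\<Sum>p\<in>I. sc (c p) (f p)) = (\<Sum>p\<in>I. c p * B x (f p))"
  by (induction I rule: infinite_finite_induct)
    (simp_all add: sesquilinearD[OF assms] sesquilinear_zero[OF assms])

lemma sum_fun_apply: "(\<Sum>k\<in>K. f k) x = (\<Sum>k\<in>K. f k x)"
  by (induction K rule: infinite_finite_induct) simp_all

text \<open>The decomposition is used for operators on a Hilbert space and for N x N matrices acting
  on functions of which only the first N values count. In the second case \<open>ip\<close> has null
  vectors; \<open>respects_null\<close> asks the forms to ignore them.\<close>

locale semi_inner_space =
  fixes sc :: "complex \<Rightarrow> 'g::ab_group_add \<Rightarrow> 'g" and ip :: "'g \<Rightarrow> 'g \<Rightarrow> complex"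
  assumes ip_sesquilinear: "sesquilinear sc ip"
begin

lemmas ip_simps = sesquilinearD[OF ip_sesquilinear] sesquilinear_zero[OF ip_sesquilinear]

definition sq :: "'g \<Rightarrow> real" where
  "sq x = Re (ip x x)"

lemma sq_zero [simp]: "sq 0 = 0"
  by (simp add: sq_def ip_simps)

lemma sq_scale: "sq (sc a x) = (cmod a)\<^sup>2 * sq x"
proof -
  have "ip (sc a x) (sc a x) = complex_of_real ((cmod a)\<^sup>2) * ip x x"
    by (simp add: ip_simps complex_norm_square mult_ac del: of_real_power)
  then show ?thesis by (simp add: sq_def)
qed

text \<open>Coefficient arrays \<open>x\<close> of column and row norm at most 1 are those for which \<open>\<Sum>i. x i \<otimes> \<delta> i\<close> is in the
  unit ball of \<open>M\<^sub>k(E\<^sub>n)\<close>; thus this is the weak form of \<open>\<parallel>w\<parallel>\<^sub>c\<^sub>b \<le> K\<close> for \<open>W i \<xi> \<eta> = \<langle>\<xi>, w (\<delta> i) \<eta>\<rangle>\<close>.\<close>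

definition cb_bounded :: "nat \<Rightarrow> real \<Rightarrow> (nat \<Rightarrow> 'g \<Rightarrow> 'g \<Rightarrow> complex) \<Rightarrow> bool" where
  "cb_bounded n K W \<longleftrightarrow>
     (\<forall>I :: (nat \<times> nat) set. \<forall>x \<alpha> \<beta>. finite I \<longrightarrow>
        (\<forall>z. (\<Sum>i<n. \<Sum>p\<in>I. (cmod (\<Sum>q\<in>I. x i p q * z q))\<^sup>2) \<le> (\<Sum>q\<in>I. (cmod (z q))\<^sup>2)) \<longrightarrow>
        (\<forall>z. (\<Sum>i<n. \<Sum>q\<in>I. (cmod (\<Sum>p\<in>I. x i p q * z p))\<^sup>2) \<le> (\<Sum>p\<in>I. (cmod (z p))\<^sup>2)) \<longrightarrow>
        (\<Sum>i<n. \<Sum>p\<in>I. \<Sum>q\<in>I. Re (x i p q * W i (\<beta> q) (\<alpha> p)))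
          \<le> K / 2 * (\<Sum>p\<in>I. sq (\<alpha> p) + sq (\<beta> p)))"

definition respects_null :: "('g \<Rightarrow> 'g \<Rightarrow> complex) \<Rightarrow> bool" where
  "respects_null B \<longleftrightarrow>
     (\<forall>x y. ((\<forall>\<zeta>. ip \<zeta> y = 0) \<longrightarrow> B x y = 0) \<and> ((\<forall>\<zeta>. ip x \<zeta> = 0) \<longrightarrow> B x y = 0))"

text \<open>This is the consistency condition for Hahn-Banach. A z that annihilates the functions
  \<open>ip \<zeta> (\<alpha> p)\<close> is a linear relation among the \<alpha> p up to null
  vectors, and so it also kills the values W i (\<beta> q) (\<alpha> p) for each q; the same holds
  for \<beta>. Hence the arrays of \<open>balanced_coefficients\<close> represent these values.
  Their column and row norms are at most t = 1/s, and after scaling by s they are admissible in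
  \<open>cb_bounded\<close>.\<close>

lemma balanced_bound:
  fixes \<alpha> \<beta> :: "nat \<times> nat \<Rightarrow> 'g" and n m :: nat
  defines "I \<equiv> {..n} \<times> {..<m}" and "s \<equiv> 1 + 1 / sqrt (real n)"
  assumes n: "n \<ge> 1"
    and W': "\<forall>i<n. sesquilinear sc (W i) \<and> respects_null (W i)"
    and cb: "cb_bounded n K W"
    and balance: "\<forall>i<n. \<forall>\<zeta> \<zeta>'.
      (\<Sum>k<m. ip \<zeta> (\<alpha> (0, k)) * ip (\<beta> (Suc i, k)) \<zeta>') = (\<Sum>k<m. ip \<zeta> (\<alpha> (Suc i, k)) * ip (\<beta> (0, k)) \<zeta>')"
  shows "s * (\<Sum>i<n. \<Sum>k<m. Re (W i (\<beta> (0, k)) (\<alpha> (Suc i, k)))) \<le> K / 2 * (\<Sum>p\<in>I. sq (\<alpha> p) + sq (\<beta> p))"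
proof -
  have W: "sesquilinear sc (W i)" "respects_null (W i)" if "i < n" for i
    using W' that by auto
  define t where "t = 1 / s"
  have rn: "sqrt (real n) > 0" using n by simp
  have s: "s \<ge> 1" using rn unfolding s_def by simp
  then have t: "0 \<le> t" "t \<le> 1" "t > 0" unfolding t_def by auto
  \<comment> \<open>t = 1/s is the solution of sqrt n (1 - t) = t.\<close>
  have "1 - t = t / sqrt (real n)"
  proof -
    have "1 - 1 / (1 + 1 / r) = 1 / (1 + 1 / r) / r" if "r > 0" for r :: real
      using that by (simp add: divide_simps)
    then show ?thesis using rn unfolding t_def s_def by blast
  qed
  then have t2: "real n * (1 - t)\<^sup>2 = t\<^sup>2"
    using n by (simp add: power_divide)
  obtain x :: "nat \<Rightarrow> nat \<times> nat \<Rightarrow> nat \<times> nat \<Rightarrow> complex"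
    where x: "\<forall>z. (\<Sum>i<n. \<Sum>p\<in>I. (cmod (\<Sum>q\<in>I. x i p q * z q))\<^sup>2) \<le> t\<^sup>2 * (\<Sum>q\<in>I. (cmod (z q))\<^sup>2)"
      "\<forall>z. (\<Sum>i<n. \<Sum>q\<in>I. (cmod (\<Sum>p\<in>I. x i p q * z p))\<^sup>2) \<le> t\<^sup>2 * (\<Sum>p\<in>I. (cmod (z p))\<^sup>2)"
      "\<forall>i<n. \<forall>B.
        (\<forall>z. annihilates I (\<lambda>\<zeta> p. ip \<zeta> (\<alpha> p)) z \<longrightarrow> (\<forall>q\<in>I. (\<Sum>p\<in>I. z p * B p q) = 0)) \<longrightarrow>
        (\<forall>z. annihilates I (\<lambda>\<zeta> p. ip (\<beta> p) \<zeta>) z \<longrightarrow> (\<forall>p\<in>I. (\<Sum>q\<in>I. z q * B p q) = 0)) \<longrightarrow>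
        (\<Sum>p\<in>I. \<Sum>q\<in>I. x i p q * B p q) = (\<Sum>k<m. B (Suc i, k) (0, k))"
    using balanced_coefficients[where n = n and m = m and ga = "\<lambda>\<zeta> p. ip \<zeta> (\<alpha> p)"
        and gb = "\<lambda>\<zeta> p. ip (\<beta> p) \<zeta>" and t = t, OF balance t(1,2) t2]
    unfolding I_def by (elim exE conjE)
  note x_col = x(1)[rule_format] and x_row = x(2)[rule_format] and x_rep = x(3)[rule_format]
  have rep: "(\<Sum>p\<in>I. \<Sum>q\<in>I. x i p q * W i (\<beta> q) (\<alpha> p)) = (\<Sum>k<m. W i (\<beta> (0, k)) (\<alpha> (Suc i, k)))"
    if i: "i < n" for i
  proof (rule x_rep[OF i])
    fix z q assume z: "annihilates I (\<lambda>\<zeta> p. ip \<zeta> (\<alpha> p)) z"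
    have "ip \<zeta> (\<Sum>p\<in>I. sc (z p) (\<alpha> p)) = 0" for \<zeta>
      using z unfolding annihilates_def by (simp add: sesquilinear_sum[OF ip_sesquilinear])
    then have "W i (\<beta> q) (\<Sum>p\<in>I. sc (z p) (\<alpha> p)) = 0"
      using W(2)[OF i] unfolding respects_null_def by blast
    then show "(\<Sum>p\<in>I. z p * W i (\<beta> q) (\<alpha> p)) = 0"
      by (simp add: sesquilinear_sum[OF W(1)[OF i]])
  next
    fix z p assume z: "annihilates I (\<lambda>\<zeta> p. ip (\<beta> p) \<zeta>) z"
    have "ip (\<Sum>q\<in>I. sc (cnj (z q)) (\<beta> q)) \<zeta> = 0" for \<zeta>
      using z unfolding annihilates_def by (simp add: sesquilinear_sum[OF ip_sesquilinear])
    then have "W i (\<Sum>q\<in>I. sc (cnj (z q)) (\<beta> q)) (\<alpha> p) = 0"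
      using W(2)[OF i] unfolding respects_null_def by blast
    then show "(\<Sum>q\<in>I. z q * W i (\<beta> q) (\<alpha> p)) = 0"
      by (simp add: sesquilinear_sum[OF W(1)[OF i]])
  qed
  have scale: "(cmod (\<Sum>q\<in>I. of_real s * c q * z q))\<^sup>2 = s\<^sup>2 * (cmod (\<Sum>q\<in>I. c q * z q))\<^sup>2"
    for c z :: "nat \<times> nat \<Rightarrow> complex"
    using s by (simp add: mult.assoc norm_mult power_mult_distrib flip: sum_distrib_left)
  have st: "s\<^sup>2 * (t\<^sup>2 * r) = r" for r
    using s unfolding t_def by (simp add: power_divide)
  have "(\<Sum>i<n. \<Sum>p\<in>I. \<Sum>q\<in>I. Re (of_real s * x i p q * W i (\<beta> q) (\<alpha> p)))
      \<le> K / 2 * (\<Sum>p\<in>I. sq (\<alpha> p) + sq (\<beta> p))"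
  proof (rule cb[unfolded cb_bounded_def, rule_format])
    show "finite I" unfolding I_def by simp
    show "(\<Sum>i<n. \<Sum>p\<in>I. (cmod (\<Sum>q\<in>I. of_real s * x i p q * z q))\<^sup>2) \<le> (\<Sum>q\<in>I. (cmod (z q))\<^sup>2)" for z
      using mult_left_mono[OF x_col[of z], of "s\<^sup>2"] unfolding scale st
      by (simp add: sum_distrib_left)
    show "(\<Sum>i<n. \<Sum>q\<in>I. (cmod (\<Sum>p\<in>I. of_real s * x i p q * z p))\<^sup>2) \<le> (\<Sum>p\<in>I. (cmod (z p))\<^sup>2)" for z
      using mult_left_mono[OF x_row[of z], of "s\<^sup>2"] unfolding scale st
      by (simp add: sum_distrib_left)
  qed
  also have "(\<Sum>i<n. \<Sum>p\<in>I. \<Sum>q\<in>I. Re (of_real s * x i p q * W i (\<beta> q) (\<alpha> p))) =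
      s * (\<Sum>i<n. Re (\<Sum>p\<in>I. \<Sum>q\<in>I. x i p q * W i (\<beta> q) (\<alpha> p)))"
    by (simp add: sum_distrib_left mult.assoc)
  also have "\<dots> = s * (\<Sum>i<n. \<Sum>k<m. Re (W i (\<beta> (0, k)) (\<alpha> (Suc i, k))))"
    by (simp add: rep)
  finally show ?thesis .
qed

text \<open>The tensor \<open>\<eta> \<otimes> \<xi>\<close> is represented by the function \<open>\<lambda>\<zeta> \<zeta>'. ip \<zeta> \<eta>
    * ip \<xi> \<zeta>'\<close>. In the Hahn-Banach argument the
  first summand is charged to the column part and the second to the row part.\<close>

definition tensor :: "nat \<Rightarrow> (nat \<Rightarrow> 'g) \<times> (nat \<Rightarrow> 'g) \<Rightarrow> nat \<Rightarrow> 'g \<Rightarrow> 'g \<Rightarrow> complex" where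
  "tensor n z = (\<lambda>i \<zeta> \<zeta>'. if i < n then
     ip \<zeta> (fst z 0) * ip (snd z (Suc i)) \<zeta>' - ip \<zeta> (fst z (Suc i)) * ip (snd z 0) \<zeta>' else 0)"

text \<open>The vectors are placed so that only the first summand of \<open>tensor\<close> survives,
  and only in slot i, where it is \<eta> \<otimes> \<xi>.\<close>

definition simple :: "nat \<Rightarrow> 'g \<Rightarrow> 'g \<Rightarrow> (nat \<Rightarrow> 'g) \<times> (nat \<Rightarrow> 'g)" where
  "simple i \<xi> \<eta> = (\<lambda>j. if j = 0 then \<eta> else 0, \<lambda>j. if j = Suc i then \<xi> else 0)"

lemma tensor_simple:
  "tensor n (simple i \<xi> \<eta>) = (\<lambda>j \<zeta> \<zeta>'. if j < n \<and> j = i then ip \<zeta> \<eta> * ip \<xi> \<zeta>' else 0)"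
  by (auto simp: tensor_def simple_def ip_simps fun_eq_iff)

text \<open>A complex form is determined by its real part: from C \<xi> (\<i> \<eta>) = \<i> C \<xi>
  \<eta> it follows that the imaginary part of C \<xi> \<eta> is the negative of the real part of C
  \<xi> (\<i> \<eta>).\<close>

lemma real_part_to_sesquilinear:
  fixes L :: "(nat \<Rightarrow> 'g \<Rightarrow> 'g \<Rightarrow> complex) \<Rightarrow> real" and n i :: nat
  assumes add: "\<And>x y. L (tensor n x + tensor n y) = L (tensor n x) + L (tensor n y)"
    and scale: "\<And>r x. L (r *\<^sub>R tensor n x) = r * L (tensor n x)"
  defines "c \<equiv> \<lambda>\<xi> \<eta>. L (tensor n (simple i \<xi> \<eta>))"
  shows "sesquilinear sc (\<lambda>\<xi> \<eta>. Complex (c \<xi> \<eta>) (- c \<xi> (sc \<i> \<eta>)))"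
proof -
  \<comment> \<open>All laws for c are equalities between tensors to which L is applied, so that
    additivity and real homogeneity of L on generators suffice.\<close>
  have c_add1: "c (\<xi> + \<xi>') \<eta> = c \<xi> \<eta> + c \<xi>' \<eta>" for \<xi> \<xi>' \<eta>
    unfolding c_def add[symmetric]
    by (rule arg_cong[where f = L]) (auto simp: tensor_simple ip_simps algebra_simps fun_eq_iff)
  have c_add2: "c \<xi> (\<eta> + \<eta>') = c \<xi> \<eta> + c \<xi> \<eta>'" for \<xi> \<eta> \<eta>'
    unfolding c_def add[symmetric]
    by (rule arg_cong[where f = L]) (auto simp: tensor_simple ip_simps algebra_simps fun_eq_iff)
  have c_add3: "c \<xi> (sc a (\<eta> + \<eta>')) = c \<xi> (sc a \<eta>) + c \<xi> (sc a \<eta>')" for \<xi> \<eta> \<eta>' a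
    unfolding c_def add[symmetric]
    by (rule arg_cong[where f = L]) (auto simp: tensor_simple ip_simps algebra_simps fun_eq_iff)
  have c_sc: "c (sc a \<xi>) \<eta> = c \<xi> (sc (cnj a) \<eta>)" for a \<xi> \<eta>
    unfolding c_def by (rule arg_cong[where f = L]) (auto simp: tensor_simple ip_simps fun_eq_iff)
  have c_sc_sc: "c \<xi> (sc a (sc b \<eta>)) = c \<xi> (sc (a * b) \<eta>)" for a b \<xi> \<eta>
    unfolding c_def by (rule arg_cong[where f = L]) (auto simp: tensor_simple ip_simps fun_eq_iff)
  have c_complex: "c \<xi> (sc a \<eta>) = Re a * c \<xi> \<eta> + Im a * c \<xi> (sc \<i> \<eta>)" for a \<xi> \<eta>
  proof -
    have re: "L (tensor n (simple i \<xi> (sc (of_real r) \<eta>))) = r * c \<xi> \<eta>" for r \<eta>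
      unfolding c_def scale[symmetric]
      by (rule arg_cong[where f = L]) (auto simp: tensor_simple ip_simps fun_eq_iff scaleR_conv_of_real)
    have "tensor n (simple i \<xi> (sc a \<eta>)) =
        tensor n (simple i \<xi> (sc (of_real (Re a)) \<eta>)) + tensor n (simple i \<xi> (sc (of_real (Im a)) (sc \<i> \<eta>)))"
    proof -
      have "a = of_real (Re a) + of_real (Im a) * \<i>"
        by (metis complex_eq mult.commute)
      then have "a * u = of_real (Re a) * u + of_real (Im a) * (\<i> * u)" for u
        by (metis distrib_right mult.assoc)
      then show ?thesis
        by (auto simp: tensor_simple ip_simps fun_eq_iff distrib_right mult.assoc)
    qed
    then show ?thesis
      using add re unfolding c_def by simp
  qed
  have c_i: "c \<xi> (sc (\<i> * a) \<eta>) = Re a * c \<xi> (sc \<i> \<eta>) - Im a * c \<xi> \<eta>" for a \<xi> \<eta>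
    using c_complex[of \<xi> "\<i> * a" \<eta>] by simp
  show ?thesis
    unfolding sesquilinear_def
  proof (intro conjI allI)
    fix x y z a
    show "Complex (c (x + y) z) (- c (x + y) (sc \<i> z)) =
        Complex (c x z) (- c x (sc \<i> z)) + Complex (c y z) (- c y (sc \<i> z))"
      by (simp add: c_add1 complex_eq_iff)
    show "Complex (c x (y + z)) (- c x (sc \<i> (y + z))) =
        Complex (c x y) (- c x (sc \<i> y)) + Complex (c x z) (- c x (sc \<i> z))"
      by (simp add: c_add2 c_add3 complex_eq_iff)
    show "Complex (c x (sc a y)) (- c x (sc \<i> (sc a y))) = a * Complex (c x y) (- c x (sc \<i> y))"
      unfolding c_sc_sc c_complex[of x a] c_i by (simp add: complex_eq_iff algebra_simps)
    show "Complex (c (sc a x) y) (- c (sc a x) (sc \<i> y)) = cnj a * Complex (c x y) (- c x (sc \<i> y))"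
      unfolding c_sc c_sc_sc c_complex[of x "cnj a"] mult.commute[of "cnj a" \<i>] c_i
      by (simp add: complex_eq_iff algebra_simps)
  qed
qed

theorem column_row_decomposition:
  fixes W :: "nat \<Rightarrow> 'g \<Rightarrow> 'g \<Rightarrow> complex" and n :: nat
  defines "s \<equiv> 1 + 1 / sqrt (real n)"
  assumes n: "n \<ge> 1"
    and W': "\<forall>i<n. sesquilinear sc (W i) \<and> respects_null (W i)"
    and cb: "cb_bounded n K W"
  shows "\<exists>C. (\<forall>i. sesquilinear sc (C i)) \<and>
    (\<forall>\<xi> \<eta>. (\<Sum>i<n. Re (C i (\<xi> i) \<eta>)) \<le> K / 2 * ((\<Sum>i<n. sq (\<xi> i)) + sq \<eta>)) \<and>
    (\<forall>\<xi> \<eta>. (\<Sum>i<n. Re (of_real s * W i \<xi> (\<eta> i) - C i \<xi> (\<eta> i))) \<le> K / 2 * (sq \<xi> + (\<Sum>i<n. sq (\<eta> i))))"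
proof -
  have W: "sesquilinear sc (W i)" if "i < n" for i
    using W' that by auto
  \<comment> \<open>The symmetric price is lowered by the value of s W on the second summand of the
    tensor. Generators with only the first summand will then bound C, and generators with only the
    second will bound s W - C.\<close>
  define cost where "cost z = K / 2 * (\<Sum>j\<le>n. sq (fst z j) + sq (snd z j))
      - s * (\<Sum>i<n. Re (W i (snd z 0) (fst z (Suc i))))" for z
  have "\<exists>z'. tensor n z' = r *\<^sub>R tensor n z \<and> cost z' = r * cost z" if r: "r > 0" for r z
  proof (intro exI conjI)
    \<comment> \<open>Tensor and cost are both quadratic in the vectors, so each vector receives the
      factor sqrt r.\<close>
    define a where "a = complex_of_real (sqrt r)"
    have a: "a * (a * u) = of_real r * u" "cnj a * u = a * u" "(cmod a)\<^sup>2 = r" for u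
      using r by (simp_all add: a_def flip: of_real_mult mult.assoc)
    let ?z = "(\<lambda>j. sc a (fst z j), \<lambda>j. sc a (snd z j))"
    show "tensor n ?z = r *\<^sub>R tensor n z"
      by (auto simp: tensor_def ip_simps fun_eq_iff a mult_ac scaleR_conv_of_real right_diff_distrib)
    have "Re (W i (sc a (snd z 0)) (sc a (fst z (Suc i)))) = r * Re (W i (snd z 0) (fst z (Suc i)))"
      if "i < n" for i
      unfolding sesquilinearD[OF W[OF that]] a by simp
    then show "cost ?z = r * cost z"
      unfolding cost_def by (simp add: sq_scale a(3) sum_distrib_left algebra_simps)
  qed
  moreover have "\<exists>z'. tensor n z' = - tensor n z" for z
    by (rule exI[of _ "(\<lambda>j. sc (- 1) (fst z j), snd z)"]) (auto simp: tensor_def ip_simps fun_eq_iff)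
  moreover have "(\<Sum>k<m. cost (z k)) \<ge> 0" if z: "(\<Sum>k<m. tensor n (z k)) = 0" for m :: nat and z
  proof -
    \<comment> \<open>With the index (slot, number of the generator), vanishing of the sum of the
      tensors is the balance condition of \<open>balanced_bound\<close>.\<close>
    define \<alpha> where "\<alpha> p = fst (z (snd p)) (fst p)" for p
    define \<beta> where "\<beta> p = snd (z (snd p)) (fst p)" for p
    have "s * (\<Sum>i<n. \<Sum>k<m. Re (W i (\<beta> (0, k)) (\<alpha> (Suc i, k))))
        \<le> K / 2 * (\<Sum>p\<in>{..n} \<times> {..<m}. sq (\<alpha> p) + sq (\<beta> p))"
      unfolding s_def
    proof (rule balanced_bound[OF n W' cb], intro allI impI)
      fix i \<zeta> \<zeta>' assume i: "i < n"
      have "(\<Sum>k<m. tensor n (z k)) i \<zeta> \<zeta>' = 0" by (simp add: z)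
      then show "(\<Sum>k<m. ip \<zeta> (\<alpha> (0, k)) * ip (\<beta> (Suc i, k)) \<zeta>') =
          (\<Sum>k<m. ip \<zeta> (\<alpha> (Suc i, k)) * ip (\<beta> (0, k)) \<zeta>')"
        using i by (simp add: sum_fun_apply tensor_def \<alpha>_def \<beta>_def sum_subtractf)
    qed
    moreover have "(\<Sum>p\<in>{..n} \<times> {..<m}. sq (\<alpha> p) + sq (\<beta> p)) =
        (\<Sum>k<m. \<Sum>j\<le>n. sq (fst (z k) j) + sq (snd (z k) j))"
      by (subst sum.swap) (simp add: \<alpha>_def \<beta>_def sum.cartesian_product split_beta)
    moreover have "(\<Sum>i<n. \<Sum>k<m. Re (W i (\<beta> (0, k)) (\<alpha> (Suc i, k)))) =
        (\<Sum>k<m. \<Sum>i<n. Re (W i (snd (z k) 0) (fst (z k) (Suc i))))"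
      by (subst sum.swap) (simp add: \<alpha>_def \<beta>_def)
    ultimately show ?thesis
      unfolding cost_def sum_subtractf sum_distrib_left[symmetric] by simp
  qed
  ultimately have "\<exists>L. (\<forall>x y. L (tensor n x + tensor n y) = L (tensor n x) + L (tensor n y)) \<and>
      (\<forall>I x. finite (I :: nat set) \<longrightarrow> L (\<Sum>i\<in>I. tensor n (x i)) = (\<Sum>i\<in>I. L (tensor n (x i)))) \<and>
      (\<forall>r x. L (r *\<^sub>R tensor n x) = r * L (tensor n x)) \<and> (\<forall>x. L (tensor n x) \<le> cost x)"
    by (rule generated_hahn_banach)
  then obtain L where L: "\<forall>x y. L (tensor n x + tensor n y) = L (tensor n x) + L (tensor n y)"
      "\<forall>I x. finite (I :: nat set) \<longrightarrow> L (\<Sum>i\<in>I. tensor n (x i)) = (\<Sum>i\<in>I. L (tensor n (x i)))"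
      "\<forall>r x. L (r *\<^sub>R tensor n x) = r * L (tensor n x)" "\<forall>x. L (tensor n x) \<le> cost x"
    by (elim exE conjE)
  note L_add = L(1)[rule_format] and L_sum = L(2)[rule_format]
    and L_scale = L(3)[rule_format] and L_cost = L(4)[rule_format]
  define c where "c i \<xi> \<eta> = L (tensor n (simple i \<xi> \<eta>))" for i \<xi> \<eta>
  define C where "C i \<xi> \<eta> = Complex (c i \<xi> \<eta>) (- c i \<xi> (sc \<i> \<eta>))" for i \<xi> \<eta>
  show ?thesis
  proof (intro exI[of _ C] conjI allI)
    show "sesquilinear sc (C i)" for i
      unfolding C_def c_def by (rule real_part_to_sesquilinear[OF L_add L_scale])
  next
    fix \<xi> :: "nat \<Rightarrow> 'g" and \<eta> :: 'g
    \<comment> \<open>Only the first summand of \<open>tensor\<close> survives, and the W term of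
      the cost vanishes.\<close>
    let ?z = "(\<lambda>j. if j = 0 then \<eta> else 0, \<lambda>j. if j = 0 then 0 else \<xi> (j - 1))"
    have "tensor n ?z = (\<Sum>i<n. tensor n (simple i (\<xi> i) \<eta>))"
      by (auto simp: fun_eq_iff sum_fun_apply tensor_simple, auto simp: tensor_def ip_simps)
    then have "(\<Sum>i<n. c i (\<xi> i) \<eta>) = L (tensor n ?z)"
      by (simp add: L_sum c_def)
    also have "\<dots> \<le> cost ?z" by (rule L_cost)
    also have "\<dots> = K / 2 * ((\<Sum>i<n. sq (\<xi> i)) + sq \<eta>)"
      using sesquilinear_zero[OF W] by (simp add: cost_def sum.atMost_shift)
    finally show "(\<Sum>i<n. Re (C i (\<xi> i) \<eta>)) \<le> K / 2 * ((\<Sum>i<n. sq (\<xi> i)) + sq \<eta>)"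
      by (simp add: C_def)
  next
    fix \<xi> :: 'g and \<eta> :: "nat \<Rightarrow> 'g"
    \<comment> \<open>Only the second summand of \<open>tensor\<close> survives. Its minus sign is
      moved into the vectors \<eta> i, because L is additive only on sums of tensors.\<close>
    let ?z = "(\<lambda>j. if j = 0 then 0 else \<eta> (j - 1), \<lambda>j. if j = 0 then \<xi> else 0)"
    have "tensor n ?z = - (\<Sum>i<n. tensor n (simple i \<xi> (\<eta> i)))"
      by (auto simp: fun_eq_iff sum_fun_apply tensor_simple, auto simp: tensor_def ip_simps)
    also have "\<dots> = (\<Sum>i<n. tensor n (simple i \<xi> (sc (- 1) (\<eta> i))))"
      unfolding sum_negf[symmetric]
      by (intro sum.cong refl) (auto simp: fun_eq_iff tensor_simple ip_simps)
    finally have "L (tensor n ?z) = (\<Sum>i<n. L (tensor n (simple i \<xi> (sc (- 1) (\<eta> i)))))"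
      by (simp only: L_sum finite_lessThan)
    also have "\<dots> = (\<Sum>i<n. - c i \<xi> (\<eta> i))"
    proof (intro sum.cong refl)
      fix i
      have "tensor n (simple i \<xi> (sc (- 1) (\<eta> i))) = (- 1) *\<^sub>R tensor n (simple i \<xi> (\<eta> i))"
        by (auto simp: fun_eq_iff tensor_simple ip_simps)
      then show "L (tensor n (simple i \<xi> (sc (- 1) (\<eta> i)))) = - c i \<xi> (\<eta> i)"
        by (simp only: L_scale c_def)
    qed
    finally have "(\<Sum>i<n. - c i \<xi> (\<eta> i)) \<le> cost ?z"
      using L_cost[of ?z] by simp
    also have "\<dots> = K / 2 * (sq \<xi> + (\<Sum>i<n. sq (\<eta> i))) - s * (\<Sum>i<n. Re (W i \<xi> (\<eta> i)))"
      by (simp add: cost_def sum.atMost_shift)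
    finally show "(\<Sum>i<n. Re (of_real s * W i \<xi> (\<eta> i) - C i \<xi> (\<eta> i))) \<le> K / 2 * (sq \<xi> + (\<Sum>i<n. sq (\<eta> i)))"
      by (simp add: C_def sum_subtractf sum_negf sum_distrib_left)
  qed
qed

end

section \<open>Hilbert space operators\<close>

text \<open>The quotient (r^2 A + B) / r is smallest at r = sqrt B / sqrt A, with value 2 sqrt A
  sqrt B. If A or B vanishes, there is no optimal r, and an extreme r shows X \<le> 0.\<close>

lemma homogenize:
  fixes A B K X :: real
  assumes "A \<ge> 0" "B \<ge> 0" "K \<ge> 0" and le: "\<And>r. r > 0 \<Longrightarrow> r * X \<le> K / 2 * (r\<^sup>2 * A + B)"
  shows "X \<le> K * sqrt A * sqrt B"
proof (cases "A > 0 \<and> B > 0")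
  case True
  define r where "r = sqrt B / sqrt A"
  have r: "r > 0" using True unfolding r_def by simp
  have "r\<^sup>2 * A = B" using True unfolding r_def by (simp add: power_divide)
  then have "r * X \<le> K * B" using le[OF r] by simp
  also have "K * B = r * (K * sqrt A * sqrt B)" using True unfolding r_def by simp
  finally show ?thesis using r by simp
next
  case False
  have "X \<le> 0"
  proof (rule ccontr)
    assume "\<not> X \<le> 0"
    then have X: "X > 0" by simp
    show False
    proof (cases "A = 0")
      case True
      \<comment> \<open>For A = 0 the bound does not grow with r; this r gives r X = K / 2 B + 1,
        which exceeds it.\<close>
      define r where "r = (K / 2 * B + 1) / X"
      have "r > 0" using X assms unfolding r_def by (intro divide_pos_pos add_nonneg_pos) auto
      then show False using le[of r] X True unfolding r_def by simp
    next
      case A: False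
      then have B: "B = 0" using False assms by simp
      \<comment> \<open>For B = 0 the bound is quadratic in r, so a small r contradicts X > 0; the
        summand 1 keeps the denominator positive when K = 0.\<close>
      define r where "r = X / (K / 2 * A + 1)"
      have pos: "K / 2 * A + 1 > 0" using assms by (intro add_nonneg_pos) auto
      have r: "r > 0" using X pos unfolding r_def by simp
      have "r * X \<le> r * (r * (K / 2 * A))" using le[OF r] B by (simp add: power2_eq_square mult_ac)
      then have "X \<le> r * (K / 2 * A)" using r by simp
      also have "r * (K / 2 * A) < r * (K / 2 * A + 1)" using r by simp
      also have "\<dots> = X" using pos unfolding r_def by simp
      finally show False by simp
    qed
  qed
  moreover have "0 \<le> K * sqrt A * sqrt B" using assms by simp
  ultimately show ?thesis by linarith
qed

section \<open>Inner product calculus and the Riesz representation\<close>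

lemma cinner_sesquilinear: "sesquilinear scaleC (cinner :: 'h::complex_hilbert_space \<Rightarrow> 'h \<Rightarrow> complex)"
  unfolding sesquilinear_def
proof (intro conjI allI)
  fix x y z :: 'h and a
  show "cinner (x + y) z = cinner x z + cinner y z"
    by (metis cinner_add_right cinner_commute complex_cnj_add)
  show "cinner (scaleC a x) y = cnj a * cinner x y"
    by (metis cinner_commute cinner_scaleC_right complex_cnj_mult)
qed (simp_all add: cinner_add_right cinner_scaleC_right)

interpretation hilbert: semi_inner_space "scaleC :: complex \<Rightarrow> 'h \<Rightarrow> 'h::complex_hilbert_space" cinner
  by unfold_locales (rule cinner_sesquilinear)

lemmas cinner_simps = hilbert.ip_simps

lemma hilbert_sq [simp]: "hilbert.sq x = (norm x)\<^sup>2"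
  by (simp add: hilbert.sq_def cinner_self del: of_real_power)

lemma cinner_minus:
  fixes x y :: "'h::complex_hilbert_space"
  shows "cinner (- x) y = - cinner x y" "cinner x (- y) = - cinner x y"
  by (metis add.right_inverse add_eq_0_iff2 cinner_simps(1,5) minus_unique, metis add.right_inverse
      cinner_simps(2,6) minus_unique)

lemma cinner_diff:
  fixes x y z :: "'h::complex_hilbert_space"
  shows "cinner (x - y) z = cinner x z - cinner y z" "cinner x (y - z) = cinner x y - cinner x z"
  using cinner_simps(1)[of x "- y" z] cinner_simps(2)[of x y "- z"] by (simp_all add: cinner_minus)

lemma cinner_scaleR:
  fixes x y :: "'h::complex_hilbert_space"
  shows "cinner (r *\<^sub>R x) y = of_real r * cinner x y" "cinner x (r *\<^sub>R y) = of_real r * cinner x y"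
  by (simp_all add: cinner_simps flip: scaleC_of_real)

lemma cinner_sum:
  fixes f :: "'i \<Rightarrow> 'h::complex_hilbert_space"
  shows "cinner (\<Sum>i\<in>I. f i) y = (\<Sum>i\<in>I. cinner (f i) y)" "cinner x (\<Sum>i\<in>I. f i) = (\<Sum>i\<in>I. cinner x (f i))"
  by (induction I rule: infinite_finite_induct) (simp_all add: cinner_simps)

lemma Re_cinner_self: "Re (cinner x x) = (norm (x :: 'h::complex_hilbert_space))\<^sup>2"
  by (simp add: cinner_self del: of_real_power)

lemma cinner_eqI:
  fixes y z :: "'h::complex_hilbert_space"
  assumes "\<And>x. cinner x y = cinner x z"
  shows "y = z"
  using Re_cinner_self[of "y - z"] assms by (simp add: cinner_diff)

lemma norm_add_sq:
  fixes x y :: "'h::complex_hilbert_space"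
  shows "(norm (x + y))\<^sup>2 = (norm x)\<^sup>2 + (norm y)\<^sup>2 + 2 * Re (cinner x y)"
proof -
  have "Re (cinner y x) = Re (cinner x y)" by (subst cinner_commute) simp
  then show ?thesis by (simp add: cinner_simps flip: Re_cinner_self)
qed

lemma norm_diff_sq:
  fixes x y :: "'h::complex_hilbert_space"
  shows "(norm (x - y))\<^sup>2 = (norm x)\<^sup>2 + (norm y)\<^sup>2 - 2 * Re (cinner x y)"
  using norm_add_sq[of x "- y"] by (simp add: cinner_minus)

lemma Re_cinner_le:
  fixes x y :: "'h::complex_hilbert_space"
  shows "Re (cinner x y) \<le> 1 / 2 * ((norm x)\<^sup>2 + (norm y)\<^sup>2)"
proof -
  have "0 \<le> (norm (x - y))\<^sup>2" by simp
  then show ?thesis unfolding norm_diff_sq by simp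
qed

lemma Re_cinner_le_norm:
  fixes x y :: "'h::complex_hilbert_space"
  shows "Re (cinner x y) \<le> norm x * norm y"
proof -
  have "Re (cinner x y) \<le> 1 * sqrt ((norm x)\<^sup>2) * sqrt ((norm y)\<^sup>2)"
  proof (rule homogenize)
    show "r * Re (cinner x y) \<le> 1 / 2 * (r\<^sup>2 * (norm x)\<^sup>2 + (norm y)\<^sup>2)" for r
      using Re_cinner_le[of "r *\<^sub>R x" y] by (simp add: cinner_scaleR power_mult_distrib)
  qed auto
  then show ?thesis by simp
qed

text \<open>The representing vector minimizes |x|^2 - 2 f x; completeness provides the minimizer and
  the first variation identifies it.\<close>

lemma riesz_real:
  fixes f :: "'h::complex_hilbert_space \<Rightarrow> real"
  assumes "bounded_linear f"
  shows "\<exists>y. \<forall>x. f x = Re (cinner y x)"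
proof -
  interpret f: bounded_linear f by fact
  obtain B where B: "\<And>x. norm (f x) \<le> norm x * B"
    using f.bounded by blast
  define J where "J x = (norm x)\<^sup>2 - 2 * f x" for x
  have J_low: "- B\<^sup>2 \<le> J x" for x
  proof -
    have "0 \<le> (norm x - B)\<^sup>2" by simp
    moreover have "f x \<le> norm x * B" using B[of x] by simp
    ultimately show ?thesis unfolding J_def by (simp add: power2_diff)
  qed
  define d where "d = Inf (range J)"
  have bdd: "bdd_below (range J)" using J_low unfolding bdd_below_def by blast
  have dJ: "d \<le> J x" for x unfolding d_def using bdd by (intro cInf_lower) auto
  have "\<exists>x. J x < d + 1 / real (Suc n)" for n
    using cInf_lessD[of "range J" "d + 1 / real (Suc n)"] unfolding d_def by auto
  then obtain u where u: "\<And>n. J (u n) < d + 1 / real (Suc n)" by metis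
  \<comment> \<open>Parallelogram law, with J at the midpoint of x and y bounded below by d. It
    makes every minimizing sequence Cauchy.\<close>
  have close: "(norm (x - y))\<^sup>2 \<le> 2 * (J x - d) + 2 * (J y - d)" for x y
  proof -
    have "J ((1 / 2) *\<^sub>R (x + y)) = (norm (x + y))\<^sup>2 / 4 - (f x + f y)"
      unfolding J_def by (simp only: f.scaleR f.add norm_scaleR power_mult_distrib)
          (simp add: power_divide field_simps)
    then have "d \<le> (norm (x + y))\<^sup>2 / 4 - (f x + f y)" using dJ by metis
    then show ?thesis
      unfolding J_def norm_add_sq norm_diff_sq by (simp add: field_simps)
  qed
  have "Cauchy u"
  proof (rule metric_CauchyI)
    fix e :: real assume e: "e > 0"
    obtain N :: nat where N: "4 / e\<^sup>2 < real N" using reals_Archimedean2 by blast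
    have "dist (u m) (u n) < e" if "m \<ge> N" "n \<ge> N" for m n
    proof -
      have "real N > 0" using N e by (smt (verit) divide_pos_pos zero_less_power)
      have le: "1 / real (Suc k) \<le> 1 / real N" if "k \<ge> N" for k
        using that \<open>real N > 0\<close> by (intro divide_left_mono) auto
      have "(norm (u m - u n))\<^sup>2 < 4 / real N"
        using close[of "u m" "u n"] u[of m] u[of n] le[OF that(1)] le[OF that(2)] by simp
      also have "4 / real N < e\<^sup>2" using N e \<open>real N > 0\<close> by (simp add: field_simps)
      finally have "norm (u m - u n) < e" using e by (simp add: power2_less_imp_less)
      then show ?thesis by (simp add: dist_norm)
    qed
    then show "\<exists>M. \<forall>m\<ge>M. \<forall>n\<ge>M. dist (u m) (u n) < e" by blast
  qed
  then obtain y where y: "u \<longlonglongrightarrow> y" using Cauchy_convergent convergent_def by blast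
  have "(\<lambda>n. J (u n)) \<longlonglongrightarrow> J y"
    unfolding J_def by (intro tendsto_intros y f.tendsto)
  moreover have "(\<lambda>n. d + 1 / real (Suc n)) \<longlonglongrightarrow> d + 0"
    by (intro tendsto_intros LIMSEQ_Suc[OF lim_1_over_n])
  ultimately have Jy: "J y \<le> d"
    using u less_imp_le by (intro LIMSEQ_le[of "\<lambda>n. J (u n)" "J y" "\<lambda>n. d + 1 / real (Suc n)" d]) auto
  have le: "f x \<le> Re (cinner y x)" for x
  proof -
    \<comment> \<open>The minimizer y is compared with y + r x. Since the right side is quadratic in
      r, the linear coefficient cannot be positive.\<close>
    have "r * (2 * (f x - Re (cinner y x))) \<le> 2 / 2 * (r\<^sup>2 * (norm x)\<^sup>2 + 0)" for r
    proof -
      have "J y \<le> J (y + r *\<^sub>R x)" using Jy dJ order_trans by blast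
      then show ?thesis
        unfolding J_def norm_add_sq
        by (simp add: f.add f.scaleR cinner_scaleR power_mult_distrib algebra_simps)
    qed
    then have "2 * (f x - Re (cinner y x)) \<le> 2 * sqrt ((norm x)\<^sup>2) * sqrt 0"
      by (intro homogenize) auto
    then show ?thesis by simp
  qed
  have "f x = Re (cinner y x)" for x
    using le[of x] le[of "- x"] f.scaleR[of "- 1" x] by (simp add: cinner_minus)
  then show ?thesis by blast
qed

lemma bounded_opsI:
  fixes T :: "'h::complex_hilbert_space \<Rightarrow>\<^sub>L 'h"
  assumes "\<And>c x. T (scaleC c x) = scaleC c (T x)"
  shows "T \<in> bounded_ops"
  using assms unfolding bounded_ops_def by blast

lemma bounded_opsD:
  "T \<in> bounded_ops \<Longrightarrow> blinfun_apply T (scaleC c x) = scaleC c (blinfun_apply T x)"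
  unfolding bounded_ops_def by blast

text \<open>Riesz for each fixed \<eta> defines T \<eta>; uniqueness of the representing vector
  makes T complex linear, and testing with \<xi> = T \<eta> bounds it.\<close>

lemma operator_of_form:
  fixes C :: "'h::complex_hilbert_space \<Rightarrow> 'h \<Rightarrow> complex"
  assumes C: "sesquilinear scaleC C" and M: "M \<ge> 0"
    and bound: "\<And>\<xi> \<eta>. Re (C \<xi> \<eta>) \<le> M * norm \<xi> * norm \<eta>"
  shows "\<exists>T\<in>bounded_ops. \<forall>\<xi> \<eta>. C \<xi> \<eta> = cinner \<xi> (blinfun_apply T \<eta>)"
proof -
  note C_simps = sesquilinearD[OF C]
  have C_scaleR: "C (r *\<^sub>R \<xi>) \<eta> = of_real r * C \<xi> \<eta>" for r \<xi> \<eta>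
    using C_simps(3)[of "of_real r" \<xi> \<eta>] by (simp add: scaleC_of_real)
  have "\<exists>y. \<forall>\<xi>. C \<xi> \<eta> = cinner \<xi> y" for \<eta>
  proof -
    have "bounded_linear (\<lambda>\<xi>. Re (C \<xi> \<eta>))"
    proof (rule bounded_linear_intro[where K = "M * norm \<eta>"])
      fix x y r
      show "Re (C (x + y) \<eta>) = Re (C x \<eta>) + Re (C y \<eta>)" by (simp add: C_simps)
      show "Re (C (r *\<^sub>R x) \<eta>) = r *\<^sub>R Re (C x \<eta>)" by (simp add: C_scaleR)
      have "C (- x) \<eta> = - C x \<eta>" using C_scaleR[of "- 1" x \<eta>] by simp
      then show "norm (Re (C x \<eta>)) \<le> norm x * (M * norm \<eta>)"
        using bound[of x \<eta>] bound[of "- x" \<eta>] by (simp add: mult_ac abs_le_iff)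
    qed
    then obtain y where y: "\<And>\<xi>. Re (C \<xi> \<eta>) = Re (cinner y \<xi>)" using riesz_real by blast
    have "C \<xi> \<eta> = cinner \<xi> y" for \<xi>
    proof (rule complex_eqI)
      have Re: "Re (C \<xi> \<eta>) = Re (cinner \<xi> y)" for \<xi>
        using y[of \<xi>] cinner_commute[of y \<xi>] by simp
      then show "Re (C \<xi> \<eta>) = Re (cinner \<xi> y)" .
      show "Im (C \<xi> \<eta>) = Im (cinner \<xi> y)"
        using Re[of "scaleC \<i> \<xi>"] by (simp add: C_simps cinner_simps)
    qed
    then show ?thesis by blast
  qed
  then obtain T where T: "\<And>\<xi> \<eta>. C \<xi> \<eta> = cinner \<xi> (T \<eta>)" by metis
  have T_add: "T (x + y) = T x + T y" for x y
    by (rule cinner_eqI) (simp add: cinner_simps C_simps flip: T)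
  have T_sc: "T (scaleC a x) = scaleC a (T x)" for a x
    by (rule cinner_eqI) (simp add: cinner_simps C_simps flip: T)
  have T_norm: "norm (T x) \<le> norm x * M" for x
  proof -
    have "norm (T x) * norm (T x) \<le> norm (T x) * (norm x * M)"
      using bound[of "T x" x] unfolding T Re_cinner_self by (simp add: power2_eq_square mult_ac)
    then show ?thesis
      using M by (cases "norm (T x) = 0") (auto simp: mult_le_cancel_left)
  qed
  have "bounded_linear T"
    by (rule bounded_linear_intro[where K = M]) (use T_add T_sc[of "of_real _"] T_norm in \<open>auto simp:
        scaleC_of_real\<close>)
  then have app: "blinfun_apply (Blinfun T) = T" by (rule bounded_linear_Blinfun_apply)
  show ?thesis
    by (rule bexI[of _ "Blinfun T"]) (auto intro: bounded_opsI simp: app T T_sc)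
qed

section \<open>Norms of operator matrices in weak form\<close>

lemma op_mnorm_bdd:
  fixes X :: "nat \<Rightarrow> nat \<Rightarrow> ('h::complex_hilbert_space \<Rightarrow>\<^sub>L 'h)"
  shows "bdd_above ((\<lambda>\<xi>. sqrt (\<Sum>i<k. (norm (\<Sum>j<k. blinfun_apply (X i j) (\<xi> j)))\<^sup>2)) `
    {\<xi> :: nat \<Rightarrow> 'h. (\<Sum>j<k. (norm (\<xi> j))\<^sup>2) \<le> 1})"
proof (rule bdd_aboveI2)
  fix \<xi> :: "nat \<Rightarrow> 'h" assume "\<xi> \<in> {\<xi>. (\<Sum>j<k. (norm (\<xi> j))\<^sup>2) \<le> 1}"
  then have \<xi>: "(\<Sum>j<k. (norm (\<xi> j))\<^sup>2) \<le> 1" by simp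
  have "norm (\<xi> j) \<le> 1" if "j < k" for j
  proof -
    have "(norm (\<xi> j))\<^sup>2 \<le> (\<Sum>j<k. (norm (\<xi> j))\<^sup>2)"
      using that by (intro member_le_sum) auto
    then show ?thesis using \<xi> by (simp add: power2_le_imp_le)
  qed
  then have "norm (blinfun_apply (X i j) (\<xi> j)) \<le> norm (X i j)" if "j < k" for i j
    using norm_blinfun[of "X i j" "\<xi> j"] that mult_left_mono[of "norm (\<xi> j)" 1 "norm (X i j)"] by force
  then have "norm (\<Sum>j<k. blinfun_apply (X i j) (\<xi> j)) \<le> (\<Sum>j<k. norm (X i j))" for i
    by (intro order.trans[OF norm_sum] sum_mono) auto
  then show "sqrt (\<Sum>i<k. (norm (\<Sum>j<k. blinfun_apply (X i j) (\<xi> j)))\<^sup>2) \<le>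
      sqrt (\<Sum>i<k. (\<Sum>j<k. norm (X i j))\<^sup>2)"
    by (intro real_sqrt_le_mono sum_mono power_mono) auto
qed

lemma op_mnorm_ge:
  fixes X :: "nat \<Rightarrow> nat \<Rightarrow> ('h::complex_hilbert_space \<Rightarrow>\<^sub>L 'h)"
  assumes "(\<Sum>j<k. (norm (\<xi> j))\<^sup>2) \<le> 1"
  shows "sqrt (\<Sum>i<k. (norm (\<Sum>j<k. blinfun_apply (X i j) (\<xi> j)))\<^sup>2) \<le> op_mnorm k X"
  unfolding op_mnorm_def by (rule cSUP_upper[OF _ op_mnorm_bdd]) (use assms in simp)

lemma op_mnorm_nonneg: "0 \<le> op_mnorm k X"
  using op_mnorm_ge[where \<xi> = "\<lambda>_. 0" and k = k and X = X] by simp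

lemma cauchy_schwarz_weak:
  fixes a b :: "'i \<Rightarrow> 'h::complex_hilbert_space"
  shows "(\<Sum>i\<in>I. Re (cinner (a i) (b i))) \<le> sqrt (\<Sum>i\<in>I. (norm (a i))\<^sup>2) * sqrt (\<Sum>i\<in>I. (norm (b i))\<^sup>2)"
proof -
  have "(\<Sum>i\<in>I. Re (cinner (a i) (b i))) \<le> 1 * sqrt (\<Sum>i\<in>I. (norm (a i))\<^sup>2) * sqrt (\<Sum>i\<in>I. (norm (b i))\<^sup>2)"
  proof (rule homogenize)
    fix r :: real
    have "r * (\<Sum>i\<in>I. Re (cinner (a i) (b i))) = (\<Sum>i\<in>I. Re (cinner (r *\<^sub>R a i) (b i)))"
      by (simp add: cinner_scaleR sum_distrib_left)
    also have "\<dots> \<le> (\<Sum>i\<in>I. 1 / 2 * ((norm (r *\<^sub>R a i))\<^sup>2 + (norm (b i))\<^sup>2))"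
      by (intro sum_mono Re_cinner_le)
    also have "\<dots> = 1 / 2 * (r\<^sup>2 * (\<Sum>i\<in>I. (norm (a i))\<^sup>2) + (\<Sum>i\<in>I. (norm (b i))\<^sup>2))"
      by (simp add: power_mult_distrib sum.distrib sum_distrib_left distrib_left)
    finally show "r * (\<Sum>i\<in>I. Re (cinner (a i) (b i))) \<le>
        1 / 2 * (r\<^sup>2 * (\<Sum>i\<in>I. (norm (a i))\<^sup>2) + (\<Sum>i\<in>I. (norm (b i))\<^sup>2))" .
  qed (auto intro: sum_nonneg)
  then show ?thesis by simp
qed

lemma op_mnorm_apply:
  fixes X :: "nat \<Rightarrow> nat \<Rightarrow> ('h::complex_hilbert_space \<Rightarrow>\<^sub>L 'h)"
  shows "sqrt (\<Sum>i<k. (norm (\<Sum>j<k. blinfun_apply (X i j) (\<xi> j)))\<^sup>2) \<le> op_mnorm k X * sqrt (\<Sum>j<k. (norm (\<xi> j))\<^sup>2)"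
proof -
  define s where "s = sqrt (\<Sum>j<k. (norm (\<xi> j))\<^sup>2)"
  have s2: "s\<^sup>2 = (\<Sum>j<k. (norm (\<xi> j))\<^sup>2)" unfolding s_def by (simp add: sum_nonneg)
  show ?thesis
  proof (cases "s = 0")
    case True
    then have "\<xi> j = 0" if "j < k" for j
      using s2 that by (simp add: sum_nonneg_eq_0_iff)
    then show ?thesis using True unfolding s_def by (simp add: blinfun.zero_right)
  next
    case False
    then have s: "s > 0" unfolding s_def by (metis less_eq_real_def real_sqrt_ge_zero sum_nonneg
        zero_le_power2)
    have "sqrt (\<Sum>i<k. (norm (\<Sum>j<k. blinfun_apply (X i j) ((1 / s) *\<^sub>R \<xi> j)))\<^sup>2) \<le> op_mnorm k X"
      using s by (intro op_mnorm_ge) (simp add: power_divide s2[symmetric] flip: sum_divide_distrib)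
    also have "sqrt (\<Sum>i<k. (norm (\<Sum>j<k. blinfun_apply (X i j) ((1 / s) *\<^sub>R \<xi> j)))\<^sup>2) =
        sqrt (\<Sum>i<k. (norm (\<Sum>j<k. blinfun_apply (X i j) (\<xi> j)))\<^sup>2) / s"
      using s by (simp only: blinfun.scaleR_right scaleR_sum_right[symmetric])
        (simp add: power_divide real_sqrt_divide flip: sum_divide_distrib)
    finally show ?thesis using s unfolding s_def[symmetric] by (simp add: field_simps)
  qed
qed

text \<open>Together with \<open>op_mnorm_weak_le\<close> this trades the supremum in
  \<open>op_mnorm\<close> for an estimate that is additive in the vectors. The mean of squares in
  place of the product of norms loses nothing, as either family can be rescaled.\<close>

lemma op_mnorm_weak_ge:
  fixes X :: "nat \<Rightarrow> nat \<Rightarrow> ('h::complex_hilbert_space \<Rightarrow>\<^sub>L 'h)"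
  assumes "op_mnorm k X \<le> c"
  shows "(\<Sum>i<k. \<Sum>j<k. Re (cinner (\<xi> i) (blinfun_apply (X i j) (\<eta> j))))
    \<le> c / 2 * ((\<Sum>i<k. (norm (\<xi> i))\<^sup>2) + (\<Sum>j<k. (norm (\<eta> j))\<^sup>2))"
proof -
  define a where "a = sqrt (\<Sum>i<k. (norm (\<xi> i))\<^sup>2)"
  define b where "b = sqrt (\<Sum>i<k. (norm (\<eta> i))\<^sup>2)"
  have ab: "a\<^sup>2 = (\<Sum>i<k. (norm (\<xi> i))\<^sup>2)" "b\<^sup>2 = (\<Sum>i<k. (norm (\<eta> i))\<^sup>2)" "a \<ge> 0" "b \<ge> 0"
    unfolding a_def b_def by (simp_all add: sum_nonneg)
  have c: "c \<ge> 0" using op_mnorm_nonneg[of k X] assms by simp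
  have "(\<Sum>i<k. \<Sum>j<k. Re (cinner (\<xi> i) (blinfun_apply (X i j) (\<eta> j)))) =
      (\<Sum>i<k. Re (cinner (\<xi> i) (\<Sum>j<k. blinfun_apply (X i j) (\<eta> j))))"
    by (simp add: cinner_sum)
  also have "\<dots> \<le> a * sqrt (\<Sum>i<k. (norm (\<Sum>j<k. blinfun_apply (X i j) (\<eta> j)))\<^sup>2)"
    unfolding a_def by (rule cauchy_schwarz_weak)
  also have "\<dots> \<le> a * (op_mnorm k X * b)"
    unfolding b_def using ab by (intro mult_left_mono op_mnorm_apply)
  also have "\<dots> \<le> a * (c * b)"
    using ab assms by (intro mult_left_mono mult_right_mono)
  also have "\<dots> = c * (a * b)" by simp
  also have "\<dots> \<le> c * (1 / 2 * (a\<^sup>2 + b\<^sup>2))"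
    using sum_squares_bound[of a b] c by (intro mult_left_mono) auto
  finally show ?thesis by (simp add: ab)
qed

lemma op_mnorm_weak_le:
  fixes X :: "nat \<Rightarrow> nat \<Rightarrow> ('h::complex_hilbert_space \<Rightarrow>\<^sub>L 'h)"
  assumes c: "c \<ge> 0"
    and weak: "\<And>\<xi> \<eta>. (\<Sum>i<k. \<Sum>j<k. Re (cinner (\<xi> i) (blinfun_apply (X i j) (\<eta> j))))
      \<le> c / 2 * ((\<Sum>i<k. (norm (\<xi> i))\<^sup>2) + (\<Sum>j<k. (norm (\<eta> j))\<^sup>2))"
  shows "op_mnorm k X \<le> c"
  unfolding op_mnorm_def
proof (rule cSUP_least)
  have "(\<lambda>_. 0) \<in> {\<xi> :: nat \<Rightarrow> 'h. (\<Sum>j<k. (norm (\<xi> j))\<^sup>2) \<le> 1}" by simp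
  then show "{\<xi> :: nat \<Rightarrow> 'h. (\<Sum>j<k. (norm (\<xi> j))\<^sup>2) \<le> 1} \<noteq> {}" by (metis empty_iff)
next
  fix \<eta> :: "nat \<Rightarrow> 'h" assume "\<eta> \<in> {\<xi>. (\<Sum>j<k. (norm (\<xi> j))\<^sup>2) \<le> 1}"
  then have \<eta>: "(\<Sum>j<k. (norm (\<eta> j))\<^sup>2) \<le> 1" by simp
  define y where "y i = (\<Sum>j<k. blinfun_apply (X i j) (\<eta> j))" for i
  define S where "S = (\<Sum>i<k. (norm (y i))\<^sup>2)"
  have S: "S \<ge> 0" unfolding S_def by (simp add: sum_nonneg)
  \<comment> \<open>The test family is r y with y = X \<eta>; optimizing over r recovers the product
    of norms.\<close>
  have "S \<le> c * sqrt S * sqrt (\<Sum>j<k. (norm (\<eta> j))\<^sup>2)"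
  proof (rule homogenize[OF S _ c])
    fix r :: real
    have "r * S = (\<Sum>i<k. \<Sum>j<k. Re (cinner (r *\<^sub>R y i) (blinfun_apply (X i j) (\<eta> j))))"
      unfolding S_def by (simp add: cinner_scaleR y_def sum_distrib_left cinner_sum flip: Re_cinner_self)
    also have "\<dots> \<le> c / 2 * ((\<Sum>i<k. (norm (r *\<^sub>R y i))\<^sup>2) + (\<Sum>j<k. (norm (\<eta> j))\<^sup>2))"
      by (rule weak)
    also have "(\<Sum>i<k. (norm (r *\<^sub>R y i))\<^sup>2) = r\<^sup>2 * S"
      unfolding S_def by (simp add: power_mult_distrib sum_distrib_left)
    finally show "r * S \<le> c / 2 * (r\<^sup>2 * S + (\<Sum>j<k. (norm (\<eta> j))\<^sup>2))" .
  qed (simp add: sum_nonneg)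
  also have "\<dots> \<le> c * sqrt S * 1"
    using \<eta> c S by (intro mult_left_mono) auto
  finally have "sqrt S * sqrt S \<le> c * sqrt S" using S by simp
  then have "sqrt S \<le> c"
    using S c mult_right_le_imp_le[of "sqrt S" "sqrt S" c] by (cases "S = 0") auto
  then show "sqrt (\<Sum>i<k. (norm (\<Sum>j<k. blinfun_apply (X i j) (\<eta> j)))\<^sup>2) \<le> c"
    unfolding S_def y_def .
qed

lemma op_mnorm_one: "op_mnorm 1 (\<lambda>_ _. T) = norm (T :: 'h::complex_hilbert_space \<Rightarrow>\<^sub>L 'h)"
proof (rule antisym)
  show "op_mnorm 1 (\<lambda>_ _. T) \<le> norm T"
  proof (rule op_mnorm_weak_le)
    fix \<xi> \<eta> :: "nat \<Rightarrow> 'h"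
    have "Re (cinner (\<xi> 0) (T (\<eta> 0))) \<le> norm (\<xi> 0) * norm (T (\<eta> 0))" by (rule Re_cinner_le_norm)
    also have "\<dots> \<le> norm (\<xi> 0) * (norm T * norm (\<eta> 0))" by (intro mult_left_mono norm_blinfun) auto
    also have "\<dots> = norm T * (norm (\<xi> 0) * norm (\<eta> 0))" by simp
    also have "\<dots> \<le> norm T * (1 / 2 * ((norm (\<xi> 0))\<^sup>2 + (norm (\<eta> 0))\<^sup>2))"
      using sum_squares_bound[of "norm (\<xi> 0)" "norm (\<eta> 0)"] by (intro mult_left_mono) auto
    finally show "(\<Sum>i<1. \<Sum>j<1. Re (cinner (\<xi> i) (T (\<eta> j))))
        \<le> norm T / 2 * ((\<Sum>i<1. (norm (\<xi> i))\<^sup>2) + (\<Sum>j<1. (norm (\<eta> j))\<^sup>2))" by simp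
  qed simp
  show "norm T \<le> op_mnorm 1 (\<lambda>_ _. T)"
  proof (rule norm_blinfun_bound[OF op_mnorm_nonneg])
    show "norm (T x) \<le> op_mnorm 1 (\<lambda>_ _. T) * norm x" for x
      using op_mnorm_apply[where k = 1 and X = "\<lambda>_ _. T" and \<xi> = "\<lambda>_. x"] by simp
  qed
qed

section \<open>Scalar matrices\<close>

lemma sum_div_mod:
  "(\<Sum>t<k * N. f t) = (\<Sum>p<k. \<Sum>r<N. f (p * N + r))" for k N :: nat
proof (induction k)
  case (Suc k)
  have "(\<Sum>t<Suc k * N. f t) = (\<Sum>t<k * N + N. f t)" by (simp add: add.commute)
  also have "\<dots> = (\<Sum>t<k * N. f t) + (\<Sum>r<N. f (k * N + r))"
  proof -
    have "{..<k * N + N} = {..<k * N} \<union> {k * N..<k * N + N}" by auto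
    moreover have "(\<Sum>t = k * N..<k * N + N. f t) = (\<Sum>r<N. f (k * N + r))"
      using sum.shift_bounds_nat_ivl[of f 0 "k * N" N] by (simp add: atLeast0LessThan add.commute)
    ultimately show ?thesis by (simp add: sum.union_disjoint ivl_disj_int)
  qed
  finally show ?case using Suc by simp
qed simp

definition fscale :: "complex \<Rightarrow> (nat \<Rightarrow> complex) \<Rightarrow> nat \<Rightarrow> complex" where
  "fscale a x = (\<lambda>r. a * x r)"

definition fip :: "nat \<Rightarrow> (nat \<Rightarrow> complex) \<Rightarrow> (nat \<Rightarrow> complex) \<Rightarrow> complex" where
  "fip N x y = (\<Sum>r<N. cnj (x r) * y r)"

definition mform :: "nat \<Rightarrow> complex mat \<Rightarrow> (nat \<Rightarrow> complex) \<Rightarrow> (nat \<Rightarrow> complex) \<Rightarrow> complex" where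
  "mform N M x y = (\<Sum>r<N. \<Sum>s<N. cnj (x r) * (M $$ (r, s) * y s))"

lemma fip_sesquilinear: "sesquilinear fscale (fip N)"
  unfolding sesquilinear_def fip_def fscale_def
  by (auto simp: algebra_simps sum.distrib sum_distrib_left)

lemma mform_sesquilinear: "sesquilinear fscale (mform N M)"
  unfolding sesquilinear_def mform_def fscale_def
  by (auto simp: algebra_simps sum.distrib sum_distrib_left)

interpretation fin: semi_inner_space fscale "fip N" for N
  by unfold_locales (rule fip_sesquilinear)

lemma fin_sq: "fin.sq N x = (\<Sum>r<N. (cmod (x r))\<^sup>2)"
proof -
  have "fip N x x = complex_of_real (\<Sum>r<N. (cmod (x r))\<^sup>2)"
    using cdot_self[of "{..<N}" x] by (simp add: fip_def cdot_def)
  then show ?thesis by (simp add: fin.sq_def)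
qed

text \<open>A null vector of \<open>fip N\<close> vanishes below N, and \<open>mform N\<close> reads
  only entries below N.\<close>

lemma mform_respects_null: "fin.respects_null N (mform N M)"
  unfolding fin.respects_null_def
proof (intro allI conjI impI)
  fix x y assume y: "\<forall>\<zeta>. fip N \<zeta> y = 0"
  have "y s = 0" if "s < N" for s
  proof -
    have "(\<Sum>r<N. (cmod (y r))\<^sup>2) = 0" using y fin_sq[of N y] by (simp add: fin.sq_def)
    then show ?thesis using that by (simp add: sum_nonneg_eq_0_iff)
  qed
  then show "mform N M x y = 0" by (simp add: mform_def)
next
  fix x y assume x: "\<forall>\<zeta>. fip N x \<zeta> = 0"
  have "x s = 0" if "s < N" for s
  proof -
    have "(\<Sum>r<N. (cmod (x r))\<^sup>2) = 0" using x fin_sq[of N x] by (simp add: fin.sq_def)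
    then show ?thesis using that by (simp add: sum_nonneg_eq_0_iff)
  qed
  then show "mform N M x y = 0" by (simp add: mform_def)
qed

lemma euclidean_norm_eq:
  assumes "x \<in> carrier_vec n"
  shows "euclidean_norm x = sqrt (\<Sum>t<n. (cmod (x $ t))\<^sup>2)"
proof -
  have "x $ t * cnj (x $ t) = complex_of_real ((cmod (x $ t))\<^sup>2)" for t
    by (metis complex_norm_square)
  then have "x \<bullet>c x = complex_of_real (\<Sum>t<n. (cmod (x $ t))\<^sup>2)"
    using assms by (simp add: scalar_prod_def atLeast0LessThan)
  then show ?thesis by (simp add: euclidean_norm_def)
qed

lemma mult_mat_vec_index:
  assumes "M \<in> carrier_mat m n" "x \<in> carrier_vec n" "t < m"
  shows "(M *\<^sub>v x) $ t = (\<Sum>u<n. M $$ (t, u) * x $ u)"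
  using assms by (auto simp: scalar_prod_def atLeast0LessThan intro!: sum.cong)

text \<open>Reading scalars as operators on the one-dimensional Hilbert space makes all estimates for
  \<open>op_mnorm\<close> available for scalar matrices.\<close>

lemma mat_opnorm_eq:
  assumes M: "M \<in> carrier_mat d d"
  shows "mat_opnorm M = op_mnorm d (\<lambda>r s. op_scaleC (M $$ (r, s)) id_blinfun :: complex \<Rightarrow>\<^sub>L complex)"
proof -
  have *: "euclidean_norm (M *\<^sub>v x) = sqrt (\<Sum>r<d. (norm (\<Sum>s<d. M $$ (r, s) * x $ s))\<^sup>2)"
    if "x \<in> carrier_vec d" for x
    using M that by (subst euclidean_norm_eq[of _ d])
      (auto simp: mult_mat_vec_index[OF M that] simp del: index_mult_mat_vec)
  have "(\<lambda>x. euclidean_norm (M *\<^sub>v x)) ` {x \<in> carrier_vec d. euclidean_norm x \<le> 1} =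
      (\<lambda>\<xi>. sqrt (\<Sum>r<d. (norm (\<Sum>s<d. M $$ (r, s) * \<xi> s))\<^sup>2)) `
        {\<xi>. (\<Sum>j<d. (norm (\<xi> j))\<^sup>2) \<le> 1}" (is "?f ` ?A = ?g ` ?B")
  proof (intro equalityI subsetI)
    fix y assume "y \<in> ?f ` ?A"
    then obtain x where x: "x \<in> carrier_vec d" "euclidean_norm x \<le> 1" "y = ?f x" by blast
    have "(\<lambda>t. x $ t) \<in> ?B" using x(2) euclidean_norm_eq[OF x(1)] by simp
    moreover have "y = ?g (\<lambda>t. x $ t)" using x *[OF x(1)] by simp
    ultimately show "y \<in> ?g ` ?B" by blast
  next
    fix y assume "y \<in> ?g ` ?B"
    then obtain \<xi> where \<xi>: "\<xi> \<in> ?B" "y = ?g \<xi>" by blast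
    have "vec d \<xi> \<in> ?A" using \<xi>(1) euclidean_norm_eq[of "vec d \<xi>" d] by simp
    moreover have "y = ?f (vec d \<xi>)" using \<xi>(2) *[of "vec d \<xi>"] by simp
    ultimately show "y \<in> ?f ` ?A" by blast
  qed
  then show ?thesis
    using M unfolding mat_opnorm_def op_mnorm_def by (simp add: op_scaleC_apply scaleC_complex_def)
qed

lemma amplify_carrier [simp]: "amplify N k X \<in> carrier_mat (k * N) (k * N)"
  by (simp add: amplify_def)

lemma block_index_less:
  fixes p q k N :: nat
  assumes "p < k" "r < N"
  shows "p * N + r < k * N"
proof -
  have "p * N + r < Suc p * N" using assms by simp
  also have "\<dots> \<le> k * N" using assms by (intro mult_le_mono1) simp
  finally show ?thesis .
qed

lemma amplify_index:
  assumes "p < k" "q < k" "r < N" "s < N"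
  shows "amplify N k X $$ (p * N + r, q * N + s) = X p q $$ (r, s)"
  using assms by (simp add: amplify_def block_index_less)

text \<open>A flat index t = p N + r is split into the block p and the position r inside the
  block.\<close>

lemma amplify_form:
  "(\<Sum>t<k * N. \<Sum>u<k * N. cnj (\<xi> t) * (amplify N k X $$ (t, u) * \<eta> u)) =
   (\<Sum>p<k. \<Sum>q<k. mform N (X p q) (\<lambda>r. \<xi> (p * N + r)) (\<lambda>s. \<eta> (q * N + s)))"
  unfolding sum_div_mod mform_def
proof (rule sum.cong[OF refl])
  fix p assume p: "p \<in> {..<k}"
  have "(\<Sum>r<N. \<Sum>q<k. \<Sum>s<N. cnj (\<xi> (p * N + r)) * (amplify N k X $$ (p * N + r, q * N + s) * \<eta> (q * N + s))) =
      (\<Sum>r<N. \<Sum>q<k. \<Sum>s<N. cnj (\<xi> (p * N + r)) * (X p q $$ (r, s) * \<eta> (q * N + s)))"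
    using p by (intro sum.cong refl) (simp add: amplify_index)
  then show "(\<Sum>r<N. \<Sum>q<k. \<Sum>s<N. cnj (\<xi> (p * N + r)) * (amplify N k X $$ (p * N + r, q * N + s) * \<eta> (q * N +
      s))) =
      (\<Sum>q<k. \<Sum>r<N. \<Sum>s<N. cnj (\<xi> (p * N + r)) * (X p q $$ (r, s) * \<eta> (q * N + s)))"
    by (simp add: sum.swap[of _ "{..<k}" "{..<N}"])
qed

lemma mform_cong:
  "(\<And>r. r < N \<Longrightarrow> x r = x' r) \<Longrightarrow> (\<And>r. r < N \<Longrightarrow> y r = y' r) \<Longrightarrow> mform N M x y = mform N M x' y'"
  by (simp add: mform_def)

lemma amplify_form_flatten:
  fixes \<xi> \<eta> :: "nat \<Rightarrow> nat \<Rightarrow> complex"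
  shows "(\<Sum>t<k * N. \<Sum>u<k * N. cnj (\<xi> (t div N) (t mod N)) * (amplify N k X $$ (t, u) * \<eta> (u div N) (u mod N)))
      =
    (\<Sum>p<k. \<Sum>q<k. mform N (X p q) (\<xi> p) (\<eta> q))"
  unfolding amplify_form by (intro sum.cong refl mform_cong) simp_all

lemma cinner_scalar_op:
  "cinner (a :: complex) (blinfun_apply (op_scaleC c id_blinfun) b) = cnj a * (c * b)"
  by (simp add: op_scaleC_apply scaleC_complex_def cinner_complex_def)

lemma mat_mnorm_nonneg: "0 \<le> mat_opnorm (amplify N k X)"
  unfolding mat_opnorm_eq[OF amplify_carrier] by (rule op_mnorm_nonneg)

lemma mat_mnorm_weak_ge:
  fixes \<xi> \<eta> :: "nat \<Rightarrow> nat \<Rightarrow> complex"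
  assumes "mat_opnorm (amplify N k X) \<le> c"
  shows "(\<Sum>i<k. \<Sum>j<k. Re (mform N (X i j) (\<xi> i) (\<eta> j)))
    \<le> c / 2 * ((\<Sum>i<k. fin.sq N (\<xi> i)) + (\<Sum>j<k. fin.sq N (\<eta> j)))"
proof -
  have "(\<Sum>t<k * N. \<Sum>u<k * N. Re (cinner (\<xi> (t div N) (t mod N))
      (blinfun_apply (op_scaleC (amplify N k X $$ (t, u)) id_blinfun) (\<eta> (u div N) (u mod N)))))
    \<le> c / 2 * ((\<Sum>t<k * N. (norm (\<xi> (t div N) (t mod N)))\<^sup>2) + (\<Sum>u<k * N. (norm (\<eta> (u div N) (u mod N)))\<^sup>2))"
    using assms unfolding mat_opnorm_eq[OF amplify_carrier] by (rule op_mnorm_weak_ge)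
  moreover have "(\<Sum>t<k * N. \<Sum>u<k * N.
      Re (cnj (\<xi> (t div N) (t mod N)) * (amplify N k X $$ (t, u) * \<eta> (u div N) (u mod N)))) =
      (\<Sum>i<k. \<Sum>j<k. Re (mform N (X i j) (\<xi> i) (\<eta> j)))"
    using arg_cong[OF amplify_form_flatten[where k = k and N = N and \<xi> = \<xi> and X = X and \<eta> = \<eta>], of Re]
    by (simp only: Re_sum)
  moreover have "(\<Sum>t<k * N. (norm (\<zeta> (t div N) (t mod N)))\<^sup>2) = (\<Sum>i<k. fin.sq N (\<zeta> i))" for \<zeta>
    by (simp add: sum_div_mod fin_sq)
  ultimately show ?thesis unfolding cinner_scalar_op by simp
qed

lemma mat_mnorm_weak_le:
  assumes c: "c \<ge> 0"
    and weak: "\<And>\<xi> \<eta>. (\<Sum>i<k. \<Sum>j<k. Re (mform N (X i j) (\<xi> i) (\<eta> j)))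
      \<le> c / 2 * ((\<Sum>i<k. fin.sq N (\<xi> i)) + (\<Sum>j<k. fin.sq N (\<eta> j)))"
  shows "mat_opnorm (amplify N k X) \<le> c"
  unfolding mat_opnorm_eq[OF amplify_carrier]
proof (rule op_mnorm_weak_le[OF c])
  fix \<xi> \<eta> :: "nat \<Rightarrow> complex"
  show "(\<Sum>t<k * N. \<Sum>u<k * N. Re (cinner (\<xi> t) (blinfun_apply (op_scaleC (amplify N k X $$ (t, u)) id_blinfun)
      (\<eta> u))))
      \<le> c / 2 * ((\<Sum>t<k * N. (norm (\<xi> t))\<^sup>2) + (\<Sum>u<k * N. (norm (\<eta> u))\<^sup>2))"
    using weak[of "\<lambda>p r. \<xi> (p * N + r)" "\<lambda>q s. \<eta> (q * N + s)"]
      arg_cong[OF amplify_form[where k = k and N = N and \<xi> = \<xi> and X = X and \<eta> = \<eta>], of Re]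
    unfolding cinner_scalar_op fin_sq sum_div_mod[where f = "\<lambda>t. (norm (_ t))\<^sup>2"] by (simp only: Re_sum)
qed

lemma mat_positive_amplify_iff:
  "mat_positive (amplify N k X) \<longleftrightarrow> (\<forall>\<xi>. 0 \<le> (\<Sum>i<k. \<Sum>j<k. mform N (X i j) (\<xi> i) (\<xi> j)))"
proof -
  have form: "(amplify N k X *\<^sub>v x) \<bullet>c x =
      (\<Sum>i<k. \<Sum>j<k. mform N (X i j) (\<lambda>r. x $ (i * N + r)) (\<lambda>s. x $ (j * N + s)))"
    if x: "x \<in> carrier_vec (k * N)" for x
  proof -
    have "(amplify N k X *\<^sub>v x) \<bullet>c x = (\<Sum>t<k * N. (\<Sum>u<k * N. amplify N k X $$ (t, u) * x $ u) * cnj (x $ t))"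
      using x mult_mat_vec_index[OF amplify_carrier x]
      by (simp add: scalar_prod_def atLeast0LessThan del: index_mult_mat_vec)
    also have "\<dots> = (\<Sum>t<k * N. \<Sum>u<k * N. cnj (x $ t) * (amplify N k X $$ (t, u) * x $ u))"
      by (simp add: sum_distrib_left sum_distrib_right mult_ac)
    finally show ?thesis unfolding amplify_form .
  qed
  show ?thesis
  proof
    assume pos: "mat_positive (amplify N k X)"
    show "\<forall>\<xi>. 0 \<le> (\<Sum>i<k. \<Sum>j<k. mform N (X i j) (\<xi> i) (\<xi> j))"
    proof
      fix \<xi> :: "nat \<Rightarrow> nat \<Rightarrow> complex"
      define x where "x = vec (k * N) (\<lambda>t. \<xi> (t div N) (t mod N))"
      have x: "x \<in> carrier_vec (k * N)" unfolding x_def by simp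
      have "0 \<le> (amplify N k X *\<^sub>v x) \<bullet>c x"
        using pos x unfolding mat_positive_def by (simp add: amplify_def)
      also have "\<dots> = (\<Sum>i<k. \<Sum>j<k. mform N (X i j) (\<xi> i) (\<xi> j))"
        unfolding form[OF x] by (intro sum.cong refl mform_cong) (simp_all add: x_def block_index_less)
      finally show "0 \<le> (\<Sum>i<k. \<Sum>j<k. mform N (X i j) (\<xi> i) (\<xi> j))" .
    qed
  next
    assume pos: "\<forall>\<xi>. 0 \<le> (\<Sum>i<k. \<Sum>j<k. mform N (X i j) (\<xi> i) (\<xi> j))"
    show "mat_positive (amplify N k X)"
      unfolding mat_positive_def
    proof
      fix x :: "complex Matrix.vec" assume "x \<in> carrier_vec (dim_col (amplify N k X))"
      then have x: "x \<in> carrier_vec (k * N)" by (simp add: amplify_def)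
      show "0 \<le> (amplify N k X *\<^sub>v x) \<bullet>c x" unfolding form[OF x] using pos by simp
    qed
  qed
qed

section \<open>The spaces \<open>E\<^sub>n\<close>\<close>

text \<open>Coordinates on E_n; in particular \<open>emat n (kron i)\<close> is \<delta> i.\<close>

definition emat :: "nat \<Rightarrow> (nat \<Rightarrow> complex) \<Rightarrow> complex mat" where
  "emat n c = mat (2 * n) (2 * n) (\<lambda>rs. \<Sum>i<n. c i * delta n i $$ rs)"

definition kron :: "nat \<Rightarrow> nat \<Rightarrow> complex" where
  "kron i j = (if j = i then 1 else 0)"

lemma E_space_carrier: "carrier (E_space n) = range (emat n)"
  by (auto simp: E_space_def mat_space_def emat_def)

lemma E_space_simps [simp]:
  "osp_add (E_space n) = (+)" "osp_scale (E_space n) = (\<cdot>\<^sub>m)"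
  "mnorm (E_space n) k X = mat_opnorm (amplify (2 * n) k X)"
  by (simp_all add: E_space_def mat_space_def)

lemma op_space_simps [simp]:
  "carrier (op_space A) = A" "osp_add (op_space A) = (+)" "osp_scale (op_space A) = op_scaleC"
  "mnorm (op_space A) = op_mnorm" "mpos (op_space A) = op_mpos"
  by (simp_all add: op_space_def)

lemma delta_index:
  assumes "i < n" "r < 2 * n" "s < 2 * n"
  shows "delta n i $$ (r, s) = (if r = i \<and> s = 0 then 1 else 0) + (if r = n \<and> s = n + i then 1 else 0)"
  using assms by (auto simp: delta_def direct_sum_def matrix_unit_def)

text \<open>Every coordinate c i occurs twice: at (i, 0), in the column of the upper block, and at
  (n, n + i), in the row of the lower block.\<close>

lemma emat_index:
  assumes "r < 2 * n" "s < 2 * n"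
  shows "emat n c $$ (r, s) =
    (if r < n \<and> s = 0 then c r else 0) + (if r = n \<and> n \<le> s then c (s - n) else 0)"
proof -
  have "emat n c $$ (r, s) = (\<Sum>i<n. c i * delta n i $$ (r, s))"
    using assms by (simp add: emat_def)
  also have "\<dots> =
      (\<Sum>i<n. (if i = r then if s = 0 then c r else 0 else 0) +
        (if i = s - n then if r = n \<and> n \<le> s then c (s - n) else 0 else 0))"
    using assms by (intro sum.cong) (auto simp: delta_index)
  finally show ?thesis
    using assms by (auto simp: sum.distrib)
qed

lemma emat_dim [simp]: "dim_row (emat n c) = 2 * n" "dim_col (emat n c) = 2 * n"
  by (simp_all add: emat_def)

lemma emat_add: "emat n c + emat n d = emat n (\<lambda>i. c i + d i)"
  by (rule eq_matI) (simp_all add: emat_index)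

lemma emat_scale: "a \<cdot>\<^sub>m emat n c = emat n (\<lambda>i. a * c i)"
  by (rule eq_matI) (simp_all add: emat_index algebra_simps)

lemma emat_cong: "(\<And>i. i < n \<Longrightarrow> c i = d i) \<Longrightarrow> emat n c = emat n d"
  by (rule eq_matI) (auto simp: emat_index)

lemma sum_double: "(\<Sum>r<2 * n. f r) = (\<Sum>r<n. f r) + (\<Sum>r<n. f (n + r))" for n :: nat
  using sum_div_mod[of f 2 n] by (simp add: numeral_2_eq_2)

lemma mform_emat:
  assumes n: "n \<ge> 1"
  shows "mform (2 * n) (emat n c) x y =
    (\<Sum>i<n. c i * (cnj (x i) * y 0)) + (\<Sum>i<n. c i * (cnj (x n) * y (n + i)))"
proof -
  have row: "(\<Sum>s<2 * n. cnj (x r) * (emat n c $$ (r, s) * y s)) =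
      (if r < n then c r * (cnj (x r) * y 0) else 0) +
      (if r = n then \<Sum>i<n. c i * (cnj (x n) * y (n + i)) else 0)" if r: "r < 2 * n" for r
  proof -
    have "(\<Sum>s<2 * n. cnj (x r) * (emat n c $$ (r, s) * y s)) =
        (\<Sum>s<2 * n. (if s = 0 then if r < n then c r * (cnj (x r) * y 0) else 0 else 0) +
          (if r = n \<and> n \<le> s then c (s - n) * (cnj (x n) * y s) else 0))"
      using r by (intro sum.cong) (auto simp: emat_index algebra_simps)
    also have "\<dots> = (if r < n then c r * (cnj (x r) * y 0) else 0) +
        (\<Sum>s<2 * n. if r = n \<and> n \<le> s then c (s - n) * (cnj (x n) * y s) else 0)"
      using n by (simp add: sum.distrib)
    also have "(\<Sum>s<2 * n. if r = n \<and> n \<le> s then c (s - n) * (cnj (x n) * y s) else 0) =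
        (if r = n then \<Sum>i<n. c i * (cnj (x n) * y (n + i)) else 0)"
      by (simp add: sum_double)
    finally show ?thesis .
  qed
  have "mform (2 * n) (emat n c) x y = (\<Sum>r<2 * n. (if r < n then c r * (cnj (x r) * y 0) else 0) +
      (if r = n then \<Sum>i<n. c i * (cnj (x n) * y (n + i)) else 0))"
    unfolding mform_def by (intro sum.cong) (simp_all add: row)
  then show ?thesis
    using n by (simp add: sum.distrib sum_double)
qed

text \<open>The norm of \<Sum> x i \<otimes> \<delta> i is the maximum of a column norm and a row
  norm, because the two summands of \<delta> i lie in different blocks. In the form, the column part
  reads the coordinates i of \<xi> and 0 of \<eta>, the row part reads n of \<xi> and n + i of
  \<eta>; each part is estimated by \<open>weak\<close>.\<close>

lemma emat_unit_ball:
  fixes x :: "nat \<Rightarrow> nat \<Rightarrow> nat \<Rightarrow> complex"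
  assumes n: "n \<ge> 1"
    and col: "\<And>z. (\<Sum>i<n. \<Sum>p<k. (cmod (\<Sum>q<k. x i p q * z q))\<^sup>2) \<le> (\<Sum>q<k. (cmod (z q))\<^sup>2)"
    and row: "\<And>z. (\<Sum>i<n. \<Sum>q<k. (cmod (\<Sum>p<k. x i p q * z p))\<^sup>2) \<le> (\<Sum>p<k. (cmod (z p))\<^sup>2)"
  shows "mat_opnorm (amplify (2 * n) k (\<lambda>p q. emat n (\<lambda>i. x i p q))) \<le> 1"
proof (rule mat_mnorm_weak_le)
  fix \<xi> \<eta> :: "nat \<Rightarrow> nat \<Rightarrow> complex"
  have weak: "Re (cnj a * b) \<le> 1 / 2 * ((cmod a)\<^sup>2 + (cmod b)\<^sup>2)" for a b :: complex
    using Re_cinner_le[of a b] by (simp add: cinner_complex_def)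
  have "(\<Sum>p<k. \<Sum>q<k. Re (mform (2 * n) (emat n (\<lambda>i. x i p q)) (\<xi> p) (\<eta> q))) =
      (\<Sum>p<k. \<Sum>q<k. \<Sum>i<n. Re (x i p q * (cnj (\<xi> p i) * \<eta> q 0))) +
      (\<Sum>p<k. \<Sum>q<k. \<Sum>i<n. Re (x i p q * (cnj (\<xi> p n) * \<eta> q (n + i))))"
    by (simp only: mform_emat[OF n] plus_complex.sel Re_sum sum.distrib)
  also have "(\<Sum>p<k. \<Sum>q<k. \<Sum>i<n. Re (x i p q * (cnj (\<xi> p i) * \<eta> q 0))) =
      (\<Sum>i<n. \<Sum>p<k. Re (cnj (\<xi> p i) * (\<Sum>q<k. x i p q * \<eta> q 0)))"
  proof -
    have "(\<Sum>p<k. \<Sum>q<k. \<Sum>i<n. Re (x i p q * (cnj (\<xi> p i) * \<eta> q 0))) =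
        (\<Sum>p<k. \<Sum>i<n. \<Sum>q<k. Re (x i p q * (cnj (\<xi> p i) * \<eta> q 0)))"
      by (rule sum.cong[OF refl]) (rule sum.swap)
    also have "\<dots> = (\<Sum>i<n. \<Sum>p<k. \<Sum>q<k. Re (x i p q * (cnj (\<xi> p i) * \<eta> q 0)))"
      by (rule sum.swap)
    finally show ?thesis by (simp only: Re_sum sum_distrib_left mult.left_commute)
  qed
  also have "(\<Sum>p<k. \<Sum>q<k. \<Sum>i<n. Re (x i p q * (cnj (\<xi> p n) * \<eta> q (n + i)))) =
      (\<Sum>i<n. \<Sum>q<k. Re (cnj (cnj (\<eta> q (n + i))) * (\<Sum>p<k. x i p q * cnj (\<xi> p n))))"
  proof -
    have "(\<Sum>p<k. \<Sum>q<k. \<Sum>i<n. Re (x i p q * (cnj (\<xi> p n) * \<eta> q (n + i)))) =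
        (\<Sum>q<k. \<Sum>p<k. \<Sum>i<n. Re (x i p q * (cnj (\<xi> p n) * \<eta> q (n + i))))"
      by (rule sum.swap)
    also have "\<dots> = (\<Sum>q<k. \<Sum>i<n. \<Sum>p<k. Re (x i p q * (cnj (\<xi> p n) * \<eta> q (n + i))))"
      by (rule sum.cong[OF refl]) (rule sum.swap)
    also have "\<dots> = (\<Sum>i<n. \<Sum>q<k. \<Sum>p<k. Re (x i p q * (cnj (\<xi> p n) * \<eta> q (n + i))))"
      by (rule sum.swap)
    finally show ?thesis by (simp only: Re_sum sum_distrib_left complex_cnj_cnj mult_ac)
  qed
  also have "(\<Sum>i<n. \<Sum>p<k. Re (cnj (\<xi> p i) * (\<Sum>q<k. x i p q * \<eta> q 0))) \<le>
      (\<Sum>i<n. \<Sum>p<k. 1 / 2 * ((cmod (\<xi> p i))\<^sup>2 + (cmod (\<Sum>q<k. x i p q * \<eta> q 0))\<^sup>2))"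
    by (intro sum_mono weak)
  also have "\<dots> = 1 / 2 * (\<Sum>i<n. \<Sum>p<k. (cmod (\<xi> p i))\<^sup>2) +
      1 / 2 * (\<Sum>i<n. \<Sum>p<k. (cmod (\<Sum>q<k. x i p q * \<eta> q 0))\<^sup>2)"
    by (simp only: sum_distrib_left[symmetric] sum.distrib distrib_left)
  also have "\<dots> \<le> 1 / 2 * (\<Sum>i<n. \<Sum>p<k. (cmod (\<xi> p i))\<^sup>2) + 1 / 2 * (\<Sum>q<k. (cmod (\<eta> q 0))\<^sup>2)"
    using col[of "\<lambda>q. \<eta> q 0"] by simp
  also have "(\<Sum>i<n. \<Sum>q<k. Re (cnj (cnj (\<eta> q (n + i))) * (\<Sum>p<k. x i p q * cnj (\<xi> p n)))) \<le>
      (\<Sum>i<n. \<Sum>q<k. 1 / 2 * ((cmod (cnj (\<eta> q (n + i))))\<^sup>2 + (cmod (\<Sum>p<k. x i p q * cnj (\<xi> p n)))\<^sup>2))"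
    by (intro sum_mono weak)
  also have "\<dots> = 1 / 2 * (\<Sum>i<n. \<Sum>q<k. (cmod (\<eta> q (n + i)))\<^sup>2) +
      1 / 2 * (\<Sum>i<n. \<Sum>q<k. (cmod (\<Sum>p<k. x i p q * cnj (\<xi> p n)))\<^sup>2)"
    by (simp only: sum_distrib_left[symmetric] sum.distrib distrib_left complex_mod_cnj)
  also have "\<dots> \<le> 1 / 2 * (\<Sum>i<n. \<Sum>q<k. (cmod (\<eta> q (n + i)))\<^sup>2) + 1 / 2 * (\<Sum>p<k. (cmod (\<xi> p n))\<^sup>2)"
    using row[of "\<lambda>p. cnj (\<xi> p n)"] by simp
  finally have "(\<Sum>p<k. \<Sum>q<k. Re (mform (2 * n) (emat n (\<lambda>i. x i p q)) (\<xi> p) (\<eta> q))) \<le>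
      1 / 2 * ((\<Sum>p<k. (\<Sum>i<n. (cmod (\<xi> p i))\<^sup>2) + (cmod (\<xi> p n))\<^sup>2) +
        (\<Sum>q<k. (cmod (\<eta> q 0))\<^sup>2 + (\<Sum>i<n. (cmod (\<eta> q (n + i)))\<^sup>2)))"
    by (simp add: sum.distrib sum.swap[of _ "{..<k}" "{..<n}"])
  also have "\<dots> \<le> 1 / 2 * ((\<Sum>p<k. fin.sq (2 * n) (\<xi> p)) + (\<Sum>q<k. fin.sq (2 * n) (\<eta> q)))"
  proof -
    \<comment> \<open>For both vectors the coordinates read by the two parts lie in different
      halves, so that together they stay below the full norm.\<close>
    have "(cmod (z n))\<^sup>2 \<le> (\<Sum>i<n. (cmod (z (n + i)))\<^sup>2)" "(cmod (z 0))\<^sup>2 \<le> (\<Sum>i<n. (cmod (z i))\<^sup>2)" for z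
      using n member_le_sum[of 0 "{..<n}" "\<lambda>i. (cmod (z (n + i)))\<^sup>2"]
        member_le_sum[of 0 "{..<n}" "\<lambda>i. (cmod (z i))\<^sup>2"] by auto
    then show ?thesis
      unfolding fin_sq sum_double by (intro mult_left_mono add_mono sum_mono) auto
  qed
  finally show "(\<Sum>p<k. \<Sum>q<k. Re (mform (2 * n) (emat n (\<lambda>i. x i p q)) (\<xi> p) (\<eta> q))) \<le>
      1 / 2 * ((\<Sum>p<k. fin.sq (2 * n) (\<xi> p)) + (\<Sum>q<k. fin.sq (2 * n) (\<eta> q)))" .
qed simp

context semi_inner_space
begin

text \<open>The coordinates are switched on one at a time, so only the given addition and scaling
  rules are used.\<close>

lemma linear_on_emat:
  fixes F :: "complex mat \<Rightarrow> complex"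
  assumes add: "\<And>c d. F (emat n (\<lambda>i. c i + d i)) = F (emat n c) + F (emat n d)"
    and scale: "\<And>a c. F (emat n (\<lambda>i. a * c i)) = a * F (emat n c)"
  shows "F (emat n c) = (\<Sum>i<n. c i * F (emat n (kron i)))"
proof -
  have "F (emat n (\<lambda>i. if i < m then c i else 0)) = (\<Sum>i<m. c i * F (emat n (kron i)))" for m
  proof (induction m)
    case 0
    then show ?case using scale[of 0 "\<lambda>_. 0"] by simp
  next
    case (Suc m)
    have "(\<lambda>i. if i < Suc m then c i else 0) = (\<lambda>i. (if i < m then c i else 0) + c m * kron m i)"
      by (auto simp: kron_def fun_eq_iff less_Suc_eq)
    then show ?case using add scale Suc by simp
  qed
  moreover have "emat n (\<lambda>i. if i < n then c i else 0) = emat n c" by (rule emat_cong) simp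
  ultimately show ?thesis by metis
qed

lemma cb_bounded_of_map:
  fixes F :: "complex mat \<Rightarrow> 'g \<Rightarrow> 'g \<Rightarrow> complex"
  assumes n: "n \<ge> 1"
    and add: "\<And>c d \<xi> \<eta>. F (emat n (\<lambda>i. c i + d i)) \<xi> \<eta> = F (emat n c) \<xi> \<eta> + F (emat n d) \<xi> \<eta>"
    and scale: "\<And>a c \<xi> \<eta>. F (emat n (\<lambda>i. a * c i)) \<xi> \<eta> = a * F (emat n c) \<xi> \<eta>"
    and bound: "\<And>k X \<xi> \<eta>. (\<And>p q. X p q \<in> carrier (E_space n)) \<Longrightarrow>
      mat_opnorm (amplify (2 * n) k X) \<le> 1 \<Longrightarrow>
      (\<Sum>i<k. \<Sum>j<k. Re (F (X i j) (\<xi> i) (\<eta> j))) \<le> K / 2 * ((\<Sum>i<k. sq (\<xi> i)) + (\<Sum>j<k. sq (\<eta> j)))"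
  shows "cb_bounded n K (\<lambda>i. F (emat n (kron i)))"
  unfolding cb_bounded_def
proof (intro allI impI)
  fix I :: "(nat \<times> nat) set" and x :: "nat \<Rightarrow> nat \<times> nat \<Rightarrow> nat \<times> nat \<Rightarrow> complex" and \<alpha> \<beta> :: "nat \<times> nat \<Rightarrow> 'g"
  assume fin: "finite I"
    and col: "\<forall>z. (\<Sum>i<n. \<Sum>p\<in>I. (cmod (\<Sum>q\<in>I. x i p q * z q))\<^sup>2) \<le> (\<Sum>q\<in>I. (cmod (z q))\<^sup>2)"
    and row: "\<forall>z. (\<Sum>i<n. \<Sum>q\<in>I. (cmod (\<Sum>p\<in>I. x i p q * z p))\<^sup>2) \<le> (\<Sum>p\<in>I. (cmod (z p))\<^sup>2)"
  obtain h where h: "bij_betw h {..<card I} I"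
    using ex_bij_betw_nat_finite[OF fin] by (auto simp: atLeast0LessThan)
  define k where "k = card I"
  define g where "g = the_inv_into {..<k} h"
  have gh: "g (h a) = a" if "a < k" for a
    using h that unfolding g_def k_def bij_betw_def by (intro the_inv_into_f_f) auto
  have re: "(\<Sum>p\<in>I. f p) = (\<Sum>a<k. f (h a))" for f :: "nat \<times> nat \<Rightarrow> 'b::comm_monoid_add"
    using sum.reindex_bij_betw[OF h, of f] unfolding k_def by simp
  \<comment> \<open>The array is transposed, since \<open>cb_bounded\<close> pairs its first index
    with the second argument of the form. Column and row condition therefore change places.\<close>
  have "mat_opnorm (amplify (2 * n) k (\<lambda>b a. emat n (\<lambda>i. x i (h a) (h b)))) \<le> 1"
  proof (rule emat_unit_ball[OF n])
    fix z :: "nat \<Rightarrow> complex"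
    show "(\<Sum>i<n. \<Sum>p<k. (cmod (\<Sum>q<k. x i (h q) (h p) * z q))\<^sup>2) \<le> (\<Sum>q<k. (cmod (z q))\<^sup>2)"
      using row[rule_format, of "\<lambda>p. z (g p)"] unfolding re by (simp add: gh)
    show "(\<Sum>i<n. \<Sum>q<k. (cmod (\<Sum>p<k. x i (h q) (h p) * z p))\<^sup>2) \<le> (\<Sum>p<k. (cmod (z p))\<^sup>2)"
      using col[rule_format, of "\<lambda>p. z (g p)"] unfolding re by (simp add: gh)
  qed
  then have "(\<Sum>b<k. \<Sum>a<k. Re (F (emat n (\<lambda>i. x i (h a) (h b))) (\<beta> (h b)) (\<alpha> (h a))))
      \<le> K / 2 * ((\<Sum>b<k. sq (\<beta> (h b))) + (\<Sum>a<k. sq (\<alpha> (h a))))"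
    by (intro bound) (auto simp: E_space_carrier)
  also have "(\<Sum>b<k. \<Sum>a<k. Re (F (emat n (\<lambda>i. x i (h a) (h b))) (\<beta> (h b)) (\<alpha> (h a)))) =
      (\<Sum>b<k. \<Sum>a<k. \<Sum>i<n. Re (x i (h a) (h b) * F (emat n (kron i)) (\<beta> (h b)) (\<alpha> (h a))))"
  proof (intro sum.cong refl)
    fix a b
    show "Re (F (emat n (\<lambda>i. x i (h a) (h b))) (\<beta> (h b)) (\<alpha> (h a))) =
        (\<Sum>i<n. Re (x i (h a) (h b) * F (emat n (kron i)) (\<beta> (h b)) (\<alpha> (h a))))"
      using linear_on_emat[of "\<lambda>M. F M (\<beta> (h b)) (\<alpha> (h a))" n "\<lambda>i. x i (h a) (h b)", OF add scale]
      by (simp only: Re_sum)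
  qed
  also have "\<dots> = (\<Sum>q\<in>I. \<Sum>p\<in>I. \<Sum>i<n. Re (x i p q * F (emat n (kron i)) (\<beta> q) (\<alpha> p)))"
    unfolding re ..
  also have "\<dots> = (\<Sum>p\<in>I. \<Sum>i<n. \<Sum>q\<in>I. Re (x i p q * F (emat n (kron i)) (\<beta> q) (\<alpha> p)))"
    by (subst sum.swap, rule sum.cong[OF refl], rule sum.swap)
  also have "\<dots> = (\<Sum>i<n. \<Sum>p\<in>I. \<Sum>q\<in>I. Re (x i p q * F (emat n (kron i)) (\<beta> q) (\<alpha> p)))"
    by (rule sum.swap)
  also have "(\<Sum>b<k. sq (\<beta> (h b))) + (\<Sum>a<k. sq (\<alpha> (h a))) = (\<Sum>p\<in>I. sq (\<alpha> p) + sq (\<beta> p))"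
    unfolding re by (simp add: sum.distrib)
  finally show "(\<Sum>i<n. \<Sum>p\<in>I. \<Sum>q\<in>I. Re (x i p q * F (emat n (kron i)) (\<beta> q) (\<alpha> p)))
      \<le> K / 2 * (\<Sum>p\<in>I. sq (\<alpha> p) + sq (\<beta> p))" .
qed

end

section \<open>Bounds for maps into E_n\<close>

lemma linear_mapD:
  assumes "linear_map V W u"
  shows "x \<in> carrier V \<Longrightarrow> u x \<in> carrier W"
    and "x \<in> carrier V \<Longrightarrow> y \<in> carrier V \<Longrightarrow> u (osp_add V x y) = osp_add W (u x) (u y)"
    and "x \<in> carrier V \<Longrightarrow> u (osp_scale V c x) = osp_scale W c (u x)"
  using assms unfolding linear_map_def by blast+

lemma mform_scale:
  assumes "M \<in> carrier_mat N N"
  shows "mform N (a \<cdot>\<^sub>m M) x y = a * mform N M x y"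
  using assms by (simp add: mform_def sum_distrib_left mult_ac)

lemma mform_add:
  assumes "M \<in> carrier_mat N N" "M' \<in> carrier_mat N N"
  shows "mform N (M + M') x y = mform N M x y + mform N M' x y"
  using assms by (simp add: mform_def sum.distrib algebra_simps)

lemma mform_kron:
  assumes "i < N" "j < N"
  shows "mform N M (fscale a (kron i)) (fscale b (kron j)) = cnj a * b * M $$ (i, j)"
proof -
  have "mform N M (kron i) (kron j) = (\<Sum>r<N. \<Sum>s<N. if s = j then if r = i then M $$ (i, j) else 0 else 0)"
    unfolding mform_def by (intro sum.cong refl) (auto simp: kron_def)
  also have "\<dots> = M $$ (i, j)"
    using assms by simp
  finally have "mform N M (kron i) (kron j) = M $$ (i, j)" .
  then show ?thesis by (simp add: sesquilinearD[OF mform_sesquilinear])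
qed

lemma fin_sq_kron:
  assumes "i < N"
  shows "fin.sq N (fscale a (kron i)) = (cmod a)\<^sup>2"
proof -
  have "(\<Sum>r<N. (cmod (fscale a (kron i) r))\<^sup>2) = (\<Sum>r<N. if r = i then (cmod a)\<^sup>2 else 0)"
    by (intro sum.cong) (auto simp: fscale_def kron_def)
  then show ?thesis using assms by (simp add: fin_sq)
qed

lemma E_space_carrier_mat: "M \<in> carrier (E_space n) \<Longrightarrow> M \<in> carrier_mat (2 * n) (2 * n)"
  by (auto simp: E_space_carrier)

text \<open>Norms are defined for square k x k arrays; a column of length n is therefore padded with
  zeros, and so is a row.\<close>

definition column :: "(nat \<Rightarrow> 'h::complex_hilbert_space \<Rightarrow>\<^sub>L 'h) \<Rightarrow> nat \<Rightarrow> nat \<Rightarrow> 'h \<Rightarrow>\<^sub>L 'h" where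
  "column c i j = (if j = 0 then c i else 0)"

definition row :: "(nat \<Rightarrow> 'h::complex_hilbert_space \<Rightarrow>\<^sub>L 'h) \<Rightarrow> nat \<Rightarrow> nat \<Rightarrow> 'h \<Rightarrow>\<^sub>L 'h" where
  "row d i j = (if i = 0 then d j else 0)"

lemma op_mnorm_normalize:
  fixes X :: "nat \<Rightarrow> nat \<Rightarrow> 'h::complex_hilbert_space \<Rightarrow>\<^sub>L 'h"
  assumes K: "op_mnorm k X \<le> K" "K > 0"
  shows "op_mnorm k (\<lambda>i j. op_scaleC (complex_of_real (1 / K)) (X i j)) \<le> 1"
proof (rule op_mnorm_weak_le)
  fix \<xi> \<eta> :: "nat \<Rightarrow> 'h"
  have "(\<Sum>i<k. \<Sum>j<k. Re (cinner (\<xi> i) (blinfun_apply (op_scaleC (complex_of_real (1 / K)) (X i j)) (\<eta> j)))) =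
      1 / K * (\<Sum>i<k. \<Sum>j<k. Re (cinner (\<xi> i) (blinfun_apply (X i j) (\<eta> j))))"
    by (simp add: op_scaleC_apply cinner_simps sum_divide_distrib)
  also have "\<dots> \<le> 1 / K * (K / 2 * ((\<Sum>i<k. (norm (\<xi> i))\<^sup>2) + (\<Sum>j<k. (norm (\<eta> j))\<^sup>2)))"
    using K by (intro mult_left_mono op_mnorm_weak_ge) auto
  finally show "(\<Sum>i<k. \<Sum>j<k. Re (cinner (\<xi> i) (blinfun_apply (op_scaleC (complex_of_real (1
      / K)) (X i j)) (\<eta> j)))) \<le>
      1 / 2 * ((\<Sum>i<k. (norm (\<xi> i))\<^sup>2) + (\<Sum>j<k. (norm (\<eta> j))\<^sup>2))"
    using K by simp
qed simp

lemma mnorm_bound_scaled: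
  fixes A :: "('h::complex_hilbert_space \<Rightarrow>\<^sub>L 'h) set"
  assumes lin: "linear_map (op_space A) (E_space n) v"
    and A_scale: "\<And>c T. T \<in> A \<Longrightarrow> op_scaleC c T \<in> A"
    and bound: "\<And>k X. X \<in> matrices_over k (op_space A) \<Longrightarrow> op_mnorm k X \<le> 1 \<Longrightarrow>
      mat_opnorm (amplify (2 * n) k (\<lambda>i j. v (X i j))) \<le> V"
    and X: "\<And>i j. X i j \<in> A" and K: "op_mnorm k X \<le> K" "K > 0"
  shows "mat_opnorm (amplify (2 * n) k (\<lambda>i j. v (X i j))) \<le> V * K"
proof -
  define a where "a = complex_of_real (1 / K)"
  define Y where "Y i j = op_scaleC a (X i j)" for i j
  have "op_mnorm k Y \<le> 1"
    unfolding Y_def a_def by (rule op_mnorm_normalize[OF K])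
  moreover have "Y \<in> matrices_over k (op_space A)"
    using X A_scale by (simp add: matrices_over_def Y_def)
  ultimately have le: "mat_opnorm (amplify (2 * n) k (\<lambda>i j. v (Y i j))) \<le> V"
    using bound by blast
  have V: "V \<ge> 0" using le mat_mnorm_nonneg order_trans by blast
  show ?thesis
  proof (rule mat_mnorm_weak_le)
    fix \<xi> \<eta> :: "nat \<Rightarrow> nat \<Rightarrow> complex"
    have "v (Y i j) = a \<cdot>\<^sub>m v (X i j)" for i j
      using linear_mapD(3)[OF lin, of "X i j" a] X by (simp add: Y_def)
    moreover have "v (X i j) \<in> carrier_mat (2 * n) (2 * n)" for i j
      using linear_mapD(1)[OF lin, of "X i j"] X by (auto intro: E_space_carrier_mat)
    ultimately have "(\<Sum>i<k. \<Sum>j<k. Re (mform (2 * n) (v (X i j)) (\<xi> i) (\<eta> j))) =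
        K * (\<Sum>i<k. \<Sum>j<k. Re (mform (2 * n) (v (Y i j)) (\<xi> i) (\<eta> j)))"
      using K by (simp add: mform_scale a_def flip: sum_divide_distrib)
    then show "(\<Sum>i<k. \<Sum>j<k. Re (mform (2 * n) (v (X i j)) (\<xi> i) (\<eta> j))) \<le>
        V * K / 2 * ((\<Sum>i<k. fin.sq (2 * n) (\<xi> i)) + (\<Sum>j<k. fin.sq (2 * n) (\<eta> j)))"
      using mult_left_mono[OF mat_mnorm_weak_ge[OF le, of \<xi> \<eta>], of K] K by (simp add: mult_ac)
  qed (use V K in simp)
qed

text \<open>The column is tested between the unit vector with components e(i) / sqrt n and the
  vector e(0) in the first copy, which yields the sum of the coordinates divided by sqrt n. For the
  row, the second occurrence (n, n + i) of the coordinate is used, and the two test vectors exchange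
  their roles.\<close>

lemma E_space_trace_bound:
  fixes A :: "('h::complex_hilbert_space \<Rightarrow>\<^sub>L 'h) set"
  assumes n: "n \<ge> 1"
    and lin: "linear_map (op_space A) (E_space n) v"
    and A_zero: "0 \<in> A" and A_scale: "\<And>c T. T \<in> A \<Longrightarrow> op_scaleC c T \<in> A"
    and bound: "\<And>k X. X \<in> matrices_over k (op_space A) \<Longrightarrow> op_mnorm k X \<le> 1 \<Longrightarrow>
      mat_opnorm (amplify (2 * n) k (\<lambda>i j. v (X i j))) \<le> V"
    and c: "\<And>i. c i \<in> A" and d: "\<And>i. d i \<in> A" and K: "K > 0"
    and col: "op_mnorm n (column c) \<le> K" and row: "op_mnorm n (row d) \<le> K"
  shows "(\<Sum>i<n. Re (v (c i) $$ (i, 0))) \<le> sqrt (real n) * (V * K)"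
    and "(\<Sum>i<n. Re (v (d i) $$ (n, n + i))) \<le> sqrt (real n) * (V * K)"
proof -
  define r where "r = 1 / sqrt (real n)"
  have r: "r > 0" "real n * r\<^sup>2 = 1" "(\<Sum>i<n. r * f i) \<le> V * K \<Longrightarrow> (\<Sum>i<n. f i) \<le> sqrt (real n) * (V * K)" for f
    using n by (auto simp: r_def power_divide field_simps simp flip: sum_divide_distrib)
  have v_zero: "v 0 = 0\<^sub>m (2 * n) (2 * n)"
  proof -
    have "op_scaleC 0 (0 :: 'h \<Rightarrow>\<^sub>L 'h) = 0"
      by (rule blinfun_eqI) (simp add: op_scaleC_apply scaleC_of_real[of 0, simplified])
    then have eq: "v 0 = 0 \<cdot>\<^sub>m v 0" using linear_mapD(3)[OF lin, of 0 0] A_zero by simp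
    have v0: "v 0 \<in> carrier_mat (2 * n) (2 * n)"
      using linear_mapD(1)[OF lin, of 0] A_zero by (auto intro: E_space_carrier_mat)
    show ?thesis
    proof (rule eq_matI)
      fix i j assume "i < dim_row (0\<^sub>m (2 * n) (2 * n) :: complex mat)" "j < dim_col (0\<^sub>m (2 * n) (2
          * n) :: complex mat)"
      then have ij: "i < 2 * n" "j < 2 * n" by simp_all
      have "v 0 $$ (i, j) = (0 \<cdot>\<^sub>m v 0) $$ (i, j)" by (rule arg_cong[OF eq])
      then show "v 0 $$ (i, j) = 0\<^sub>m (2 * n) (2 * n) $$ (i, j)" using v0 ij by simp
    qed (use v0 in auto)
  qed
  have v_zero_form: "mform (2 * n) (v 0) x y = 0" for x y
    by (simp add: v_zero mform_def)
  have le: "mat_opnorm (amplify (2 * n) n (\<lambda>i j. v (column c i j))) \<le> V * K"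
    by (rule mnorm_bound_scaled[OF lin A_scale bound _ col K]) (auto simp: column_def c A_zero)
  have sq_if: "(\<Sum>j<n. fin.sq (2 * n) (fscale (if j = 0 then 1 else 0) (kron i))) = 1" if "i < 2 * n" for i
  proof -
    have "(\<Sum>j<n. fin.sq (2 * n) (fscale (if j = 0 then 1 else 0) (kron i))) = (\<Sum>j<n. if j = 0 then 1 else 0)"
      using that by (intro sum.cong refl) (simp add: fin_sq_kron)
    then show ?thesis using n by simp
  qed
  have sum0: "(\<Sum>j<n. if j = 0 then f else 0) = (f :: real)" for f
    using n by simp
  have "(\<Sum>i<n. r * Re (v (c i) $$ (i, 0))) =
      (\<Sum>i<n. \<Sum>j<n. Re (mform (2 * n) (v (column c i j)) (fscale (of_real r) (kron i)) (fscale (if j =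
          0 then 1 else 0) (kron 0))))"
  proof (intro sum.cong refl)
    fix i assume "i \<in> {..<n}"
    then have "(\<Sum>j<n. Re (mform (2 * n) (v (column c i j)) (fscale (of_real r) (kron i)) (fscale (if j =
        0 then 1 else 0) (kron 0)))) =
        (\<Sum>j<n. if j = 0 then r * Re (v (c i) $$ (i, 0)) else 0)"
      using n by (intro sum.cong refl) (auto simp: column_def mform_kron v_zero_form)
    then show "r * Re (v (c i) $$ (i, 0)) = (\<Sum>j<n. Re (mform (2
        * n) (v (column c i j)) (fscale (of_real r) (kron i)) (fscale (if j = 0 then 1 else 0) (kron 0))))"
      by (simp only: sum0)
  qed
  also have "\<dots> \<le> V * K / 2 * ((\<Sum>i<n. fin.sq (2 * n) (fscale (of_real r) (kron i))) +
      (\<Sum>j<n. fin.sq (2 * n) (fscale (if j = 0 then 1 else 0) (kron 0))))"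
    by (rule mat_mnorm_weak_ge[OF le])
  also have "\<dots> = V * K / 2 * (real n * r\<^sup>2 + 1)"
    using n by (simp add: sq_if fin_sq_kron[where a = "of_real r"])
  finally show "(\<Sum>i<n. Re (v (c i) $$ (i, 0))) \<le> sqrt (real n) * (V * K)"
    using r by simp
  have le: "mat_opnorm (amplify (2 * n) n (\<lambda>i j. v (row d i j))) \<le> V * K"
    by (rule mnorm_bound_scaled[OF lin A_scale bound _ row K]) (auto simp: row_def d A_zero)
  have "(\<Sum>j<n. r * Re (v (d j) $$ (n, n + j))) =
      (\<Sum>j<n. \<Sum>i<n. Re (mform (2 * n) (v (row d i j)) (fscale (if i =
          0 then 1 else 0) (kron n)) (fscale (of_real r) (kron (n + j)))))"
  proof (intro sum.cong refl)
    fix j assume "j \<in> {..<n}"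
    then have "(\<Sum>i<n. Re (mform (2 * n) (v (row d i j)) (fscale (if i =
        0 then 1 else 0) (kron n)) (fscale (of_real r) (kron (n + j))))) =
        (\<Sum>i<n. if i = 0 then r * Re (v (d j) $$ (n, n + j)) else 0)"
      using n by (intro sum.cong refl) (auto simp: row_def mform_kron v_zero_form)
    then show "r * Re (v (d j) $$ (n, n + j)) = (\<Sum>i<n. Re (mform (2 * n) (v (row d i j)) (fscale (if i =
        0 then 1 else 0) (kron n)) (fscale (of_real r) (kron (n + j)))))"
      by (simp only: sum0)
  qed
  also have "\<dots> = (\<Sum>i<n. \<Sum>j<n. Re (mform (2 * n) (v (row d i j)) (fscale (if i =
      0 then 1 else 0) (kron n)) (fscale (of_real r) (kron (n + j)))))"
    by (rule sum.swap)
  also have "\<dots> \<le> V * K / 2 * ((\<Sum>i<n. fin.sq (2 * n) (fscale (if i = 0 then 1 else 0) (kron n))) +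
      (\<Sum>j<n. fin.sq (2 * n) (fscale (of_real r) (kron (n + j)))))"
    by (rule mat_mnorm_weak_ge[OF le])
  also have "\<dots> = V * K / 2 * (1 + real n * r\<^sup>2)"
    using n by (simp add: sq_if fin_sq_kron[where a = "of_real r"])
  finally show "(\<Sum>i<n. Re (v (d i) $$ (n, n + i))) \<le> sqrt (real n) * (V * K)"
    using r by simp
qed

section \<open>Approximate units\<close>

lemma is_adjointD: "is_adjoint S T \<Longrightarrow> cinner (blinfun_apply S x) y = cinner x (blinfun_apply T y)"
  unfolding is_adjoint_def by blast

lemma is_adjoint_sym:
  assumes "is_adjoint S T"
  shows "is_adjoint T S"
  unfolding is_adjoint_def
  by (metis assms cinner_commute is_adjoint_def)

lemma cinner_adjoint:
  "is_adjoint S T \<Longrightarrow> cinner x (blinfun_apply S y) = cinner (blinfun_apply T x) y"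
  using is_adjointD[OF is_adjoint_sym] by metis

lemma norm_adjoint_le:
  assumes "is_adjoint S T"
  shows "norm S \<le> norm T"
proof (rule norm_blinfun_bound)
  fix x
  have "norm (S x) * norm (S x) = Re (cinner (S x) (S x))"
    by (simp add: Re_cinner_self power2_eq_square)
  also have "\<dots> = Re (cinner x (T (S x)))" by (simp add: is_adjointD[OF assms])
  also have "\<dots> \<le> norm x * norm (T (S x))" by (rule Re_cinner_le_norm)
  also have "\<dots> \<le> norm x * (norm T * norm (S x))" by (intro mult_left_mono norm_blinfun) auto
  finally have "norm (S x) * norm (S x) \<le> (norm T * norm x) * norm (S x)" by (simp add: mult_ac)
  then show "norm (S x) \<le> norm T * norm x"
    using mult_right_le_imp_le[of "norm (S x)" "norm (S x)" "norm T * norm x"]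
    by (cases "norm (S x) = 0") auto
qed simp

lemma cstar_algebraD:
  assumes "cstar_algebra A"
  shows "A \<subseteq> bounded_ops" "0 \<in> A" "S \<in> A \<Longrightarrow> T \<in> A \<Longrightarrow> S + T \<in> A"
    "T \<in> A \<Longrightarrow> op_scaleC c T \<in> A" "S \<in> A \<Longrightarrow> T \<in> A \<Longrightarrow> S o\<^sub>L T \<in> A"
    "T \<in> A \<Longrightarrow> \<exists>S\<in>A. is_adjoint S T"
  using assms unfolding cstar_algebra_def by blast+

lemma op_scaleC_of_real: "op_scaleC (of_real r) T = r *\<^sub>R (T :: 'h::complex_hilbert_space \<Rightarrow>\<^sub>L 'h)"
  by (rule blinfun_eqI) (simp add: op_scaleC_apply scaleC_of_real scaleR_blinfun.rep_eq)

lemma cstar_algebra_scaleR: "cstar_algebra A \<Longrightarrow> T \<in> A \<Longrightarrow> r *\<^sub>R T \<in> A"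
  using cstar_algebraD(4)[of A T "of_real r"] by (simp add: op_scaleC_of_real)

lemma cstar_algebra_diff:
  assumes "cstar_algebra A" "S \<in> A" "T \<in> A"
  shows "S - T \<in> A"
  using cstar_algebraD(3)[OF assms(1,2) cstar_algebra_scaleR[OF assms(1,3), of "- 1"]] by simp

lemma cstar_algebra_sum:
  assumes "cstar_algebra A" "\<And>i. i \<in> I \<Longrightarrow> f i \<in> A"
  shows "(\<Sum>i\<in>I. f i) \<in> A"
  using assms(2) by (induction I rule: infinite_finite_induct)
    (auto intro: cstar_algebraD[OF assms(1)])

text \<open>The condition 0 \<le> h \<le> 1 in terms of forms. Powers of 1 - h take the place of
  functional calculus; \<open>residual j\<close> is (1 - h)^j, as a map on the Hilbert
  space.\<close>

locale positive_contraction =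
  fixes h :: "'h::complex_hilbert_space \<Rightarrow>\<^sub>L 'h"
  assumes self_adjoint: "is_adjoint h h"
    and nonneg: "0 \<le> Re (cinner x (h x))"
    and le_one: "Re (cinner x (h x)) \<le> (norm x)\<^sup>2"
begin

definition residual :: "nat \<Rightarrow> 'h \<Rightarrow> 'h" where
  "residual j = ((\<lambda>x. x - h x) ^^ j)"

lemma residual_simps: "residual 0 x = x" "residual (Suc j) x = residual j x - h (residual j x)"
  by (simp_all add: residual_def)

lemma residual_add: "residual (j + l) x = residual j (residual l x)"
  by (simp add: residual_def funpow_add)

lemma residual_diff: "residual j (x - y) = residual j x - residual j y"
  by (induction j) (simp_all add: residual_simps blinfun.diff_right)

lemma residual_commute: "residual j (h x) = h (residual j x)"
  by (induction j) (simp_all add: residual_simps blinfun.diff_right)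

lemma residual_adjoint: "cinner (residual j x) y = cinner x (residual j y)"
proof (induction j arbitrary: x y)
  case (Suc j)
  have "cinner (residual (Suc j) x) y = cinner (residual j x) (y - h y)"
    by (simp add: residual_simps cinner_diff is_adjointD[OF self_adjoint])
  also have "\<dots> = cinner x (residual (Suc j) y)"
    by (simp add: Suc residual_diff residual_commute residual_simps)
  finally show ?case .
qed (simp add: residual_simps)

lemma residual_even: "Re (cinner x (residual (j + j) x)) = (norm (residual j x))\<^sup>2"
proof -
  have "cinner x (residual (j + j) x) = cinner (residual j x) (residual j x)"
    by (simp only: residual_add residual_adjoint)
  then show ?thesis by (simp only: Re_cinner_self)
qed

lemma h_residual_even: "Re (cinner x (h (residual (j + j) x))) =
    Re (cinner (residual j x) (h (residual j x)))"
  by (simp add: residual_add residual_adjoint residual_commute)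

lemma residual_one_nonneg: "0 \<le> Re (cinner x (residual 1 x))"
  using le_one[of x] by (simp add: residual_simps cinner_diff Re_cinner_self)

text \<open>Even powers of 1 - h are squares, and odd powers are (1 - h)^l (1 - h) (1 - h)^l with 1
  - h \<ge> 0.\<close>

lemma residual_nonneg: "0 \<le> Re (cinner x (residual j x))"
proof (cases "even j")
  case True
  then obtain l where "j = l + l" by (metis evenE mult_2)
  then show ?thesis by (simp add: residual_even)
next
  case False
  then obtain l where j: "j = l + (1 + l)" by (metis oddE add.assoc add.commute mult_2)
  have "cinner x (residual j x) = cinner (residual l x) (residual 1 (residual l x))"
    unfolding j residual_add residual_adjoint[symmetric] ..
  then show ?thesis by (simp only: residual_one_nonneg)
qed

lemma residual_norm_le: "norm (residual j x) \<le> norm x"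
proof (induction j)
  case (Suc j)
  have "(norm (residual 1 y))\<^sup>2 \<le> (norm y)\<^sup>2" for y
  proof -
    \<comment> \<open>The identity h (1 - h) = h (1 - h) h + (1 - h) h (1 - h) shows that h (1 - h)
      is positive.\<close>
    have "Re (cinner y (h (residual 1 y))) =
        Re (cinner (h y) (residual 1 (h y))) + Re (cinner (residual 1 y) (h (residual 1 y)))"
      by (simp add: residual_simps cinner_diff blinfun.diff_right is_adjointD[OF self_adjoint])
    then have "0 \<le> Re (cinner y (h (residual 1 y)))"
      using residual_one_nonneg[of "h y"] nonneg[of "residual 1 y"] by linarith
    moreover have "(norm (residual 1 y))\<^sup>2 = Re (cinner y (residual 1 y)) - Re (cinner y (h (residual 1 y)))"
    proof -
      have "(norm (residual 1 y))\<^sup>2 = Re (cinner y (residual 1 (residual 1 y)))"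
        by (simp only: residual_adjoint flip: Re_cinner_self)
      then show ?thesis by (simp add: residual_simps cinner_diff)
    qed
    moreover have "Re (cinner y (residual 1 y)) \<le> (norm y)\<^sup>2"
      using nonneg[of y] by (simp add: residual_simps cinner_diff Re_cinner_self)
    ultimately show ?thesis by simp
  qed
  then have "norm (residual 1 y) \<le> norm y" for y by (meson norm_ge_zero power2_le_imp_le)
  then show ?case using Suc residual_add[of 1 j x] by
      (metis One_nat_def add.commute order.trans plus_1_eq_Suc)
qed (simp add: residual_simps)

text \<open>The terms of the telescoping sum \<open>(\<Sum>j<m. h (1 - h)\<^sup>j) = 1 - (1 - h)\<^sup>m\<close> decrease.\<close>

lemma h_residual_small: "real m * Re (cinner x (h (residual m x))) \<le> (norm x)\<^sup>2"
proof -
  define a where "a j = Re (cinner x (h (residual j x)))" for j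
  have dec: "a (Suc j) \<le> a j" for j
  proof -
    have "a j - a (Suc j) = Re (cinner (h x) (residual j (h x)))"
      by (simp add: a_def residual_simps blinfun.diff_right cinner_diff residual_commute
          is_adjointD[OF self_adjoint])
    then show ?thesis using residual_nonneg[of "h x" j] by simp
  qed
  have "(\<Sum>j<m. a m) \<le> (\<Sum>j<m. a j)"
    using lift_Suc_antimono_le[of a, OF dec] by (intro sum_mono) simp
  moreover have "(\<Sum>j<m. a j) = Re (cinner x x) - Re (cinner x (residual m x))"
  proof (induction m)
    case (Suc m)
    then show ?case by (simp add: a_def residual_simps cinner_diff)
  qed (simp add: residual_simps)
  ultimately show ?thesis
    using residual_nonneg[of x m] by (simp add: a_def Re_cinner_self)
qed

text \<open>This is 1 - (1 - h)^j, a polynomial in h without constant term; the recursion avoids the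
  identity operator, so the values stay in an algebra that contains h.\<close>

fun unit_approx :: "nat \<Rightarrow> 'h \<Rightarrow>\<^sub>L 'h" where
  "unit_approx 0 = 0"
| "unit_approx (Suc j) = unit_approx j + h - (unit_approx j o\<^sub>L h)"

lemma unit_approx_apply: "unit_approx j x = x - residual j x"
proof (induction j arbitrary: x)
  case (Suc j)
  then show ?case
    by (simp add: blinfun.add_left blinfun.diff_left residual_simps residual_commute)
qed (simp add: residual_simps)

lemma unit_approx_mem:
  assumes "cstar_algebra A" "h \<in> A"
  shows "unit_approx j \<in> A"
  by (induction j) (auto intro: assms cstar_algebraD[OF assms(1)] cstar_algebra_diff[OF assms(1)])

lemma unit_approx_self_adjoint: "is_adjoint (unit_approx j) (unit_approx j)"
  unfolding is_adjoint_def by (simp add: unit_approx_apply cinner_diff residual_adjoint)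

text \<open>For the exponent 2l the cross term in |x - (1 - h)^(2l) x|^2 is -2 |(1 - h)^l x|^2,
  which outweighs the square of the residual.\<close>

lemma unit_approx_norm: "norm (unit_approx (l + l)) \<le> 1"
proof (rule norm_blinfun_bound)
  fix x
  have le: "(norm (residual (l + l) x))\<^sup>2 \<le> (norm (residual l x))\<^sup>2"
    unfolding residual_add by (intro power_mono residual_norm_le) auto
  then have "(norm (unit_approx (l + l) x))\<^sup>2 \<le> (norm x)\<^sup>2"
    unfolding unit_approx_apply norm_diff_sq residual_even
    using le zero_le_power2[of "norm (residual l x)"] by linarith
  then have "norm (unit_approx (l + l) x) \<le> norm x" by (rule power2_le_imp_le) simp
  then show "norm (unit_approx (l + l) x) \<le> 1 * norm x" by simp
qed simp

text \<open>Since y is dominated by h, the square of y (1 - h)^j is dominated by M h (1 - h)^(2j),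
  which is at most M / (2j) by \<open>h_residual_small\<close>.\<close>

lemma unit_approx_absorbs:
  assumes y: "\<And>x. (norm (blinfun_apply y x))\<^sup>2 \<le> M * Re (cinner x (h x))" and M: "M \<ge> 0" and j: "j > 0"
  shows "norm (y - (y o\<^sub>L unit_approx j)) \<le> sqrt (M / real (j + j))"
proof (rule norm_blinfun_bound)
  fix x
  have "(norm ((y - (y o\<^sub>L unit_approx j)) x))\<^sup>2 = (norm (y (residual j x)))\<^sup>2"
    by (simp add: blinfun.diff_left unit_approx_apply blinfun.diff_right)
  also have "\<dots> \<le> M * Re (cinner x (h (residual (j + j) x)))"
    unfolding h_residual_even by (rule y)
  also have "\<dots> \<le> M * ((norm x)\<^sup>2 / real (j + j))"
    using h_residual_small[of "j + j" x] M j by (intro mult_left_mono) (auto simp: field_simps)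
  also have "\<dots> = (sqrt (M / real (j + j)) * norm x)\<^sup>2"
    using M by (simp add: power_mult_distrib)
  finally show "norm ((y - (y o\<^sub>L unit_approx j)) x) \<le> sqrt (M / real (j + j)) * norm x"
    using M by (auto intro: power2_le_imp_le)
qed (use M in simp)

end

lemma cstar_approximate_unit:
  fixes A :: "('h::complex_hilbert_space \<Rightarrow>\<^sub>L 'h) set"
  assumes A: "cstar_algebra A" and G: "finite G" "G \<subseteq> A" and \<epsilon>: "\<epsilon> > 0"
  shows "\<exists>e\<in>A. is_adjoint e e \<and> norm e \<le> 1 \<and> (\<forall>y\<in>G. norm (y - (e o\<^sub>L y o\<^sub>L e)) \<le> \<epsilon>)"
proof -
  obtain star where star: "\<And>y. y \<in> A \<Longrightarrow> star y \<in> A" "\<And>y. y \<in> A \<Longrightarrow> is_adjoint (star y) y"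
    using cstar_algebraD(6)[OF A] by metis
  \<comment> \<open>Both orders of the product occur, so that h dominates y as well as its adjoint.
    The estimate for the adjoint becomes the approximation of y from the left.\<close>
  define h0 where "h0 = (\<Sum>y\<in>G. (y o\<^sub>L star y) + (star y o\<^sub>L y))"
  define M where "M = norm h0 + 1"
  have M: "M > 0" unfolding M_def by (simp add: add_nonneg_pos)
  define h where "h = (1 / M) *\<^sub>R h0"
  have hA: "h \<in> A"
    unfolding h_def h0_def using star G(2)
    by (intro cstar_algebra_scaleR[OF A] cstar_algebra_sum[OF A] cstar_algebraD[OF A]) auto
  have h0_apply: "h0 x = (\<Sum>y\<in>G. y (star y x) + star y (y x))" for x
    unfolding h0_def by (simp add: blinfun.sum_left blinfun.add_left)
  have h0_form: "Re (cinner x (h0 x)) = (\<Sum>y\<in>G. (norm (star y x))\<^sup>2 + (norm (blinfun_apply y x))\<^sup>2)" for x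
  proof -
    have "Re (cinner x (y (star y x) + star y (y x))) = (norm (star y x))\<^sup>2 + (norm (blinfun_apply y x))\<^sup>2"
      if "y \<in> G" for y
    proof -
      have adj: "is_adjoint (star y) y" using star(2) G(2) that by auto
      have "cinner x (y (star y x)) = cinner (star y x) (star y x)"
        by (rule cinner_adjoint[OF is_adjoint_sym[OF adj]])
      moreover have "cinner x (star y (y x)) = cinner (y x) (y x)"
        by (rule cinner_adjoint[OF adj])
      ultimately show ?thesis by (simp only: cinner_simps plus_complex.sel Re_cinner_self)
    qed
    then show ?thesis by (simp add: h0_apply cinner_sum del: plus_complex.sel cong: sum.cong)
  qed
  interpret positive_contraction h
  proof
    have "cinner (h0 x) y = cinner x (h0 y)" for x y
    proof -
      have "cinner (z (star z x) + star z (z x)) y = cinner x (z (star z y) + star z (z y))" if "z \<in> G" for z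
      proof -
        have adj: "is_adjoint (star z) z" using star(2) G(2) that by auto
        show ?thesis
          by (simp add: cinner_simps is_adjointD[OF adj] is_adjointD[OF is_adjoint_sym[OF adj]])
      qed
      then show ?thesis by (simp add: h0_apply cinner_sum cong: sum.cong)
    qed
    then show "is_adjoint h h" unfolding is_adjoint_def h_def by (simp add: blinfun.scaleR_left cinner_scaleR)
    fix x
    show "0 \<le> Re (cinner x (h x))"
      using M by (simp add: h_def blinfun.scaleR_left cinner_scaleR h0_form sum_nonneg)
    have "Re (cinner x (h0 x)) \<le> norm x * norm (h0 x)" by (rule Re_cinner_le_norm)
    also have "\<dots> \<le> norm x * (norm h0 * norm x)" by (intro mult_left_mono norm_blinfun) auto
    also have "\<dots> \<le> norm x * (M * norm x)" unfolding M_def by (intro mult_left_mono mult_right_mono) auto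
    also have "\<dots> = M * (norm x)\<^sup>2" by (simp add: power2_eq_square)
    finally show "Re (cinner x (h x)) \<le> (norm x)\<^sup>2"
      using M by (simp add: h_def blinfun.scaleR_left cinner_scaleR field_simps)
  qed
  have dom: "(norm (star y x))\<^sup>2 \<le> M * Re (cinner x (h x))" "(norm (blinfun_apply y x))\<^sup>2 \<le>
      M * Re (cinner x (h x))"
    if "y \<in> G" for x y
  proof -
    have "(norm (star y x))\<^sup>2 + (norm (blinfun_apply y x))\<^sup>2 \<le> Re (cinner x (h0 x))"
      unfolding h0_form using that G(1) by (intro member_le_sum) auto
    also have "\<dots> = M * Re (cinner x (h x))"
      using M by (simp add: h_def blinfun.scaleR_left cinner_scaleR)
    finally show "(norm (star y x))\<^sup>2 \<le> M * Re (cinner x (h x))" "(norm (blinfun_apply y x))\<^sup>2 \<le>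
        M * Re (cinner x (h x))"
      using zero_le_power2[of "norm (blinfun_apply y x)"] zero_le_power2[of "norm (star y x)"] by linarith+
  qed
  \<comment> \<open>This l gives 2 \<delta> = sqrt (M / l) \<le> \<epsilon>; the left and the right
    error are each at most \<delta>.\<close>
  obtain l :: nat where l: "M / \<epsilon>\<^sup>2 < real l" using reals_Archimedean2 by blast
  have "0 < M / \<epsilon>\<^sup>2" using M \<epsilon> by simp
  then have l0: "l > 0" using l by linarith
  define e where "e = unit_approx (l + l)"
  define \<delta> where "\<delta> = sqrt (M / real ((l + l) + (l + l)))"
  have \<delta>: "2 * \<delta> \<le> \<epsilon>"
  proof -
    have "(2 * \<delta>)\<^sup>2 = M / real l" using M l0 unfolding \<delta>_def by (simp add: power_mult_distrib)
    also have "\<dots> \<le> \<epsilon>\<^sup>2" using l l0 \<epsilon> by (simp add: field_simps)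
    finally show ?thesis using \<epsilon> by (auto intro: power2_le_imp_le)
  qed
  have norm_e: "norm e \<le> 1" unfolding e_def by (rule unit_approx_norm)
  have adj_e: "is_adjoint e e" unfolding e_def by (rule unit_approx_self_adjoint)
  show ?thesis
  proof (intro bexI[of _ e] conjI ballI)
    fix y assume y: "y \<in> G"
    have right: "norm (y - (y o\<^sub>L e)) \<le> \<delta>" and right': "norm (star y - (star y o\<^sub>L e)) \<le> \<delta>"
      unfolding e_def \<delta>_def using y M l0 dom by (intro unit_approx_absorbs; auto)+
    have adj: "is_adjoint (star y) y" using star(2) G(2) y by auto
    have "is_adjoint (y - (e o\<^sub>L y)) (star y - (star y o\<^sub>L e))"
      unfolding is_adjoint_def
      by (simp add: blinfun.diff_left cinner_diff is_adjointD[OF adj_e]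
          is_adjointD[OF is_adjoint_sym[OF adj]])
    then have left: "norm (y - (e o\<^sub>L y)) \<le> \<delta>" using norm_adjoint_le right' order_trans by blast
    have split: "y - (e o\<^sub>L y o\<^sub>L e) = (y - (y o\<^sub>L e)) + ((y - (e o\<^sub>L y)) o\<^sub>L e)"
      by (rule blinfun_eqI) (simp add: blinfun.diff_left blinfun.add_left)
    have "norm (y - (e o\<^sub>L y o\<^sub>L e)) \<le> norm (y - (y o\<^sub>L e)) + norm ((y - (e o\<^sub>L y)) o\<^sub>L e)"
      unfolding split by (rule norm_triangle_ineq)
    also have "norm ((y - (e o\<^sub>L y)) o\<^sub>L e) \<le> norm (y - (e o\<^sub>L y)) * norm e" by (rule norm_blinfun_compose)
    also have "\<dots> \<le> norm (y - (e o\<^sub>L y)) * 1" using norm_e by (intro mult_left_mono) auto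
    finally show "norm (y - (e o\<^sub>L y o\<^sub>L e)) \<le> \<epsilon>" using left right \<delta> by linarith
  qed (use adj_e norm_e unit_approx_mem[OF A hA] in \<open>simp_all add: e_def\<close>)
qed

section \<open>Completely positive contractions\<close>

text \<open>The matrix \<open>[[P, X], [Xs, P]]\<close> over \<open>M\<^sub>k\<close>, where \<open>P\<close> stands for \<open>P \<otimes> 1\<close>.\<close>

definition block :: "nat \<Rightarrow> 'a \<Rightarrow> 'a \<Rightarrow> (nat \<Rightarrow> nat \<Rightarrow> 'a) \<Rightarrow> (nat \<Rightarrow> nat \<Rightarrow> 'a) \<Rightarrow> nat \<Rightarrow> nat \<Rightarrow> 'a" where
  "block k z P X Xs i j =
     (if i < k then if j < k then if i = j then P else z else X i (j - k)
      else if j < k then Xs (i - k) j else if i = j then P else z)"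

text \<open>The quadratic form of \<open>block\<close> at the vector (\<xi>, \<eta>), where F turns
  entries into forms; with \<open>opform\<close> and \<open>mform N\<close> for F it serves
  operators and matrices alike.\<close>

definition block_form ::
    "nat \<Rightarrow> ('a \<Rightarrow> 'g \<Rightarrow> 'g \<Rightarrow> complex) \<Rightarrow> 'a \<Rightarrow> (nat \<Rightarrow> nat \<Rightarrow> 'a) \<Rightarrow> (nat \<Rightarrow> nat \<Rightarrow> 'a) \<Rightarrow>
      (nat \<Rightarrow> 'g) \<Rightarrow> (nat \<Rightarrow> 'g) \<Rightarrow> complex" where
  "block_form k F P X Xs \<xi> \<eta> =
     ((\<Sum>i<k. F P (\<xi> i) (\<xi> i)) + (\<Sum>i<k. F P (\<eta> i) (\<eta> i))) +
     ((\<Sum>i<k. \<Sum>j<k. F (X i j) (\<xi> i) (\<eta> j)) + (\<Sum>i<k. \<Sum>j<k. F (Xs i j) (\<eta> i) (\<xi> j)))"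

lemma block_sum:
  fixes \<zeta> :: "nat \<Rightarrow> 'g"
  assumes z: "\<And>x y. F z x y = 0"
  shows "(\<Sum>i<2 * k. \<Sum>j<2 * k. F (block k z P X Xs i j) (\<zeta> i) (\<zeta> j)) =
    block_form k F P X Xs \<zeta> (\<lambda>i. \<zeta> (k + i))"
proof -
  have d: "(\<Sum>j<k. F (if i = j then P else z) (u i) (u j)) =
      F P (u i) (u i)" if "i < k" for i and u :: "nat \<Rightarrow> 'g"
  proof -
    have "(\<Sum>j<k. F (if i = j then P else z) (u i) (u j)) = (\<Sum>j<k. if j = i then F P (u i) (u i) else 0)"
      by (intro sum.cong) (auto simp: z)
    then show ?thesis using that by simp
  qed
  have "(\<Sum>j<2 * k. F (block k z P X Xs i j) (\<zeta> i) (\<zeta> j)) =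
      F P (\<zeta> i) (\<zeta> i) + (\<Sum>j<k. F (X i j) (\<zeta> i) (\<zeta> (k + j)))" if "i < k" for i
    using that d[of i \<zeta>] by (simp add: sum_double block_def)
  moreover have "(\<Sum>j<2 * k. F (block k z P X Xs (k + i) j) (\<zeta> (k + i)) (\<zeta> j)) =
      F P (\<zeta> (k + i)) (\<zeta> (k + i)) + (\<Sum>j<k. F (Xs i j) (\<zeta> (k + i)) (\<zeta> j))" if "i < k" for i
    using that d[of i "\<lambda>i. \<zeta> (k + i)"] by (simp add: sum_double block_def)
  ultimately show ?thesis
    unfolding sum_double[of _ k] block_form_def by (simp add: sum_double sum.distrib)
qed

lemma block_map: "u (block k z P X Xs i j) = block k (u z) (u P) (\<lambda>i j. u (X i j)) (\<lambda>i j. u (Xs i j)) i j"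
  by (simp add: block_def)

context semi_inner_space
begin

text \<open>Testing positivity on \<open>(u \<xi>, \<eta>)\<close> for \<open>u = 1, -1, \<i>\<close> shows that the off-diagonal blocks are adjoint to
  each other and dominated by the diagonal.\<close>

lemma positive_block_bound:
  fixes F :: "'a \<Rightarrow> 'g \<Rightarrow> 'g \<Rightarrow> complex"
  assumes sesq: "sesquilinear sc (F P)" "\<And>i j. sesquilinear sc (F (X i j))" "\<And>i j. sesquilinear sc (F (Xs i
      j))"
    and pos: "\<And>\<xi> \<eta>. 0 \<le> block_form k F P X Xs \<xi> \<eta>"
    and P: "\<And>x. Re (F P x x) \<le> K * sq x"
  shows "(\<Sum>i<k. \<Sum>j<k. Re (F (X i j) (\<xi> i) (\<eta> j))) \<le> K / 2 * ((\<Sum>i<k. sq (\<xi> i)) + (\<Sum>j<k. sq (\<eta> j)))"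
proof -
  define D where "D = (\<Sum>i<k. F P (\<xi> i) (\<xi> i)) + (\<Sum>i<k. F P (\<eta> i) (\<eta> i))"
  define a where "a = (\<Sum>i<k. \<Sum>j<k. F (X i j) (\<xi> i) (\<eta> j))"
  define b where "b = (\<Sum>i<k. \<Sum>j<k. F (Xs i j) (\<eta> i) (\<xi> j))"
  have *: "0 \<le> D + (cnj u * a + u * b)" if u: "cnj u * u = 1" for u
  proof -
    have cu: "cnj u * (u * c) = c" "u * (cnj u * c) = c" for c
      by (metis mult.assoc mult_1 u, metis mult.assoc mult.commute mult_1 u)
    have "block_form k F P X Xs (\<lambda>i. sc u (\<xi> i)) \<eta> = D + (cnj u * a + u * b)"
      unfolding block_form_def D_def a_def b_def
      by (simp only: sesquilinearD[OF sesq(1)] sesquilinearD[OF sesq(2)] sesquilinearD[OF sesq(3)]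
          cu sum_distrib_left)
    then show ?thesis using pos by metis
  qed
  have "2 * Re a \<le> Re D"
    using *[of 1] *[of "- 1"] *[of \<i>] by (simp add: less_eq_complex_def)
  also have "Re D \<le> (\<Sum>i<k. K * sq (\<xi> i)) + (\<Sum>i<k. K * sq (\<eta> i))"
    unfolding D_def by (simp add: sum_mono add_mono P)
  finally show ?thesis by (simp add: a_def distrib_left flip: sum_distrib_left)
qed

end

lemma M_space_simps [simp]:
  "carrier (M_space N) = carrier_mat N N" "osp_add (M_space N) = (+)" "osp_scale (M_space N) = (\<cdot>\<^sub>m)"
  "mnorm (M_space N) k X = mat_opnorm (amplify N k X)" "mpos (M_space N) k X = mat_positive (amplify N k X)"
  by (simp_all add: mat_space_def)

definition opform :: "('h::complex_hilbert_space \<Rightarrow>\<^sub>L 'h) \<Rightarrow> 'h \<Rightarrow> 'h \<Rightarrow> complex" where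
  "opform T x y = cinner x (blinfun_apply T y)"

lemma opform_sesquilinear:
  assumes "T \<in> bounded_ops"
  shows "sesquilinear scaleC (opform T)"
  unfolding sesquilinear_def opform_def
  by (simp add: cinner_simps blinfun.add_right bounded_opsD[OF assms])

lemma op_mpos_iff: "op_mpos k X \<longleftrightarrow> (\<forall>\<xi>. 0 \<le> (\<Sum>i<k. \<Sum>j<k. opform (X i j) (\<xi> i) (\<xi> j)))"
  by (simp add: op_mpos_def opform_def)

text \<open>Mutually adjoint off-diagonal blocks contribute twice the real part of one of them, so
  positivity at (\<xi>, \<eta>) is the norm estimate at (-\<xi>, \<eta>).\<close>

lemma block_form_adjoint_pos:
  fixes F :: "'a \<Rightarrow> 'g \<Rightarrow> 'g \<Rightarrow> complex"
  assumes P: "\<And>x. F P x x = of_real (r x)"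
    and adj: "\<And>i j x y. i < k \<Longrightarrow> j < k \<Longrightarrow> F (Xs i j) x y = cnj (F (X j i) y x)"
    and bound: "- 2 * (\<Sum>i<k. \<Sum>j<k. Re (F (X i j) (\<xi> i) (\<eta> j))) \<le> (\<Sum>i<k. r (\<xi> i)) + (\<Sum>i<k. r (\<eta> i))"
  shows "0 \<le> block_form k F P X Xs \<xi> \<eta>"
proof -
  define a where "a = (\<Sum>i<k. \<Sum>j<k. F (X i j) (\<xi> i) (\<eta> j))"
  have "(\<Sum>i<k. \<Sum>j<k. F (Xs i j) (\<eta> i) (\<xi> j)) = (\<Sum>i<k. \<Sum>j<k. cnj (F (X j i) (\<xi> j) (\<eta> i)))"
    by (intro sum.cong refl) (simp add: adj)
  also have "\<dots> = cnj a"
    unfolding a_def by (subst sum.swap) simp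
  finally have "block_form k F P X Xs \<xi> \<eta> = of_real ((\<Sum>i<k. r (\<xi> i)) + (\<Sum>i<k. r (\<eta> i))) + (a + cnj a)"
    unfolding block_form_def P a_def by simp
  moreover have "Re a = (\<Sum>i<k. \<Sum>j<k. Re (F (X i j) (\<xi> i) (\<eta> j)))"
    by (simp add: a_def)
  ultimately show ?thesis using bound by (simp add: less_eq_complex_def)
qed

lemma mform_adjoint:
  assumes "M \<in> carrier_mat N N"
  shows "mform N (mat N N (\<lambda>(r, s). cnj (M $$ (s, r)))) x y = cnj (mform N M y x)"
  unfolding mform_def using assms by (subst sum.swap) (simp add: mult_ac)

lemma mform_zero: "mform N (0\<^sub>m N N) x y = 0"
  by (simp add: mform_def)

lemma op_scaleC_zero: "op_scaleC 0 T = (0 :: 'h::complex_hilbert_space \<Rightarrow>\<^sub>L 'h)"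
  using op_scaleC_of_real[of 0 T] by simp

lemma mform_one: "mform N (1\<^sub>m N) x y = fip N x y"
proof -
  have "(\<Sum>s<N. cnj (x r) * (1\<^sub>m N $$ (r, s) * y s)) = (\<Sum>s<N. if s =
      r then cnj (x r) * y r else 0)" if "r < N" for r
    using that by (intro sum.cong refl) auto
  then show ?thesis by (simp add: mform_def fip_def)
qed

lemma fip_self: "fip N x x = of_real (fin.sq N x)"
  using cdot_self[of "{..<N}" x] by (simp add: fip_def cdot_def fin_sq)

text \<open>If X has norm at most K, the block matrix with diagonal K 1 and off-diagonal X and its
  adjoint is positive. Its image under \<psi> is again positive, and the diagonal becomes K
  \<psi>(1), which is at most K by contractivity.\<close>

lemma cp_from_matrices:
  fixes A :: "('h::complex_hilbert_space \<Rightarrow>\<^sub>L 'h) set"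
  assumes A: "cstar_algebra A"
    and lin: "linear_map (M_space N) (op_space A) \<psi>"
    and cp: "completely_positive (M_space N) (op_space A) \<psi>"
    and contr: "contractive (M_space N) (op_space A) \<psi>"
    and X: "\<And>i j. X i j \<in> carrier_mat N N" and K: "mat_opnorm (amplify N k X) \<le> K"
  shows "op_mnorm k (\<lambda>i j. \<psi> (X i j)) \<le> K"
proof -
  have K0: "K \<ge> 0" using K mat_mnorm_nonneg order_trans by blast
  define Xs where "Xs i j = mat N N (\<lambda>(r, s). cnj (X j i $$ (s, r)))" for i j
  define P where "P = complex_of_real K \<cdot>\<^sub>m 1\<^sub>m N"
  define Z where "Z = block k (0\<^sub>m N N) P X Xs"
  have ZM: "Z i j \<in> carrier_mat N N" for i j
    unfolding Z_def block_def P_def Xs_def using X by simp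
  have \<psi>A: "\<psi> M \<in> bounded_ops" if "M \<in> carrier_mat N N" for M
    using linear_mapD(1)[OF lin, of M] that cstar_algebraD(1)[OF A] by auto
  have "0 \<le> (\<Sum>i<2 * k. \<Sum>j<2 * k. mform N (Z i j) (\<zeta> i) (\<zeta> j))" for \<zeta>
  proof -
    have "0 \<le> block_form k (mform N) P X Xs \<zeta> (\<lambda>i. \<zeta> (k + i))"
    proof (rule block_form_adjoint_pos[where r = "\<lambda>x. K * fin.sq N x"])
      show "mform N P x x = of_real (K * fin.sq N x)" for x
        unfolding P_def by (simp add: mform_scale[of _ N] mform_one fip_self)
      show "mform N (Xs i j) x y = cnj (mform N (X j i) y x)" for i j x y
        unfolding Xs_def by (rule mform_adjoint[OF X])
      have "(\<Sum>i<k. \<Sum>j<k. Re (mform N (X i j) (fscale (- 1) (\<zeta> i)) (\<zeta> (k + j)))) \<le>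
          K / 2 * ((\<Sum>i<k. fin.sq N (fscale (- 1) (\<zeta> i))) + (\<Sum>j<k. fin.sq N (\<zeta> (k + j))))"
        by (rule mat_mnorm_weak_ge[OF K])
      then show "- 2 * (\<Sum>i<k. \<Sum>j<k. Re (mform N (X i j) (\<zeta> i) (\<zeta> (k + j)))) \<le>
          (\<Sum>i<k. K * fin.sq N (\<zeta> i)) + (\<Sum>i<k. K * fin.sq N (\<zeta> (k + i)))"
        by (simp add: sesquilinearD[OF mform_sesquilinear] fin.sq_scale sum_negf distrib_left flip:
            sum_distrib_left)
    qed
    then show ?thesis
      unfolding Z_def by (subst block_sum[where F = "mform N" and z = "0\<^sub>m N N"]) (simp_all add: mform_zero)
  qed
  then have "op_mpos (2 * k) (\<lambda>i j. \<psi> (Z i j))"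
    using cp ZM unfolding completely_positive_def
    by (simp add: mat_positive_amplify_iff matrices_over_def)
  moreover have \<psi>0: "opform (\<psi> (0\<^sub>m N N)) x y = 0" for x y
  proof -
    have "\<psi> (0 \<cdot>\<^sub>m 0\<^sub>m N N) = op_scaleC 0 (\<psi> (0\<^sub>m N N))"
      using linear_mapD(3)[OF lin, of "0\<^sub>m N N" 0] by simp
    then have "\<psi> (0\<^sub>m N N) = 0" by (simp add: op_scaleC_zero)
    then show ?thesis by (simp add: opform_def cinner_simps)
  qed
  ultimately have pos: "0 \<le> block_form k opform (\<psi> P) (\<lambda>i j. \<psi> (X i j)) (\<lambda>i j. \<psi> (Xs i j)) \<xi> \<eta>" for \<xi> \<eta>
  proof -
    define \<zeta> where "\<zeta> i = (if i < k then \<xi> i else \<eta> (i - k))" for i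
    have "0 \<le> (\<Sum>i<2 * k. \<Sum>j<2 * k. opform (\<psi> (Z i j)) (\<zeta> i) (\<zeta> j))"
      using \<open>op_mpos (2 * k) (\<lambda>i j. \<psi> (Z i j))\<close> unfolding op_mpos_iff by blast
    also have "\<dots> = block_form k opform (\<psi> P) (\<lambda>i j. \<psi> (X i j)) (\<lambda>i j. \<psi> (Xs i j)) \<zeta> (\<lambda>i. \<zeta> (k + i))"
      unfolding Z_def block_map[of \<psi>] by (rule block_sum[where F = opform and z = "\<psi> (0\<^sub>m N N)", OF \<psi>0])
    also have "\<dots> = block_form k opform (\<psi> P) (\<lambda>i j. \<psi> (X i j)) (\<lambda>i j. \<psi> (Xs i j)) \<xi> \<eta>"
      unfolding block_form_def \<zeta>_def by simp
    finally show ?thesis .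
  qed
  have P_bound: "Re (opform (\<psi> P) x x) \<le> K * hilbert.sq x" for x
  proof -
    have "mat_opnorm (amplify N 1 (\<lambda>_ _. 1\<^sub>m N)) \<le> 1"
    proof (rule mat_mnorm_weak_le)
      fix \<xi> \<eta> :: "nat \<Rightarrow> nat \<Rightarrow> complex"
      have "Re (\<Sum>r<N. cnj (\<xi> 0 r) * \<eta> 0 r) \<le> (\<Sum>r<N. 1 / 2 * ((cmod (\<xi> 0 r))\<^sup>2 + (cmod (\<eta> 0 r))\<^sup>2))"
        unfolding Re_sum using Re_cinner_le[of "\<xi> 0 _" "\<eta> 0 _"]
        by (intro sum_mono) (simp add: cinner_complex_def)
      then show "(\<Sum>i<1. \<Sum>j<1. Re (mform N (1\<^sub>m N) (\<xi> i) (\<eta> j))) \<le>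
          1 / 2 * ((\<Sum>i<1. fin.sq N (\<xi> i)) + (\<Sum>j<1. fin.sq N (\<eta> j)))"
        by (simp add: mform_one fip_def fin_sq sum.distrib flip: sum_divide_distrib)
    qed simp
    then have n1: "norm (\<psi> (1\<^sub>m N)) \<le> 1"
      using bspec[OF contr[unfolded contractive_def], of "1\<^sub>m N"]
      by (simp add: op_mnorm_one[unfolded One_nat_def])
    have "\<psi> P = op_scaleC (of_real K) (\<psi> (1\<^sub>m N))"
      using linear_mapD(3)[OF lin, of "1\<^sub>m N" "of_real K"] by (simp add: P_def)
    then have "Re (opform (\<psi> P) x x) = K * Re (cinner x (\<psi> (1\<^sub>m N) x))"
      by (simp add: opform_def op_scaleC_apply cinner_simps)
    also have "\<dots> \<le> K * (norm x * (1 * norm x))"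
    proof (rule mult_left_mono[OF order_trans[OF Re_cinner_le_norm] K0])
      have "norm (\<psi> (1\<^sub>m N) x) \<le> norm (\<psi> (1\<^sub>m N)) * norm x" by (rule norm_blinfun)
      also have "\<dots> \<le> 1 * norm x" using n1 by (intro mult_right_mono) auto
      finally show "norm x * norm (\<psi> (1\<^sub>m N) x) \<le> norm x * (1 * norm x)" by (intro mult_left_mono) auto
    qed
    finally show ?thesis by (simp add: power2_eq_square)
  qed
  show ?thesis
  proof (rule op_mnorm_weak_le[OF K0])
    fix \<xi> \<eta> :: "nat \<Rightarrow> 'h"
    have "(\<Sum>i<k. \<Sum>j<k. Re (opform (\<psi> (X i j)) (\<xi> i) (\<eta> j))) \<le>
        K / 2 * ((\<Sum>i<k. hilbert.sq (\<xi> i)) + (\<Sum>j<k. hilbert.sq (\<eta> j)))"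
      using pos P_bound
      by (rule hilbert.positive_block_bound[rotated 3])
          (auto intro!: opform_sesquilinear \<psi>A X simp: P_def Xs_def)
    then show "(\<Sum>i<k. \<Sum>j<k. Re (cinner (\<xi> i) (blinfun_apply (\<psi> (X i j)) (\<eta> j)))) \<le>
        K / 2 * ((\<Sum>i<k. (norm (\<xi> i))\<^sup>2) + (\<Sum>j<k. (norm (\<eta> j))\<^sup>2))"
      by (simp add: opform_def)
  qed
qed

text \<open>Compressing the positive block matrix with diagonal K by a self-adjoint contraction e in
  A gives the blocks K e e and e Y e, all of them in A, and the diagonal still has norm at most K.
  Finally e runs through an approximate unit for the finitely many entries of Y.\<close>

lemma cp_to_matrices:
  fixes A :: "('h::complex_hilbert_space \<Rightarrow>\<^sub>L 'h) set"
  assumes A: "cstar_algebra A"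
    and lin: "linear_map (op_space A) (M_space N) \<phi>"
    and cp: "completely_positive (op_space A) (M_space N) \<phi>"
    and contr: "contractive (op_space A) (M_space N) \<phi>"
    and Y: "\<And>i j. Y i j \<in> A" and K: "op_mnorm k Y \<le> K"
  shows "(\<Sum>i<k. \<Sum>j<k. Re (mform N (\<phi> (Y i j)) (\<xi> i) (\<eta> j)))
    \<le> K / 2 * ((\<Sum>i<k. fin.sq N (\<xi> i)) + (\<Sum>j<k. fin.sq N (\<eta> j)))"
proof -
  have K0: "K \<ge> 0" using K op_mnorm_nonneg order_trans by blast
  have \<phi>M: "\<phi> T \<in> carrier_mat N N" if "T \<in> A" for T
    using linear_mapD(1)[OF lin, of T] that by simp
  have \<phi>_norm: "Re (mform N (\<phi> T) x y) \<le> norm T / 2 * (fin.sq N x + fin.sq N y)" if T: "T \<in> A" for T x y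
  proof -
    have "mat_opnorm (amplify N 1 (\<lambda>_ _. \<phi> T)) \<le> norm T"
      using contr T op_mnorm_one[of T] unfolding contractive_def by auto
    from mat_mnorm_weak_ge[OF this, of "\<lambda>_. x" "\<lambda>_. y"] show ?thesis by simp
  qed
  obtain star where star: "\<And>y. y \<in> A \<Longrightarrow> star y \<in> A" "\<And>y. y \<in> A \<Longrightarrow> is_adjoint (star y) y"
    using cstar_algebraD(6)[OF A] by metis
  have compressed: "(\<Sum>i<k. \<Sum>j<k. Re (mform N (\<phi> (e o\<^sub>L Y i j o\<^sub>L e)) (\<xi> i) (\<eta> j)))
      \<le> K / 2 * ((\<Sum>i<k. fin.sq N (\<xi> i)) + (\<Sum>j<k. fin.sq N (\<eta> j)))"
    if e: "e \<in> A" "is_adjoint e e" "norm e \<le> 1" for e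
  proof -
    define X where "X i j = e o\<^sub>L Y i j o\<^sub>L e" for i j
    define Xs where "Xs i j = e o\<^sub>L star (Y j i) o\<^sub>L e" for i j
    define P where "P = op_scaleC (of_real K) (e o\<^sub>L e)"
    define Z where "Z = block k 0 P X Xs"
    have mem: "X i j \<in> A" "Xs i j \<in> A" "P \<in> A" for i j
      unfolding X_def Xs_def P_def using e(1) Y star(1) by (auto intro!: cstar_algebraD[OF A])
    have ZA: "Z i j \<in> A" for i j
      unfolding Z_def block_def using mem cstar_algebraD(2)[OF A] by simp
    have "op_mpos (2 * k) Z"
      unfolding op_mpos_iff
    proof
      fix \<zeta> :: "nat \<Rightarrow> 'h"
      have "0 \<le> block_form k opform P X Xs \<zeta> (\<lambda>i. \<zeta> (k + i))"
      proof (rule block_form_adjoint_pos[where r = "\<lambda>x. K * (norm (e x))\<^sup>2"])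
        show "opform P x x = of_real (K * (norm (e x))\<^sup>2)" for x
          by (simp add: opform_def P_def op_scaleC_apply cinner_simps cinner_adjoint[OF e(2)] cinner_self)
        show "opform (Xs i j) x y = cnj (opform (X j i) y x)" for i j x y
        proof -
          have "opform (Xs i j) x y = cinner (e x) (star (Y j i) (e y))"
            by (simp add: opform_def Xs_def cinner_adjoint[OF e(2)])
          also have "\<dots> = cinner (Y j i (e x)) (e y)"
            by (rule cinner_adjoint[OF star(2)[OF Y]])
          also have "\<dots> = cnj (cinner (e y) (Y j i (e x)))" by (rule cinner_commute)
          also have "cinner (e y) (Y j i (e x)) = opform (X j i) y x"
            by (simp add: opform_def X_def cinner_adjoint[OF e(2)])
          finally show ?thesis .
        qed
        have "(\<Sum>i<k. \<Sum>j<k. Re (cinner (- e (\<zeta> i)) (Y i j (e (\<zeta> (k + j)))))) \<le>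
            K / 2 * ((\<Sum>i<k. (norm (- e (\<zeta> i)))\<^sup>2) + (\<Sum>j<k. (norm (e (\<zeta> (k + j))))\<^sup>2))"
          by (rule op_mnorm_weak_ge[OF K])
        moreover have "opform (X i j) x y = cinner (e x) (Y i j (e y))" for i j x y
          by (simp add: opform_def X_def cinner_adjoint[OF e(2)])
        ultimately show "- 2 * (\<Sum>i<k. \<Sum>j<k. Re (opform (X i j) (\<zeta> i) (\<zeta> (k + j)))) \<le>
            (\<Sum>i<k. K * (norm (e (\<zeta> i)))\<^sup>2) + (\<Sum>i<k. K * (norm (e (\<zeta> (k + i))))\<^sup>2)"
          by (simp add: cinner_minus sum_negf distrib_left flip: sum_distrib_left)
      qed
      then show "0 \<le> (\<Sum>i<2 * k. \<Sum>j<2 * k. opform (Z i j) (\<zeta> i) (\<zeta> j))"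
        unfolding Z_def by (subst block_sum[where F = opform and z = 0])
            (simp_all add: opform_def cinner_simps)
    qed
    then have Zpos: "mat_positive (amplify N (2 * k) (\<lambda>i j. \<phi> (Z i j)))"
      using cp ZA unfolding completely_positive_def by (simp add: matrices_over_def)
    have \<phi>0: "mform N (\<phi> 0) x y = 0" for x y
    proof -
      have "\<phi> 0 = 0 \<cdot>\<^sub>m \<phi> 0"
        using linear_mapD(3)[OF lin, of 0 0] cstar_algebraD(2)[OF A]
        unfolding op_space_simps M_space_simps op_scaleC_zero by blast
      then show ?thesis
        using mform_scale[OF \<phi>M[OF cstar_algebraD(2)[OF A]], of 0 x y] by simp
    qed
    have pos: "0 \<le> block_form k (mform N) (\<phi> P) (\<lambda>i j. \<phi> (X i j)) (\<lambda>i j. \<phi> (Xs i j)) \<xi> \<eta>" for \<xi> \<eta>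
    proof -
      define \<zeta> where "\<zeta> i = (if i < k then \<xi> i else \<eta> (i - k))" for i
      have "0 \<le> (\<Sum>i<2 * k. \<Sum>j<2 * k. mform N (\<phi> (Z i j)) (\<zeta> i) (\<zeta> j))"
        using Zpos unfolding mat_positive_amplify_iff by blast
      also have "\<dots> = block_form k (mform N) (\<phi> P) (\<lambda>i j. \<phi> (X i j)) (\<lambda>i j. \<phi> (Xs i j)) \<zeta> (\<lambda>i. \<zeta> (k + i))"
        unfolding Z_def block_map[of \<phi>] by (rule block_sum[where F = "mform N" and z = "\<phi> 0", OF \<phi>0])
      also have "\<dots> = block_form k (mform N) (\<phi> P) (\<lambda>i j. \<phi> (X i j)) (\<lambda>i j. \<phi> (Xs i j)) \<xi> \<eta>"
        unfolding block_form_def \<zeta>_def by simp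
      finally show ?thesis .
    qed
    have P_bound: "Re (mform N (\<phi> P) x x) \<le> K * fin.sq N x" for x
    proof -
      have sq0: "fin.sq N x \<ge> 0" by (simp add: fin_sq sum_nonneg)
      have "norm (e o\<^sub>L e) \<le> norm e * norm e" by (rule norm_blinfun_compose)
      also have "\<dots> \<le> 1" using e(3) by (simp add: mult_le_one)
      finally have "norm P \<le> K"
        using K0 by (simp add: P_def op_scaleC_of_real mult_left_le)
      then have "norm P / 2 * (fin.sq N x + fin.sq N x) \<le> K / 2 * (fin.sq N x + fin.sq N x)"
        using sq0 by (intro mult_right_mono) auto
      then show ?thesis using \<phi>_norm[OF mem(3), of x x] by simp
    qed
    show ?thesis
      unfolding X_def[symmetric]
      by (rule fin.positive_block_bound[where F = "mform N", OF mform_sesquilinear mform_sesquilinear mform_sesquilinear pos P_bound])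
  qed
  \<comment> \<open>Replacing every entry of Y by its compression up to \<epsilon> changes the form
    by at most \<epsilon> S.\<close>
  define S where "S = (\<Sum>i<k. \<Sum>j<k. (fin.sq N (\<xi> i) + fin.sq N (\<eta> j)) / 2)"
  have S: "S \<ge> 0" unfolding S_def by (intro sum_nonneg) (simp add: fin_sq sum_nonneg)
  have approx: "(\<Sum>i<k. \<Sum>j<k. Re (mform N (\<phi> (Y i j)) (\<xi> i) (\<eta> j)))
      \<le> K / 2 * ((\<Sum>i<k. fin.sq N (\<xi> i)) + (\<Sum>j<k. fin.sq N (\<eta> j))) + \<epsilon> * S" if \<epsilon>: "\<epsilon> > 0" for \<epsilon>
  proof -
    obtain e where e: "e \<in> A" "is_adjoint e e" "norm e \<le> 1"
      and close: "\<And>i j. i < k \<Longrightarrow> j < k \<Longrightarrow> norm (Y i j - (e o\<^sub>L Y i j o\<^sub>L e)) \<le> \<epsilon>"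
    proof -
      have "finite ((\<lambda>(i, j). Y i j) ` ({..<k} \<times> {..<k}))" "(\<lambda>(i, j). Y i j) ` ({..<k} \<times> {..<k}) \<subseteq> A"
        using Y by auto
      from cstar_approximate_unit[OF A this \<epsilon>] show thesis using that by force
    qed
    have "Re (mform N (\<phi> (Y i j)) (\<xi> i) (\<eta> j)) \<le> Re (mform N (\<phi> (e o\<^sub>L Y i j o\<^sub>L e)) (\<xi> i) (\<eta> j)) +
        \<epsilon> * ((fin.sq N (\<xi> i) + fin.sq N (\<eta> j)) / 2)" if ij: "i < k" "j < k" for i j
    proof -
      define T where "T = e o\<^sub>L Y i j o\<^sub>L e"
      define R where "R = Y i j - T"
      have T: "T \<in> A" unfolding T_def using e(1) Y by (auto intro!: cstar_algebraD[OF A])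
      have R: "R \<in> A" unfolding R_def using T Y by (intro cstar_algebra_diff[OF A]) auto
      have "\<phi> (Y i j) = \<phi> T + \<phi> R"
        using linear_mapD(2)[OF lin, of T R] T R by (simp add: R_def)
      then have "mform N (\<phi> (Y i j)) (\<xi> i) (\<eta> j) = mform N (\<phi> T) (\<xi> i) (\<eta> j) + mform N (\<phi> R) (\<xi> i) (\<eta> j)"
        by (simp add: mform_add[OF \<phi>M[OF T] \<phi>M[OF R]])
      moreover have "Re (mform N (\<phi> R) (\<xi> i) (\<eta> j)) \<le> norm R / 2 * (fin.sq N (\<xi> i) + fin.sq N (\<eta> j))"
        by (rule \<phi>_norm[OF R])
      moreover have "norm R / 2 * (fin.sq N (\<xi> i) + fin.sq N (\<eta> j)) \<le>
          \<epsilon> / 2 * (fin.sq N (\<xi> i) + fin.sq N (\<eta> j))"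
        using close[OF ij] unfolding R_def T_def
        by (intro mult_right_mono) (auto simp: fin_sq intro!: add_nonneg_nonneg sum_nonneg)
      ultimately show ?thesis unfolding T_def by simp
    qed
    then have "(\<Sum>i<k. \<Sum>j<k. Re (mform N (\<phi> (Y i j)) (\<xi> i) (\<eta> j))) \<le>
        (\<Sum>i<k. \<Sum>j<k. Re (mform N (\<phi> (e o\<^sub>L Y i j o\<^sub>L e)) (\<xi> i) (\<eta> j)) + \<epsilon> * ((fin.sq N (\<xi> i) +
            fin.sq N (\<eta> j)) / 2))"
      by (intro sum_mono) auto
    also have "\<dots> = (\<Sum>i<k. \<Sum>j<k. Re (mform N (\<phi> (e o\<^sub>L Y i j o\<^sub>L e)) (\<xi> i) (\<eta> j))) + \<epsilon> * S"
      unfolding S_def by (simp only: sum.distrib sum_distrib_left)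
    finally show ?thesis using compressed[OF e] by simp
  qed
  show ?thesis
  proof (rule field_le_epsilon)
    fix d :: real assume d: "d > 0"
    have "d / (S + 1) * S \<le> d" using d S by (simp add: field_simps)
    moreover have "d / (S + 1) > 0" using d S by simp
    ultimately show "(\<Sum>i<k. \<Sum>j<k. Re (mform N (\<phi> (Y i j)) (\<xi> i) (\<eta> j)))
      \<le> K / 2 * ((\<Sum>i<k. fin.sq N (\<xi> i)) + (\<Sum>j<k. fin.sq N (\<eta> j))) + d"
      using approx[of "d / (S + 1)"] by linarith
  qed
qed

section \<open>Factorizations\<close>

lemma cb_norm_bound:
  assumes "cb_norm V W u \<le> ennreal c" "c \<ge> 0" "X \<in> matrices_over k V" "mnorm V k X \<le> 1"
  shows "mnorm W k (\<lambda>i j. u (X i j)) \<le> c"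
proof -
  have "ennreal (mnorm W k (\<lambda>i j. u (X i j))) \<le> cb_norm V W u"
    unfolding cb_norm_def using assms(3,4) by (intro SUP_upper2[of k] SUP_upper2[of X]) auto
  then have "ennreal (mnorm W k (\<lambda>i j. u (X i j))) \<le> ennreal c" using assms(1) by (rule order_trans)
  then show ?thesis using assms(2) by (simp add: ennreal_le_iff)
qed

context semi_inner_space
begin

text \<open>A padded column sees only \<eta> 0; the other components of \<eta> merely enlarge the
  right side.\<close>

lemma first_column_form_le:
  fixes B :: "nat \<Rightarrow> nat \<Rightarrow> 'g \<Rightarrow> 'g \<Rightarrow> complex"
  assumes sq: "\<And>x. sq x \<ge> 0" and K: "K \<ge> 0"
    and B: "\<And>i j x y. j \<noteq> 0 \<Longrightarrow> B i j x y = 0"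
    and le: "\<And>\<xi> \<eta>. (\<Sum>i<n. Re (B i 0 (\<xi> i) \<eta>)) \<le> K / 2 * ((\<Sum>i<n. sq (\<xi> i)) + sq \<eta>)"
  shows "(\<Sum>i<n. \<Sum>j<n. Re (B i j (\<xi> i) (\<eta> j))) \<le> K / 2 * ((\<Sum>i<n. sq (\<xi> i)) + (\<Sum>j<n. sq (\<eta> j)))"
proof (cases "n = 0")
  case False
  have "(\<Sum>j<n. Re (B i j (\<xi> i) (\<eta> j))) = (\<Sum>j<n. if j = 0 then Re (B i 0 (\<xi> i) (\<eta> 0)) else 0)" for i
    by (intro sum.cong refl) (auto simp: B)
  then have "(\<Sum>i<n. \<Sum>j<n. Re (B i j (\<xi> i) (\<eta> j))) = (\<Sum>i<n. Re (B i 0 (\<xi> i) (\<eta> 0)))"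
    using False by simp
  also have "\<dots> \<le> K / 2 * ((\<Sum>i<n. sq (\<xi> i)) + sq (\<eta> 0))" by (rule le)
  also have "\<dots> \<le> K / 2 * ((\<Sum>i<n. sq (\<xi> i)) + (\<Sum>j<n. sq (\<eta> j)))"
    using K False sq
    by (intro mult_left_mono add_left_mono member_le_sum[of 0 _ "\<lambda>j. sq (\<eta> j)"]) auto
  finally show ?thesis .
qed simp

lemma first_row_form_le:
  fixes B :: "nat \<Rightarrow> nat \<Rightarrow> 'g \<Rightarrow> 'g \<Rightarrow> complex"
  assumes sq: "\<And>x. sq x \<ge> 0" and K: "K \<ge> 0"
    and B: "\<And>i j x y. i \<noteq> 0 \<Longrightarrow> B i j x y = 0"
    and le: "\<And>\<xi> \<eta>. (\<Sum>j<n. Re (B 0 j \<xi> (\<eta> j))) \<le> K / 2 * (sq \<xi> + (\<Sum>j<n. sq (\<eta> j)))"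
  shows "(\<Sum>i<n. \<Sum>j<n. Re (B i j (\<xi> i) (\<eta> j))) \<le> K / 2 * ((\<Sum>i<n. sq (\<xi> i)) + (\<Sum>j<n. sq (\<eta> j)))"
proof -
  have "(\<Sum>j<n. \<Sum>i<n. Re (B i j (\<xi> i) (\<eta> j))) \<le> K / 2 * ((\<Sum>j<n. sq (\<eta> j)) + (\<Sum>i<n. sq (\<xi> i)))"
    using first_column_form_le[where B = "\<lambda>j i \<eta> \<xi>. B i j \<xi> \<eta>" and \<xi> = \<eta> and \<eta> = \<xi> and n = n, OF sq K B] le
    by (simp add: add.commute)
  then show ?thesis
    by (subst sum.swap) (simp add: add.commute)
qed

end

lemma column_norm_le:
  assumes K: "K \<ge> 0"
    and le: "\<And>\<xi> \<eta>. (\<Sum>i<n. Re (opform (c i) (\<xi> i) \<eta>)) \<le> K / 2 * ((\<Sum>i<n. (norm (\<xi> i))\<^sup>2) + (norm \<eta>)\<^sup>2)"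
  shows "op_mnorm n (column c) \<le> K"
  using hilbert.first_column_form_le[where B = "\<lambda>i j. opform (column c i j)" and K = K and n = n] le
  by (intro op_mnorm_weak_le[OF K]) (simp add: K column_def opform_def cinner_simps)

lemma row_norm_le:
  assumes K: "K \<ge> 0"
    and le: "\<And>\<xi> \<eta>. (\<Sum>i<n. Re (opform (d i) \<xi> (\<eta> i))) \<le> K / 2 * ((norm \<xi>)\<^sup>2 + (\<Sum>i<n. (norm (\<eta> i))\<^sup>2))"
  shows "op_mnorm n (row d) \<le> K"
  using hilbert.first_row_form_le[where B = "\<lambda>i j. opform (row d i j)" and K = K and n = n] le
  by (intro op_mnorm_weak_le[OF K]) (simp add: K row_def opform_def cinner_simps)

lemma fin_sq_nonneg: "fin.sq N x \<ge> 0"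
  by (simp add: fin_sq sum_nonneg)

lemma mat_column_norm_le:
  assumes K: "K \<ge> 0"
    and le: "\<And>\<xi> \<eta>. (\<Sum>i<n. Re (mform N (c i) (\<xi> i) \<eta>)) \<le> K / 2 * ((\<Sum>i<n. fin.sq N (\<xi> i)) + fin.sq N \<eta>)"
  shows "mat_opnorm (amplify N n (\<lambda>i j. if j = 0 then c i else 0\<^sub>m N N)) \<le> K"
  by (rule mat_mnorm_weak_le[OF K],
      rule fin.first_column_form_le[where B = "\<lambda>i j. mform N (if j = 0 then c i else 0\<^sub>m N N)"])
    (use le in \<open>simp_all add: fin_sq_nonneg K mform_zero\<close>)

lemma mat_row_norm_le:
  assumes K: "K \<ge> 0"
    and le: "\<And>\<xi> \<eta>. (\<Sum>i<n. Re (mform N (d i) \<xi> (\<eta> i))) \<le> K / 2 * (fin.sq N \<xi> + (\<Sum>i<n. fin.sq N (\<eta> i)))"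
  shows "mat_opnorm (amplify N n (\<lambda>i j. if i = 0 then d j else 0\<^sub>m N N)) \<le> K"
  by (rule mat_mnorm_weak_le[OF K],
      rule fin.first_row_form_le[where B = "\<lambda>i j. mform N (if i = 0 then d j else 0\<^sub>m N N)"])
    (use le in \<open>simp_all add: fin_sq_nonneg K mform_zero\<close>)

text \<open>The error \<open>\<epsilon>\<close> only occurs for nuclear \<open>A\<close>.\<close>

definition decomposes ::
    "nat \<Rightarrow> ('h::complex_hilbert_space \<Rightarrow>\<^sub>L 'h) set \<Rightarrow> real \<Rightarrow> (nat \<Rightarrow> 'h \<Rightarrow>\<^sub>L 'h) \<Rightarrow> bool" where
  "decomposes n A K W \<longleftrightarrow>
     (\<forall>\<epsilon>>0. \<exists>c d. (\<forall>i. c i \<in> A \<and> d i \<in> A) \<and>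
        op_mnorm n (column c) \<le> K \<and> op_mnorm n (row d) \<le> K \<and>
        (\<forall>i<n. norm (c i + d i - (1 + 1 / sqrt (real n)) *\<^sub>R W i) \<le> \<epsilon>))"

section \<open>Decompositions in injective and in nuclear algebras\<close>

lemma linear_map_emat:
  assumes "linear_map (E_space n) (op_space A) w"
  shows "w (emat n c) \<in> A"
    and "w (emat n (\<lambda>i. c i + d i)) = w (emat n c) + w (emat n d)"
    and "w (emat n (\<lambda>i. a * c i)) = op_scaleC a (w (emat n c))"
  using linear_mapD(1)[OF assms, of "emat n c"] linear_mapD(2)[OF assms, of "emat n c" "emat n d"]
    linear_mapD(3)[OF assms, of "emat n c" a]
  by (simp_all add: E_space_carrier emat_add emat_scale)

lemma completely_contractive_scaled:
  fixes A :: "('h::complex_hilbert_space \<Rightarrow>\<^sub>L 'h) set" and P :: "('h \<Rightarrow>\<^sub>L 'h) \<Rightarrow> 'h \<Rightarrow>\<^sub>L 'h"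
  assumes lin: "linear_map (op_space bounded_ops) (op_space A) P"
    and A: "A \<subseteq> bounded_ops"
    and cb: "cb_norm (op_space bounded_ops) (op_space A) P \<le> 1"
    and X: "\<And>i j. X i j \<in> bounded_ops" and K: "op_mnorm k X \<le> K" "K > 0"
  shows "op_mnorm k (\<lambda>i j. P (X i j)) \<le> K"
proof -
  define a where "a = complex_of_real (1 / K)"
  define Y where "Y i j = op_scaleC a (X i j)" for i j
  have YB: "Y i j \<in> bounded_ops" for i j
    unfolding Y_def by (rule bounded_opsI)
      (simp add: op_scaleC_apply bounded_opsD[OF X] scaleC_scaleC mult.commute)
  have "op_mnorm k Y \<le> 1"
    unfolding Y_def a_def by (rule op_mnorm_normalize[OF K])
  then have le: "op_mnorm k (\<lambda>i j. P (Y i j)) \<le> 1"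
    using cb_norm_bound[of "op_space bounded_ops" "op_space A" P 1 Y k] cb YB
    by (simp add: matrices_over_def)
  show ?thesis
  proof (rule op_mnorm_weak_le)
    fix \<xi> \<eta> :: "nat \<Rightarrow> 'h"
    have "P (Y i j) = op_scaleC a (P (X i j))" for i j
      using linear_mapD(3)[OF lin, of "X i j" a] X by (simp add: Y_def)
    then have "(\<Sum>i<k. \<Sum>j<k. Re (cinner (\<xi> i) (blinfun_apply (P (X i j)) (\<eta> j)))) =
        K * (\<Sum>i<k. \<Sum>j<k. Re (cinner (\<xi> i) (blinfun_apply (P (Y i j)) (\<eta> j))))"
      using K by (simp add: op_scaleC_apply cinner_simps a_def flip: sum_divide_distrib)
    then show "(\<Sum>i<k. \<Sum>j<k. Re (cinner (\<xi> i) (blinfun_apply (P (X i j)) (\<eta> j)))) \<le>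
        K / 2 * ((\<Sum>i<k. (norm (\<xi> i))\<^sup>2) + (\<Sum>j<k. (norm (\<eta> j))\<^sup>2))"
      using mult_left_mono[OF op_mnorm_weak_ge[OF le, of \<xi> \<eta>], of K] K by simp
  qed (use K in simp)
qed

lemma opform_respects_null: "hilbert.respects_null (opform T)"
  unfolding hilbert.respects_null_def
proof (intro allI conjI impI)
  fix x y :: 'a
  show "opform T x y = 0" if "\<forall>\<zeta>. cinner \<zeta> y = 0"
  proof -
    have "y = 0"
    proof (rule cinner_eqI)
      show "cinner z y = cinner z 0" for z using that by (simp add: cinner_simps(6))
    qed
    then show ?thesis by (simp add: opform_def cinner_simps blinfun.zero_right)
  qed
  show "opform T x y = 0" if "\<forall>\<zeta>. cinner x \<zeta> = 0"
    using that by (simp add: opform_def)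
qed

lemma injective_decomposes:
  fixes A :: "('h::complex_hilbert_space \<Rightarrow>\<^sub>L 'h) set"
  assumes n: "n \<ge> 1" and inj: "injective_von_neumann_algebra A"
    and w: "linear_map (E_space n) (op_space A) w"
    and cb: "cb_norm (E_space n) (op_space A) w \<le> ennreal K" and K: "K > 0"
  shows "decomposes n A K (\<lambda>i. w (emat n (kron i)))"
proof -
  define s where "s = 1 + 1 / sqrt (real n)"
  have A: "cstar_algebra A"
    using inj unfolding injective_von_neumann_algebra_def von_neumann_algebra_def by blast
  note AB = cstar_algebraD(1)[OF A]
  obtain P where P: "linear_map (op_space bounded_ops) (op_space A) P" "\<And>a. a \<in> A \<Longrightarrow> P a = a"
    and Pcb: "cb_norm (op_space bounded_ops) (op_space A) P \<le> 1"
    using inj unfolding injective_von_neumann_algebra_def by blast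
  define W where "W i = w (emat n (kron i))" for i
  have WA: "W i \<in> A" for i unfolding W_def by (rule linear_map_emat(1)[OF w])
  have cbW: "hilbert.cb_bounded n K (\<lambda>i. opform (W i))"
    unfolding W_def
  proof (rule hilbert.cb_bounded_of_map[where F = "\<lambda>M. opform (w M)", OF n])
    fix k and X :: "nat \<Rightarrow> nat \<Rightarrow> complex mat" and \<xi> \<eta> :: "nat \<Rightarrow> 'h"
    assume "\<And>p q. X p q \<in> carrier (E_space n)" "mat_opnorm (amplify (2 * n) k X) \<le> 1"
    then have "mnorm (op_space A) k (\<lambda>i j. w (X i j)) \<le> K"
      using K by (intro cb_norm_bound[OF cb]) (auto simp: matrices_over_def)
    then have "op_mnorm k (\<lambda>i j. w (X i j)) \<le> K" by simp
    from op_mnorm_weak_ge[OF this, of \<xi> \<eta>]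
    show "(\<Sum>i<k. \<Sum>j<k. Re (opform (w (X i j)) (\<xi> i) (\<eta> j))) \<le>
        K / 2 * ((\<Sum>i<k. hilbert.sq (\<xi> i)) + (\<Sum>j<k. hilbert.sq (\<eta> j)))"
      by (simp add: opform_def)
  qed (simp_all add: linear_map_emat[OF w] opform_def blinfun.add_left cinner_simps op_scaleC_apply)
  have "\<forall>i<n. sesquilinear scaleC (opform (W i)) \<and> hilbert.respects_null (opform (W i))"
    by (simp add: opform_sesquilinear[OF subsetD[OF AB WA]] opform_respects_null)
  from hilbert.column_row_decomposition[OF n this cbW]
  obtain C where C: "\<And>i. sesquilinear scaleC (C i)"
    and col: "\<And>\<xi> \<eta>. (\<Sum>i<n. Re (C i (\<xi> i) \<eta>)) \<le> K / 2 * ((\<Sum>i<n. hilbert.sq (\<xi> i)) + hilbert.sq \<eta>)"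
    and row: "\<And>\<xi> \<eta>. (\<Sum>i<n. Re (of_real s * opform (W i) \<xi> (\<eta> i) - C i \<xi> (\<eta> i))) \<le>
      K / 2 * (hilbert.sq \<xi> + (\<Sum>i<n. hilbert.sq (\<eta> i)))"
    unfolding s_def by blast
  \<comment> \<open>The column estimate with \<xi> in slot i alone bounds the single form C i, and
    so \<open>operator_of_form\<close> applies.\<close>
  have bound: "Re (C i \<xi> \<eta>) \<le> K * norm \<xi> * norm \<eta>" if i: "i < n" for i \<xi> \<eta>
  proof -
    have "Re (C i \<xi> \<eta>) \<le> K * sqrt ((norm \<xi>)\<^sup>2) * sqrt ((norm \<eta>)\<^sup>2)"
    proof (rule homogenize)
      fix r :: real
      define u where "u j = (if j = i then r *\<^sub>R \<xi> else 0)" for j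
      have "r * Re (C i \<xi> \<eta>) = Re (C i (u i) \<eta>)"
        using sesquilinearD(3)[OF C, of i "of_real r" \<xi> \<eta>] by (simp add: u_def scaleC_of_real)
      also have "\<dots> = (\<Sum>j<n. if j = i then Re (C i (u i) \<eta>) else 0)" using i by simp
      also have "\<dots> = (\<Sum>j<n. Re (C j (u j) \<eta>))"
        by (intro sum.cong refl) (auto simp: u_def sesquilinear_zero[OF C])
      also have "\<dots> \<le> K / 2 * ((\<Sum>j<n. (norm (u j))\<^sup>2) + (norm \<eta>)\<^sup>2)" using col[of u \<eta>] by simp
      also have "(\<Sum>j<n. (norm (u j))\<^sup>2) = (\<Sum>j<n. if j = i then r\<^sup>2 * (norm \<xi>)\<^sup>2 else 0)"
        by (intro sum.cong refl) (auto simp: u_def power_mult_distrib)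
      also have "\<dots> = r\<^sup>2 * (norm \<xi>)\<^sup>2" using i by simp
      finally show "r * Re (C i \<xi> \<eta>) \<le> K / 2 * (r\<^sup>2 * (norm \<xi>)\<^sup>2 + (norm \<eta>)\<^sup>2)" .
    qed (use K in auto)
    then show ?thesis by simp
  qed
  \<comment> \<open>Only the forms with i < n are bounded; beyond n the operator is 0.\<close>
  have "\<exists>T\<in>bounded_ops. i < n \<longrightarrow> (\<forall>\<xi> \<eta>. C i \<xi> \<eta> = cinner \<xi> (blinfun_apply T \<eta>))" for i
  proof (cases "i < n")
    case True
    then show ?thesis using operator_of_form[OF C _ bound[OF True]] K by auto
  next
    case False
    then show ?thesis using subsetD[OF AB cstar_algebraD(2)[OF A]] by blast
  qed
  then obtain T where T: "\<And>i. T i \<in> bounded_ops"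
    "\<And>i \<xi> \<eta>. i < n \<Longrightarrow> C i \<xi> \<eta> = cinner \<xi> (blinfun_apply (T i) \<eta>)" by metis
  define D where "D i = s *\<^sub>R W i - T i" for i
  have D: "D i \<in> bounded_ops" for i
  proof (rule bounded_opsI)
    fix a x
    have Wi: "W i \<in> bounded_ops" by (rule subsetD[OF AB WA])
    have "scaleC a (s *\<^sub>R y - z) = s *\<^sub>R scaleC a y - scaleC a z" for y z :: 'h
    proof -
      have "scaleC a (s *\<^sub>R y - z) + scaleC a z = scaleC a (s *\<^sub>R y)"
        by (simp flip: scaleC_add_right)
      also have "\<dots> = s *\<^sub>R scaleC a y"
        by (simp add: scaleC_scaleC mult.commute flip: scaleC_of_real)
      finally show ?thesis by (simp add: eq_diff_eq)
    qed
    then show "D i (scaleC a x) = scaleC a (D i x)"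
      by (simp add: D_def blinfun.diff_left blinfun.scaleR_left bounded_opsD[OF Wi] bounded_opsD[OF T(1)])
  qed
  have colT: "op_mnorm n (column T) \<le> K"
  proof (rule column_norm_le)
    fix \<xi> :: "nat \<Rightarrow> 'h" and \<eta>
    have "(\<Sum>i<n. Re (opform (T i) (\<xi> i) \<eta>)) = (\<Sum>i<n. Re (C i (\<xi> i) \<eta>))"
      by (intro sum.cong refl) (simp add: T(2) opform_def)
    then show "(\<Sum>i<n. Re (opform (T i) (\<xi> i) \<eta>)) \<le> K / 2 * ((\<Sum>i<n. (norm (\<xi> i))\<^sup>2) + (norm \<eta>)\<^sup>2)"
      using col[of \<xi> \<eta>] by simp
  qed (use K in simp)
  have rowD: "op_mnorm n (row D) \<le> K"
  proof (rule row_norm_le)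
    fix \<xi> and \<eta> :: "nat \<Rightarrow> 'h"
    have "(\<Sum>i<n. Re (opform (D i) \<xi> (\<eta> i))) = (\<Sum>i<n. Re (of_real s * opform (W i) \<xi> (\<eta> i) - C i \<xi> (\<eta> i)))"
      by (intro sum.cong refl)
        (simp add: D_def T(2) opform_def blinfun.diff_left blinfun.scaleR_left cinner_diff cinner_scaleR)
    then show "(\<Sum>i<n. Re (opform (D i) \<xi> (\<eta> i))) \<le> K / 2 * ((norm \<xi>)\<^sup>2 + (\<Sum>i<n. (norm (\<eta> i))\<^sup>2))"
      using row[of \<xi> \<eta>] by simp
  qed (use K in simp)
  have zero: "(0 :: 'h \<Rightarrow>\<^sub>L 'h) \<in> bounded_ops" by (rule subsetD[OF AB cstar_algebraD(2)[OF A]])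
  \<comment> \<open>P maps the zeros of the padding to zeros, so images of padded columns and rows
    are again padded columns and rows.\<close>
  have P0: "P 0 = 0" by (rule P(2)[OF cstar_algebraD(2)[OF A]])
  have colP: "op_mnorm n (column (\<lambda>i. P (T i))) \<le> K"
  proof -
    have "op_mnorm n (\<lambda>i j. P (column T i j)) \<le> K"
      using T(1) zero by (intro completely_contractive_scaled[OF P(1) AB Pcb _ colT K]) (simp add: column_def)
    also have "(\<lambda>i j. P (column T i j)) = column (\<lambda>i. P (T i))" by (simp add: column_def P0 fun_eq_iff)
    finally show ?thesis .
  qed
  have rowP: "op_mnorm n (row (\<lambda>i. P (D i))) \<le> K"
  proof -
    have "op_mnorm n (\<lambda>i j. P (row D i j)) \<le> K"
      using D zero by (intro completely_contractive_scaled[OF P(1) AB Pcb _ rowD K]) (simp add: row_def)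
    also have "(\<lambda>i j. P (row D i j)) = row (\<lambda>i. P (D i))" by (simp add: row_def P0 fun_eq_iff)
    finally show ?thesis .
  qed
  \<comment> \<open>The sum T i + D i = s W i lies in A and is fixed by P; the decomposition is
    exact here.\<close>
  have "P (T i) + P (D i) = s *\<^sub>R W i" for i
    using linear_mapD(2)[OF P(1), of "T i" "D i"] T(1) D P(2)[OF cstar_algebra_scaleR[OF A WA]]
    by (simp add: D_def)
  moreover have "P (T i) \<in> A" "P (D i) \<in> A" for i
    using linear_mapD(1)[OF P(1)] T(1) D by auto
  ultimately show ?thesis
    unfolding decomposes_def W_def[symmetric] s_def[symmetric]
    using colP rowP by (intro allI impI exI[of _ "\<lambda>i. P (T i)"] exI[of _ "\<lambda>i. P (D i)"]) simp
qed

text \<open>The form C found by Hahn-Banach lives on all functions and may depend on values from N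
  on. Truncation makes it a matrix form.\<close>

lemma mform_of_form:
  fixes N :: nat and x y :: "nat \<Rightarrow> complex"
  assumes C: "sesquilinear fscale C"
  defines "\<pi> \<equiv> \<lambda>x r. if r < N then x r else 0"
  shows "mform N (mat N N (\<lambda>(r, s). C (kron r) (kron s))) x y = C (\<pi> x) (\<pi> y)"
proof -
  have \<pi>: "\<pi> x = (\<Sum>r<N. fscale (x r) (kron r))" for x
  proof
    fix t
    have "(\<Sum>r<N. fscale (x r) (kron r) t) = (\<Sum>r<N. if r = t then x t else 0)"
      by (intro sum.cong) (auto simp: fscale_def kron_def)
    then show "\<pi> x t = (\<Sum>r<N. fscale (x r) (kron r)) t"
      by (simp add: \<pi>_def sum_fun_apply)
  qed
  show ?thesis
    unfolding \<pi> sesquilinear_sum(1)[OF C] sesquilinear_sum(2)[OF C] mform_def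
    by (simp add: sum_distrib_left mult_ac) (rule sum.swap)
qed

lemma nuclear_decomposes:
  fixes A :: "('h::complex_hilbert_space \<Rightarrow>\<^sub>L 'h) set"
  assumes n: "n \<ge> 1" and nuc: "nuclear_cstar_algebra A"
    and w: "linear_map (E_space n) (op_space A) w"
    and cb: "cb_norm (E_space n) (op_space A) w \<le> ennreal K" and K: "K > 0"
  shows "decomposes n A K (\<lambda>i. w (emat n (kron i)))"
  unfolding decomposes_def
proof (intro allI impI)
  fix \<epsilon> :: real assume \<epsilon>: "\<epsilon> > 0"
  define s where "s = 1 + 1 / sqrt (real n)"
  have s: "s > 0" unfolding s_def by (simp add: add_pos_nonneg)
  have A: "cstar_algebra A" using nuc unfolding nuclear_cstar_algebra_def by blast
  define W where "W i = w (emat n (kron i))" for i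
  have WA: "W i \<in> A" for i unfolding W_def by (rule linear_map_emat(1)[OF w])
  \<comment> \<open>The tolerance \<epsilon> / s compensates the factor s in the decomposition of s
    W.\<close>
  have "finite (W ` {..<n}) \<and> W ` {..<n} \<subseteq> A \<and> \<epsilon> / s > 0" using WA \<epsilon> s by auto
  then obtain N \<phi> \<psi> where \<phi>: "linear_map (op_space A) (M_space N) \<phi>"
      "completely_positive (op_space A) (M_space N) \<phi>" "contractive (op_space A) (M_space N) \<phi>"
    and \<psi>: "linear_map (M_space N) (op_space A) \<psi>"
      "completely_positive (M_space N) (op_space A) \<psi>" "contractive (M_space N) (op_space A) \<psi>"
    and close: "\<forall>a\<in>W ` {..<n}. norm (\<psi> (\<phi> a) - a) < \<epsilon> / s"
    using nuc unfolding nuclear_cstar_algebra_def by meson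
  have \<phi>M: "\<phi> T \<in> carrier_mat N N" if "T \<in> A" for T
    using linear_mapD(1)[OF \<phi>(1), of T] that by simp
  have \<psi>A: "\<psi> M \<in> A" if "M \<in> carrier_mat N N" for M
    using linear_mapD(1)[OF \<psi>(1), of M] that by simp
  have cbW: "fin.cb_bounded N n K (\<lambda>i. mform N (\<phi> (W i)))"
    unfolding W_def
  proof (rule fin.cb_bounded_of_map[where F = "\<lambda>M. mform N (\<phi> (w M))", OF n])
    fix c d \<xi> \<eta>
    show "mform N (\<phi> (w (emat n (\<lambda>i. c i + d i)))) \<xi> \<eta> =
        mform N (\<phi> (w (emat n c))) \<xi> \<eta> + mform N (\<phi> (w (emat n d))) \<xi> \<eta>"
      using linear_mapD(2)[OF \<phi>(1), of "w (emat n c)" "w (emat n d)"]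
      by (simp add: linear_map_emat[OF w] mform_add[OF \<phi>M \<phi>M])
  next
    fix a c \<xi> \<eta>
    show "mform N (\<phi> (w (emat n (\<lambda>i. a * c i)))) \<xi> \<eta> = a * mform N (\<phi> (w (emat n c))) \<xi> \<eta>"
      using linear_mapD(3)[OF \<phi>(1), of "w (emat n c)" a]
      by (simp add: linear_map_emat[OF w] mform_scale[OF \<phi>M])
  next
    fix k and X :: "nat \<Rightarrow> nat \<Rightarrow> complex mat" and \<xi> \<eta> :: "nat \<Rightarrow> nat \<Rightarrow> complex"
    assume X: "\<And>p q. X p q \<in> carrier (E_space n)" "mat_opnorm (amplify (2 * n) k X) \<le> 1"
    then have "mnorm (op_space A) k (\<lambda>i j. w (X i j)) \<le> K"
      using K by (intro cb_norm_bound[OF cb]) (auto simp: matrices_over_def)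
    then have "op_mnorm k (\<lambda>i j. w (X i j)) \<le> K" by simp
    moreover have "w (X i j) \<in> A" for i j using linear_mapD(1)[OF w X(1)] by simp
    ultimately show "(\<Sum>i<k. \<Sum>j<k. Re (mform N (\<phi> (w (X i j))) (\<xi> i) (\<eta> j))) \<le>
        K / 2 * ((\<Sum>i<k. fin.sq N (\<xi> i)) + (\<Sum>j<k. fin.sq N (\<eta> j)))"
      by (intro cp_to_matrices[OF A \<phi>])
  qed
  have "\<forall>i<n. sesquilinear fscale (mform N (\<phi> (W i))) \<and> fin.respects_null N (mform N (\<phi> (W i)))"
    by (simp add: mform_sesquilinear mform_respects_null)
  from fin.column_row_decomposition[OF n this cbW]
  obtain C where C: "\<And>i. sesquilinear fscale (C i)"
    and col: "\<And>\<xi> \<eta>. (\<Sum>i<n. Re (C i (\<xi> i) \<eta>)) \<le> K / 2 * ((\<Sum>i<n. fin.sq N (\<xi> i)) + fin.sq N \<eta>)"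
    and row: "\<And>\<xi> \<eta>. (\<Sum>i<n. Re (of_real s * mform N (\<phi> (W i)) \<xi> (\<eta> i) - C i \<xi> (\<eta> i))) \<le>
      K / 2 * (fin.sq N \<xi> + (\<Sum>i<n. fin.sq N (\<eta> i)))"
    unfolding s_def by blast
  define T where "T i = mat N N (\<lambda>(r, q). C i (kron r) (kron q))" for i
  define D where "D i = complex_of_real s \<cdot>\<^sub>m \<phi> (W i) + (- 1) \<cdot>\<^sub>m T i" for i
  \<comment> \<open>Truncation changes neither \<open>fin.sq N\<close> nor \<open>mform N\<close>,
    so the estimates for C carry over to the matrices T i and D i.\<close>
  define \<pi> where "\<pi> x r = (if r < N then x r else 0)" for x :: "nat \<Rightarrow> complex" and r
  have TM: "T i \<in> carrier_mat N N" and DM: "D i \<in> carrier_mat N N" for i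
    unfolding T_def D_def using \<phi>M[OF WA] by simp_all
  have T_form: "mform N (T i) x y = C i (\<pi> x) (\<pi> y)" for i x y
    unfolding T_def \<pi>_def by (rule mform_of_form[OF C])
  have \<pi>_sq: "fin.sq N (\<pi> x) = fin.sq N x" for x by (simp add: fin_sq \<pi>_def)
  have \<pi>_form: "mform N M (\<pi> x) (\<pi> y) = mform N M x y" for M x y by (simp add: mform_def \<pi>_def)
  have colT: "mat_opnorm (amplify N n (\<lambda>i j. if j = 0 then T i else 0\<^sub>m N N)) \<le> K"
  proof (rule mat_column_norm_le)
    fix \<xi> and \<eta> :: "nat \<Rightarrow> complex"
    show "(\<Sum>i<n. Re (mform N (T i) (\<xi> i) \<eta>)) \<le> K / 2 * ((\<Sum>i<n. fin.sq N (\<xi> i)) + fin.sq N \<eta>)"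
      using col[of "\<lambda>i. \<pi> (\<xi> i)" "\<pi> \<eta>"] by (simp add: T_form \<pi>_sq)
  qed (use K in simp)
  have rowD: "mat_opnorm (amplify N n (\<lambda>i j. if i = 0 then D j else 0\<^sub>m N N)) \<le> K"
  proof (rule mat_row_norm_le)
    fix \<xi> :: "nat \<Rightarrow> complex" and \<eta>
    have "mform N (D i) x y = of_real s * mform N (\<phi> (W i)) x y - C i (\<pi> x) (\<pi> y)" for i x y
      unfolding D_def using \<phi>M[OF WA, of i] TM[of i]
      by (simp add: mform_add[of _ N] mform_scale[of _ N] T_form)
    then show "(\<Sum>i<n. Re (mform N (D i) \<xi> (\<eta> i))) \<le> K / 2 * (fin.sq N \<xi> + (\<Sum>i<n. fin.sq N (\<eta> i)))"
      using row[of "\<pi> \<xi>" "\<lambda>i. \<pi> (\<eta> i)"] by (simp add: \<pi>_sq \<pi>_form)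
  qed (use K in simp)
  have \<psi>0: "\<psi> (0\<^sub>m N N) = 0"
    using linear_mapD(3)[OF \<psi>(1), of "0\<^sub>m N N" 0] by (simp add: op_scaleC_zero)
  have "op_mnorm n (column (\<lambda>i. \<psi> (T i))) \<le> K"
  proof -
    have "op_mnorm n (\<lambda>i j. \<psi> (if j = 0 then T i else 0\<^sub>m N N)) \<le> K"
      using TM colT by (intro cp_from_matrices[OF A \<psi>]) auto
    also have "(\<lambda>i j. \<psi> (if j = 0 then T i else 0\<^sub>m N N)) = column (\<lambda>i. \<psi> (T i))"
      by (simp add: column_def \<psi>0 fun_eq_iff)
    finally show ?thesis .
  qed
  moreover have "op_mnorm n (row (\<lambda>i. \<psi> (D i))) \<le> K"
  proof -
    have "op_mnorm n (\<lambda>i j. \<psi> (if i = 0 then D j else 0\<^sub>m N N)) \<le> K"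
      using DM rowD by (intro cp_from_matrices[OF A \<psi>]) auto
    also have "(\<lambda>i j. \<psi> (if i = 0 then D j else 0\<^sub>m N N)) = row (\<lambda>i. \<psi> (D i))"
      by (simp add: row_def \<psi>0 fun_eq_iff)
    finally show ?thesis .
  qed
  moreover have "norm (\<psi> (T i) + \<psi> (D i) - s *\<^sub>R W i) \<le> \<epsilon>" if i: "i < n" for i
  proof -
    have "T i + D i = complex_of_real s \<cdot>\<^sub>m \<phi> (W i)"
      unfolding D_def using \<phi>M[OF WA, of i] TM[of i] by (intro eq_matI) auto
    then have "\<psi> (T i) + \<psi> (D i) = s *\<^sub>R \<psi> (\<phi> (W i))"
      using linear_mapD(2)[OF \<psi>(1), of "T i" "D i"] linear_mapD(3)[OF \<psi>(1), of "\<phi> (W i)" "of_real s"]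
        TM[of i] DM[of i] \<phi>M[OF WA, of i]
      by (simp add: op_scaleC_of_real)
    then have "norm (\<psi> (T i) + \<psi> (D i) - s *\<^sub>R W i) = s * norm (\<psi> (\<phi> (W i)) - W i)"
      using s by (simp flip: scaleR_diff_right)
    also have "\<dots> \<le> s * (\<epsilon> / s)"
      using close i s by (intro mult_left_mono) (auto intro: less_imp_le)
    finally show ?thesis using s by simp
  qed
  ultimately show "\<exists>c d. (\<forall>i. c i \<in> A \<and> d i \<in> A) \<and> op_mnorm n (column c) \<le> K \<and> op_mnorm n (row d) \<le> K \<and>
      (\<forall>i<n. norm (c i + d i - (1 + 1 / sqrt (real n)) *\<^sub>R w (emat n (kron i))) \<le> \<epsilon>)"
    unfolding W_def[symmetric] s_def[symmetric]
    by (intro exI[of _ "\<lambda>i. \<psi> (T i)"] exI[of _ "\<lambda>i. \<psi> (D i)"]) (simp add: \<psi>A TM DM)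
qed

section \<open>From the decomposition to the constant\<close>

lemma factorization_bound:
  fixes A :: "('h::complex_hilbert_space \<Rightarrow>\<^sub>L 'h) set"
  assumes n: "n \<ge> 1" and A: "cstar_algebra A"
    and w: "linear_map (E_space n) (op_space A) w"
    and v: "linear_map (op_space A) (E_space n) v"
    and id: "\<forall>x\<in>carrier (E_space n). v (w x) = x"
    and cb: "cb_norm (op_space A) (E_space n) v \<le> ennreal V" and V: "V \<ge> 0"
    and K: "K > 0" and dec: "decomposes n A K (\<lambda>i. w (emat n (kron i)))"
  shows "1 + sqrt (real n) \<le> 2 * (V * K)"
proof -
  define s where "s = 1 + 1 / sqrt (real n)"
  define W where "W i = w (emat n (kron i))" for i
  have WA: "W i \<in> A" for i unfolding W_def by (rule linear_map_emat(1)[OF w])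
  have vW: "v (W i) = emat n (kron i)" for i
    using id unfolding W_def by (simp add: E_space_carrier)
  have bound: "mat_opnorm (amplify (2 * n) k (\<lambda>i j. v (X i j))) \<le> V"
    if "X \<in> matrices_over k (op_space A)" "op_mnorm k X \<le> 1" for k X
    using cb_norm_bound[OF cb V that(1)] that(2) by simp
  have vE: "v T \<in> carrier (E_space n)" if "T \<in> A" for T
    using linear_mapD(1)[OF v, of T] that by simp
  have vM: "v T \<in> carrier_mat (2 * n) (2 * n)" if "T \<in> A" for T
    using vE[OF that] by (rule E_space_carrier_mat)
  \<comment> \<open>The column test sees the entry (i, 0), the row test the entry (n, n + i). In E_n
    these agree, which allows the two bounds to be added.\<close>
  have coord: "M $$ (n, n + i) = M $$ (i, 0)" if "M \<in> carrier (E_space n)" "i < n" for M i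
    using that by (auto simp: E_space_carrier emat_index)
  have rn: "sqrt (real n) > 0" "sqrt (real n) * sqrt (real n) = real n" using n by simp_all
  have key: "real n * s \<le> 2 * (sqrt (real n) * (V * K)) + real n * (V * \<epsilon>)" if \<epsilon>: "\<epsilon> > 0" for \<epsilon>
  proof -
    obtain c d where cd: "\<And>i. c i \<in> A" "\<And>i. d i \<in> A"
      and norms: "op_mnorm n (column c) \<le> K" "op_mnorm n (row d) \<le> K"
      and close: "\<And>i. i < n \<Longrightarrow> norm (c i + d i - s *\<^sub>R W i) \<le> \<epsilon>"
      using dec \<epsilon> unfolding decomposes_def W_def s_def by blast
    have "s - V * \<epsilon> \<le> Re (v (c i) $$ (i, 0)) + Re (v (d i) $$ (n, n + i))" if i: "i < n" for i
    proof -
      define R where "R = c i + d i - s *\<^sub>R W i"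
      have R: "R \<in> A"
        unfolding R_def using cd WA by (intro cstar_algebra_diff[OF A] cstar_algebraD(3)[OF A]
            cstar_algebra_scaleR[OF A])
      have "op_mnorm 1 (\<lambda>_ _. R) \<le> \<epsilon>"
        unfolding op_mnorm_one R_def by (rule close[OF i])
      \<comment> \<open>The error R of the decomposition is not small in E_n by itself, but the cb
        bound at level 1 makes v R at most V \<epsilon>.\<close>
      then have le: "mat_opnorm (amplify (2 * n) 1 (\<lambda>_ _. v R)) \<le> V * \<epsilon>"
        by (intro mnorm_bound_scaled[where X = "\<lambda>_ _. R", OF v cstar_algebraD(4)[OF A] bound R _ \<epsilon>])
      have "- Re (v R $$ (i, 0)) \<le> V * \<epsilon>"
        using mat_mnorm_weak_ge[OF le, of "\<lambda>_. fscale (- 1) (kron i)" "\<lambda>_. fscale 1 (kron 0)"] i n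
        by (simp add: mform_kron fin_sq_kron)
      moreover have "v (c i) + v (d i) = complex_of_real s \<cdot>\<^sub>m emat n (kron i) + v R"
      proof -
        have "v (c i) + v (d i) = v (c i + d i)"
          using linear_mapD(2)[OF v, of "c i" "d i"] cd by simp
        also have "c i + d i = op_scaleC (of_real s) (W i) + R" by (simp add: R_def op_scaleC_of_real)
        also have "v \<dots> = v (op_scaleC (of_real s) (W i)) + v R"
          using linear_mapD(2)[OF v, of "op_scaleC (of_real s) (W i)" R] R cstar_algebraD(4)[OF A WA] by simp
        also have "v (op_scaleC (of_real s) (W i)) = of_real s \<cdot>\<^sub>m emat n (kron i)"
          using linear_mapD(3)[OF v, of "W i" "of_real s"] WA by (simp add: vW)
        finally show ?thesis .
      qed
      then have "(v (c i) + v (d i)) $$ (i, 0) = (complex_of_real s \<cdot>\<^sub>m emat n (kron i) + v R) $$ (i, 0)"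
        by simp
      then have "v (c i) $$ (i, 0) + v (d i) $$ (i, 0) = of_real s + v R $$ (i, 0)"
        using i vM[OF cd(1), of i] vM[OF cd(2), of i] vM[OF R] by (simp add: emat_index kron_def)
      then have "Re (v (c i) $$ (i, 0)) + Re (v (d i) $$ (i, 0)) = s + Re (v R $$ (i, 0))"
        by (metis Re_complex_of_real plus_complex.sel(1))
      ultimately show ?thesis using coord[OF vE[OF cd(2)] i] by simp
    qed
    then have "(\<Sum>i<n. s - V * \<epsilon>) \<le> (\<Sum>i<n. Re (v (c i) $$ (i, 0)) + Re (v (d i) $$ (n, n + i)))"
      by (intro sum_mono) simp
    also have "\<dots> \<le> sqrt (real n) * (V * K) + sqrt (real n) * (V * K)"
      unfolding sum.distrib
      by (intro add_mono E_space_trace_bound[OF n v cstar_algebraD(2)[OF A] cstar_algebraD(4)[OF A] bound cd K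
          norms])
    finally show ?thesis by (simp add: algebra_simps)
  qed
  have "real n * s \<le> 2 * (sqrt (real n) * (V * K))"
  proof (rule field_le_epsilon)
    fix e :: real assume e: "e > 0"
    define \<epsilon> where "\<epsilon> = e / (real n * (V + 1))"
    have pos: "real n * (V + 1) > 0" using n V by simp
    have "\<epsilon> > 0" unfolding \<epsilon>_def using e pos by simp
    moreover have "real n * (V * \<epsilon>) \<le> e"
    proof -
      have "real n * (V * \<epsilon>) \<le> (real n * (V + 1)) * \<epsilon>"
        using \<open>\<epsilon> > 0\<close> by (simp add: algebra_simps)
      moreover have "c * (e / c) = e" if "c > 0" for c using that by simp
      from this[OF pos] have "(real n * (V + 1)) * \<epsilon> = e" unfolding \<epsilon>_def .
      ultimately show ?thesis by simp
    qed
    ultimately show "real n * s \<le> 2 * (sqrt (real n) * (V * K)) + e" using key[of \<epsilon>] by linarith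
  qed
  \<comment> \<open>Since s = (1 + sqrt n) / sqrt n, one factor sqrt n cancels and 1 + sqrt n
    remains.\<close>
  also have "real n * s = sqrt (real n) * (1 + sqrt (real n))"
    unfolding s_def using rn by (simp add: field_simps)
  finally have "sqrt (real n) * (1 + sqrt (real n)) \<le> sqrt (real n) * (2 * (V * K))" by simp
  then show ?thesis using rn(1) by (rule mult_left_le_imp_le)
qed

text \<open>If either map had cb norm 0, then v w would kill the nonzero element \<delta> 0. This
  excludes a product 0 times \<infinity> and provides the K > 0 by which arrays are
  normalized.\<close>

lemma factorization_cb_nonzero:
  fixes A :: "('h::complex_hilbert_space \<Rightarrow>\<^sub>L 'h) set"
  assumes n: "n \<ge> 1" and A: "cstar_algebra A"
    and w: "linear_map (E_space n) (op_space A) w"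
    and v: "linear_map (op_space A) (E_space n) v"
    and id: "\<forall>x\<in>carrier (E_space n). v (w x) = x"
  shows "cb_norm (E_space n) (op_space A) w \<noteq> 0" "cb_norm (op_space A) (E_space n) v \<noteq> 0"
proof -
  define T where "T = w (emat n (kron 0))"
  have TA: "T \<in> A" unfolding T_def by (rule linear_map_emat(1)[OF w])
  have vT: "v T = emat n (kron 0)" using id unfolding T_def by (simp add: E_space_carrier)
  have coord: "emat n (kron 0) $$ (0, 0) = 1" using n by (simp add: emat_index kron_def)
  show "cb_norm (E_space n) (op_space A) w \<noteq> 0"
  proof
    assume "cb_norm (E_space n) (op_space A) w = 0"
    then have cb: "cb_norm (E_space n) (op_space A) w \<le> ennreal 0" by simp
    have delta: "(\<Sum>i<n. (cmod (kron 0 i * z))\<^sup>2) = (cmod z)\<^sup>2" for z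
    proof -
      have "(\<Sum>i<n. (cmod (kron 0 i * z))\<^sup>2) = (\<Sum>i<n. if i = 0 then (cmod z)\<^sup>2 else 0)"
        by (intro sum.cong refl) (auto simp: kron_def)
      then show ?thesis using n by simp
    qed
    have "mat_opnorm (amplify (2 * n) 1 (\<lambda>p q. emat n (\<lambda>i. kron 0 i))) \<le> 1"
      by (rule emat_unit_ball[OF n, where x = "\<lambda>i p q. kron 0 i"]) (simp_all add: delta)
    then have "mnorm (op_space A) 1 (\<lambda>i j. w (emat n (kron 0))) \<le> 0"
      by (intro cb_norm_bound[OF cb, where X = "\<lambda>_ _. emat n (kron 0)"])
          (auto simp: matrices_over_def E_space_carrier)
    then have "norm T \<le> 0" by (simp add: T_def op_mnorm_one[unfolded One_nat_def])
    then have T0: "T = op_scaleC 0 T" by (simp add: op_scaleC_zero)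
    have "v T = 0 \<cdot>\<^sub>m v T"
      using linear_mapD(3)[OF v, of T 0] TA T0 by simp
    then have "emat n (kron 0) $$ (0, 0) = (0 \<cdot>\<^sub>m emat n (kron 0)) $$ (0, 0)" unfolding vT by simp
    then show False using coord n by simp
  qed
  show "cb_norm (op_space A) (E_space n) v \<noteq> 0"
  proof
    assume "cb_norm (op_space A) (E_space n) v = 0"
    then have cb: "cb_norm (op_space A) (E_space n) v \<le> ennreal 0" by simp
    have bound: "mat_opnorm (amplify (2 * n) k (\<lambda>i j. v (X i j))) \<le> 0"
      if "X \<in> matrices_over k (op_space A)" "op_mnorm k X \<le> 1" for k X
      using cb_norm_bound[OF cb _ that(1)] that(2) by simp
    have "mat_opnorm (amplify (2 * n) 1 (\<lambda>_ _. v T)) \<le> 0 * (norm T + 1)"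
      by (rule mnorm_bound_scaled[where X = "\<lambda>_ _. T", OF v cstar_algebraD(4)[OF A] bound TA])
        (simp_all add: op_mnorm_one[unfolded One_nat_def] add_nonneg_pos)
    from mat_mnorm_weak_ge[OF this, of "\<lambda>_. fscale 1 (kron 0)" "\<lambda>_. fscale 1 (kron 0)"]
    show False using n by (simp add: mform_kron vT coord)
  qed
qed

theorem theorem4p1:
  fixes A :: "('h::complex_hilbert_space \<Rightarrow>\<^sub>L 'h) set"
    and n :: nat
    and v :: "('h \<Rightarrow>\<^sub>L 'h) \<Rightarrow> complex mat"
    and w :: "complex mat \<Rightarrow> ('h \<Rightarrow>\<^sub>L 'h)"
  assumes "nuclear_cstar_algebra A \<or> injective_von_neumann_algebra A"
    and "n \<ge> 1"
    and "linear_map (E_space n) (op_space A) w"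
    and "linear_map (op_space A) (E_space n) v"
    and "\<forall>x\<in>carrier (E_space n). v (w x) = x"
  shows "cb_norm (op_space A) (E_space n) v * cb_norm (E_space n) (op_space A) w
           \<ge> ennreal (1 / 2 * (1 + sqrt (real n)))"
proof -
  have A: "cstar_algebra A"
    using assms(1) unfolding nuclear_cstar_algebra_def injective_von_neumann_algebra_def
      von_neumann_algebra_def by blast
  note nonzero = factorization_cb_nonzero[OF assms(2) A assms(3-5)]
  show ?thesis
  proof (cases "cb_norm (op_space A) (E_space n) v = top_class.top \<or> cb_norm (E_space n) (op_space A) w =
      top_class.top")
    \<comment> \<open>In \<open>ennreal\<close>, 0 times \<infinity> is 0; as both factors are
      nonzero, the product is \<infinity>.\<close>
    case True
    then have "cb_norm (op_space A) (E_space n) v * cb_norm (E_space n) (op_space A) w = top_class.top"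
      using nonzero by (auto simp: ennreal_mult_eq_top_iff)
    then show ?thesis by simp
  next
    case False
    obtain V where V: "cb_norm (op_space A) (E_space n) v = ennreal V" "V \<ge> 0"
      using False by (cases "cb_norm (op_space A) (E_space n) v" rule: ennreal_cases) auto
    obtain K where K: "cb_norm (E_space n) (op_space A) w = ennreal K" "K \<ge> 0"
      using False by (cases "cb_norm (E_space n) (op_space A) w" rule: ennreal_cases) auto
    have K0: "K > 0" using nonzero(1) K by (cases "K = 0") auto
    have dec: "decomposes n A K (\<lambda>i. w (emat n (kron i)))"
      using assms(1) nuclear_decomposes[OF assms(2) _ assms(3) _ K0]
        injective_decomposes[OF assms(2) _ assms(3) _ K0] K(1) by auto
    have "1 + sqrt (real n) \<le> 2 * (V * K)"
      by (rule factorization_bound[OF assms(2) A assms(3-5) _ V(2) K0 dec]) (simp add: V)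
    then have "ennreal (1 / 2 * (1 + sqrt (real n))) \<le> ennreal (V * K)"
      by (intro ennreal_leI) simp
    then show ?thesis by (simp add: V K ennreal_mult)
  qed
qed

end
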